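(* Let $1\le k<n$ and $m\ge 1$ be integers, and let $F_\alpha^A=F_\alpha^A(x,p,p')$, for $A=1,\dots,m$ and $\alpha=k+1,\dots,n$, be real-valued, real-analytic functions defined in an open subset $U$ of $\mathbb{R}^n\times\mathbb{R}^m\times\mathbb{R}^{mk}$. The following are equivalent. (i) The Cauchy problem $$\frac{\partial u^A}{\partial x^\alpha}=F_\alpha^A\Big(x,u,\frac{\partial u}{\partial x^1},\dots,\frac{\partial u}{\partial x^k}\Big),\qquad u^A(x^1,\dots,x^k,x_0^{k+1},\dots,x_0^n)=a^A(x^1,\dots,x^k),$$ ($A=1,\dots,m$, $\alpha=k+1,\dots,n$) is solvable for every initial data at every $(x_0,p_0,p_0')\in U$. (ii) This Cauchy problem is approximately solvable for every initial data at every $(x_0,p_0,p_0')\in U$. (iii) The functions $F_\alpha^A$ satisfy $$\Phi^A_{\alpha\beta}(x,p,p')=\Phi^A_{\beta\alpha}(x,p,p'),\qquad \Psi^{A\Gamma\Lambda}_{\alpha\beta C}(x,p,p')=\Psi^{A\Gamma\Lambda}_{\beta\alpha C}(x,p,p')$$ for all $A,C=1,\dots,m$, $\Lambda,\Gamma=1,\dots,k$, $\alpha,\beta=k+1,\dots,n$ and all $(x,p,p')\in U$, where $$\Phi^A_{\alpha\beta}:=\frac{\partial F^A_\alpha}{\partial x^\beta}+\sum_{B=1}^m\frac{\partial F^A_\alpha}{\partial p^B}F^B_\beta+\sum_{\Gamma=1}^k\sum_{B=1}^m\frac{\partial F^A_\alpha}{\partial p^B_\Gamma}\Big(\frac{\partial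 F^B_\beta}{\partial x^\Gamma}+\sum_{C=1}^m\frac{\partial F^B_\beta}{\partial p^C}p^C_\Gamma\Big),$$ $$\Psi^{A\Gamma\Lambda}_{\alpha\beta C}:=\sum_{B=1}^m\Big(\frac{\partial F^A_\alpha}{\partial p^B_\Gamma}\frac{\partial F^B_\beta}{\partial p^C_\Lambda}+\frac{\partial F^A_\alpha}{\partial p^B_\Lambda}\frac{\partial F^B_\beta}{\partial p^C_\Gamma}\Big).$$
   Context: Coordinates: $x=(x^1,\dots,x^n)\in\mathbb{R}^n$, and on $\mathbb{R}^n\times\mathbb{R}^m\times\mathbb{R}^{mk}$ the coordinates are $(x,p,p')$ with $p=(p^A)_{A=1,\dots,m}$, $p'=(p^A_\Gamma)_{A=1,\dots,m,\ \Gamma=1,\dots,k}$. A point $(x_0,p_0,p_0')\in U$ is fixed; an admissible initial datum at this point is a real-analytic $\mathbb{R}^m$-valued function $a=(a^1,\dots,a^m)$ defined near $(x_0^1,\dots,x_0^k)\in\mathbb{R}^k$ with $a(x_0^1,\dots,x_0^k)=p_0$ and $\big(\frac{\partial a}{\partial x^1},\dots,\frac{\partial a}{\partial x^k}\big)(x_0^1,\dots,x_0^k)=p_0'$. The Cauchy problem is solvable for every initial data at $(x_0,p_0,p_0')$ if for every admissible initial datum $a$ there is a unique real-analytic solution $u=(u^1,\dots,u^m)$ of the Cauchy problem in an open neighborhood of $x_0$. A real-analytic $\mathbb{R}^m$-valued function $u$ defined near $x_0$ is an approximate solution at $x_0$ (for the datum $a$) if $\frac{\partial u^A}{\partial x^\alpha}=F^A_\alpha(x,u,\frac{\partial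 u}{\partial x^1},\dots,\frac{\partial u}{\partial x^k})+O(\sum_{i=1}^n|x^i-x_0^i|^2)$ and $u^A(x^1,\dots,x^k,x_0^{k+1},\dots,x_0^n)=a^A(x^1,\dots,x^k)+O(\sum_{j=1}^k|x^j-x_0^j|^3)$ for all $A,\alpha$. The Cauchy problem is approximately solvable for every initial data at $(x_0,p_0,p_0')$ if for every admissible initial datum $a$ there exists an approximate solution at $x_0$. *)

theory Defs
  imports "HOL-Analysis.Analysis"
begin

text \<open>Conventions. Points of R^n are pairs (y, z) with y in R^k (the coordinates
x^1..x^k) and z in R^(n-k) (the coordinates x^(k+1)..x^n); the index types
'k, 'l, 'm are arbitrary finite (hence nonempty) types, of cardinalities
k, n-k, m. A point of R^n x R^m x R^(mk) is (x, p, p') with p' $ A $ G = p^A_G.\<close>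

type_synonym ('k,'l,'m) jetpt = "((real^'k) \<times> (real^'l)) \<times> (real^'m) \<times> (real^'k^'m)"

definition real_analytic_on :: "('a::euclidean_space \<Rightarrow> real) \<Rightarrow> 'a set \<Rightarrow> bool" where
  "real_analytic_on f S \<longleftrightarrow>
     (\<forall>a\<in>S. \<exists>r>0. \<exists>c :: ('a \<Rightarrow> nat) \<Rightarrow> real.
        \<forall>x\<in>ball a r.
          ((\<lambda>\<alpha>. c \<alpha> * (\<Prod>b\<in>Basis. ((x - a) \<bullet> b) ^ \<alpha> b)) has_sum f x)
            {\<alpha>. \<forall>b. b \<notin> Basis \<longrightarrow> \<alpha> b = 0})"

definition pdiff :: "('a::real_normed_vector \<Rightarrow> real) \<Rightarrow> 'a \<Rightarrow> 'a \<Rightarrow> real" where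
  "pdiff f v w = deriv (\<lambda>t. f (w + t *\<^sub>R v)) 0"

definition exk :: "'k::finite \<Rightarrow> ((real^'k) \<times> (real^'l::finite))" where
  "exk G = (axis G 1, 0)"

definition exl :: "'l::finite \<Rightarrow> ((real^'k::finite) \<times> (real^'l))" where
  "exl j = (0, axis j 1)"

definition dxk :: "'k \<Rightarrow> ('k::finite,'l::finite,'m::finite) jetpt" where
  "dxk G = (exk G, 0, 0)"

definition dxl :: "'l \<Rightarrow> ('k::finite,'l::finite,'m::finite) jetpt" where
  "dxl j = (exl j, 0, 0)"

definition dp :: "'m \<Rightarrow> ('k::finite,'l::finite,'m::finite) jetpt" where
  "dp B = (0, axis B 1, 0)"

definition dp' :: "'m \<Rightarrow> 'k \<Rightarrow> ('k::finite,'l::finite,'m::finite) jetpt" where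
  "dp' B G = (0, 0, axis B (axis G 1))"

definition jet_of :: "(((real^'k) \<times> (real^'l)) \<Rightarrow> (real^'m)) \<Rightarrow> ((real^'k) \<times> (real^'l))
                       \<Rightarrow> ('k::finite,'l::finite,'m::finite) jetpt" where
  "jet_of u x = (x, u x, (\<chi> A G. pdiff (\<lambda>y. u y $ A) (exk G) x))"

definition admissible_datum ::
  "((real^'k) \<Rightarrow> (real^'m)) \<Rightarrow> ((real^'k::finite) \<times> (real^'l::finite)) \<Rightarrow> (real^'m::finite) \<Rightarrow> (real^'k^'m) \<Rightarrow> bool" where
  "admissible_datum a x0 p0 p0' \<longleftrightarrow>
     (\<exists>D. open D \<and> fst x0 \<in> D \<and> (\<forall>A. real_analytic_on (\<lambda>y. a y $ A) D) \<and>
          a (fst x0) = p0 \<and>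
          (\<forall>A G. pdiff (\<lambda>y. a y $ A) (axis G 1) (fst x0) = p0' $ A $ G))"

definition cauchy_solution ::
  "('m \<Rightarrow> 'l \<Rightarrow> ('k,'l,'m) jetpt \<Rightarrow> real) \<Rightarrow> ('k,'l,'m) jetpt set \<Rightarrow> ((real^'k) \<Rightarrow> (real^'m))
   \<Rightarrow> ((real^'k::finite) \<times> (real^'l::finite)) \<Rightarrow> ((real^'k) \<times> (real^'l)) set
   \<Rightarrow> (((real^'k) \<times> (real^'l)) \<Rightarrow> (real^'m::finite)) \<Rightarrow> bool" where
  "cauchy_solution F U a x0 V u \<longleftrightarrow>
     open V \<and> x0 \<in> V \<and> (\<forall>A. real_analytic_on (\<lambda>x. u x $ A) V) \<and>
     (\<forall>x\<in>V. jet_of u x \<in> U \<and>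
        (\<forall>A j. pdiff (\<lambda>y. u y $ A) (exl j) x = F A j (jet_of u x))) \<and>
     (\<forall>y. (y, snd x0) \<in> V \<longrightarrow> u (y, snd x0) = a y)"

definition cauchy_solvable_at ::
  "('m::finite \<Rightarrow> 'l::finite \<Rightarrow> ('k::finite,'l,'m) jetpt \<Rightarrow> real) \<Rightarrow> ('k,'l,'m) jetpt set
   \<Rightarrow> ('k,'l,'m) jetpt \<Rightarrow> bool" where
  "cauchy_solvable_at F U w \<longleftrightarrow>
     (\<forall>a. admissible_datum a (fst w) (fst (snd w)) (snd (snd w)) \<longrightarrow>
        (\<exists>V u. cauchy_solution F U a (fst w) V u) \<and>
        (\<forall>V1 u1 V2 u2. cauchy_solution F U a (fst w) V1 u1 \<and> cauchy_solution F U a (fst w) V2 u2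
           \<longrightarrow> (\<exists>W. open W \<and> fst w \<in> W \<and> (\<forall>x\<in>W. u1 x = u2 x))))"

definition approx_solution ::
  "('m \<Rightarrow> 'l \<Rightarrow> ('k,'l,'m) jetpt \<Rightarrow> real) \<Rightarrow> ('k,'l,'m) jetpt set \<Rightarrow> ((real^'k) \<Rightarrow> (real^'m))
   \<Rightarrow> ((real^'k::finite) \<times> (real^'l::finite)) \<Rightarrow> (((real^'k) \<times> (real^'l)) \<Rightarrow> (real^'m::finite)) \<Rightarrow> bool" where
  "approx_solution F U a x0 u \<longleftrightarrow>
     (\<exists>V. open V \<and> x0 \<in> V \<and> (\<forall>A. real_analytic_on (\<lambda>x. u x $ A) V) \<and>
       (\<exists>C e. e > 0 \<and>
          (\<forall>x\<in>V. dist x x0 < e \<longrightarrow> jet_of u x \<in> U \<and>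
             (\<forall>A j. \<bar>pdiff (\<lambda>y. u y $ A) (exl j) x - F A j (jet_of u x)\<bar>
                       \<le> C * (norm (x - x0))^2)) \<and>
          (\<forall>y. (y, snd x0) \<in> V \<longrightarrow> dist y (fst x0) < e \<longrightarrow>
             (\<forall>A. \<bar>u (y, snd x0) $ A - a y $ A\<bar> \<le> C * (norm (y - fst x0))^3))))"

definition approx_solvable_at ::
  "('m::finite \<Rightarrow> 'l::finite \<Rightarrow> ('k::finite,'l,'m) jetpt \<Rightarrow> real) \<Rightarrow> ('k,'l,'m) jetpt set
   \<Rightarrow> ('k,'l,'m) jetpt \<Rightarrow> bool" where
  "approx_solvable_at F U w \<longleftrightarrow>
     (\<forall>a. admissible_datum a (fst w) (fst (snd w)) (snd (snd w)) \<longrightarrow>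
        (\<exists>u. approx_solution F U a (fst w) u))"

definition Phi ::
  "('m::finite \<Rightarrow> 'l::finite \<Rightarrow> ('k::finite,'l,'m) jetpt \<Rightarrow> real) \<Rightarrow> 'm \<Rightarrow> 'l \<Rightarrow> 'l
   \<Rightarrow> ('k,'l,'m) jetpt \<Rightarrow> real" where
  "Phi F A a b w =
     pdiff (F A a) (dxl b) w
     + (\<Sum>B\<in>UNIV. pdiff (F A a) (dp B) w * F B b w)
     + (\<Sum>G\<in>UNIV. \<Sum>B\<in>UNIV. pdiff (F A a) (dp' B G) w *
          (pdiff (F B b) (dxk G) w + (\<Sum>C\<in>UNIV. pdiff (F B b) (dp C) w * (snd (snd w) $ C $ G))))"

definition Psi ::
  "('m::finite \<Rightarrow> 'l::finite \<Rightarrow> ('k::finite,'l,'m) jetpt \<Rightarrow> real) \<Rightarrow> 'm \<Rightarrow> 'k \<Rightarrow> 'k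
   \<Rightarrow> 'l \<Rightarrow> 'l \<Rightarrow> 'm \<Rightarrow> ('k,'l,'m) jetpt \<Rightarrow> real" where
  "Psi F A G L a b C w =
     (\<Sum>B\<in>UNIV. pdiff (F A a) (dp' B G) w * pdiff (F B b) (dp' C L) w
              + pdiff (F A a) (dp' B L) w * pdiff (F B b) (dp' C G) w)"

end

theory Submission
  imports Defs "HOL-Library.Function_Algebras"
begin

text \<open>
  (i) implies (ii) trivially, and (ii) implies (iii) by comparing the mixed second derivatives of
  an approximate solution at the base point for quadratic initial data.

  For (iii) implies (i), write \<open>\<zeta>\<close> for the transversal coordinates and \<open>E\<close> for the Euler
  operator in them. One solves the single radial equation
  \<open>E u = \<Sum>\<^sub>j \<zeta>\<^sub>j F\<^sub>j(x, u, \<partial>u)\<close> with the given datum: in the algebra of power series with finite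
  norm \<open>\<Sum>\<^sub>\<alpha> |c\<^sub>\<alpha>| \<alpha>!/|\<alpha>|!\<close> both \<open>E\<^sup>-\<^sup>1 \<zeta>\<^sub>j\<close> and its derivatives along the initial
  manifold are contractions, so there is no loss of derivatives and the Banach fixed point theorem
  applies. By (iii) the defects \<open>\<partial>\<^sub>j u - F\<^sub>j\<close> then solve a homogeneous linear equation
  that forces them to vanish to infinite order along the initial manifold, hence identically. The same
  vanishing-order argument gives uniqueness.
\<close>


section \<open>Multi-indices\<close>

text \<open>The obstacle is the loss of a derivative: \<open>F\<close> depends on tangential
  derivatives of \<open>u\<close>, which no norm of \<open>u\<close> controls. The unknown of the
  fixed point problem is therefore not \<open>u\<close> but the series f_j that represent
  \<open>F\<close> along the jet of \<open>u\<close>; both \<open>u\<close> and its tangential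
  derivatives are recovered from f by bounded linear maps. The weights are dictated by this:
  differentiating along the initial manifold and multiplying by \<zeta>_j replaces \<gamma> + e_G by
  \<gamma> + e_j, which changes the weight by exactly (\<gamma>_j + 1)/(\<gamma>_G + 1). The factor
  \<gamma>_G + 1 produced by the derivative cancels, and \<gamma>_j + 1 is absorbed by the
  eigenvalue of E. The operators thus have norm at most 1; a genuine contraction comes from making
  the transversal unit of length small relative to the tangential one. The original system is
  overdetermined as soon as there are several transversal variables, while its contraction with
  \<zeta> is one equation per component; (iii) enters only through the defects.\<close>

definition mindex :: "('a::euclidean_space \<Rightarrow> nat) set" where
  "mindex = {\<alpha>. \<forall>b. b \<notin> Basis \<longrightarrow> \<alpha> b = 0}"

definition mdeg :: "('a::euclidean_space \<Rightarrow> nat) \<Rightarrow> nat" where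
  "mdeg \<alpha> = (\<Sum>b\<in>Basis. \<alpha> b)"

definition munit :: "'a::euclidean_space \<Rightarrow> 'a \<Rightarrow> nat" where
  "munit b = (\<lambda>x. if x = b then 1 else 0)"

definition mpow :: "('a::euclidean_space \<Rightarrow> 'b::comm_monoid_mult) \<Rightarrow> ('a \<Rightarrow> nat) \<Rightarrow> 'b" where
  "mpow H \<alpha> = (\<Prod>b\<in>Basis. H b ^ \<alpha> b)"

text \<open>The reciprocal of the multinomial coefficient of \<alpha>, used as the norm of the
  monomial with exponent \<alpha>.\<close>

definition mweight :: "('a::euclidean_space \<Rightarrow> nat) \<Rightarrow> real" where
  "mweight \<alpha> = (\<Prod>b\<in>Basis. fact (\<alpha> b)) / fact (mdeg \<alpha>)"

lemma zero_mindex [simp]: "0 \<in> mindex"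
  by (simp add: mindex_def)

lemma munit_mindex [simp]: "b \<in> Basis \<Longrightarrow> munit b \<in> mindex"
  by (auto simp: mindex_def munit_def)

lemma add_mindex [simp]: "\<alpha> \<in> mindex \<Longrightarrow> \<beta> \<in> mindex \<Longrightarrow> \<alpha> + \<beta> \<in> mindex"
  by (simp add: mindex_def)

lemma diff_mindex [simp]: "\<alpha> \<in> mindex \<Longrightarrow> \<alpha> - \<beta> \<in> mindex"
  by (simp add: mindex_def fun_diff_def)

lemma mdeg_0 [simp]: "mdeg 0 = 0"
  by (simp add: mdeg_def)

lemma mdeg_munit [simp]: "b \<in> Basis \<Longrightarrow> mdeg (munit b) = 1"
  by (simp add: mdeg_def munit_def)

lemma mdeg_add [simp]: "mdeg (\<alpha> + \<beta>) = mdeg \<alpha> + mdeg \<beta>"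
  by (simp add: mdeg_def sum.distrib)

lemma component_le_mdeg: "b \<in> Basis \<Longrightarrow> \<alpha> b \<le> mdeg \<alpha>"
  unfolding mdeg_def by (rule member_le_sum) auto

lemma mdeg_eq_0_iff: "\<alpha> \<in> mindex \<Longrightarrow> mdeg \<alpha> = 0 \<longleftrightarrow> \<alpha> = 0"
  by (auto simp: mdeg_def mindex_def fun_eq_iff)

lemma minus_munit_add:
  assumes "\<alpha> b > 0"
  shows "(\<alpha> - munit b) + munit b = \<alpha>"
  using assms by (auto simp: fun_eq_iff munit_def fun_diff_def)

lemma mindex_cases:
  assumes "\<alpha> \<in> mindex"
  obtains "\<alpha> = 0" | b \<beta> where "b \<in> Basis" "\<beta> \<in> mindex" "\<alpha> = \<beta> + munit b"
proof (cases "\<alpha> = 0")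
  case False
  then obtain b where "\<alpha> b > 0" by (auto simp: fun_eq_iff)
  moreover from this have "b \<in> Basis" using assms by (auto simp: mindex_def)
  ultimately show ?thesis
    using that(2)[of b "\<alpha> - munit b"] assms minus_munit_add[of \<alpha> b] by simp
qed

lemma mdeg_eq_1_iff: "\<alpha> \<in> mindex \<Longrightarrow> mdeg \<alpha> = 1 \<longleftrightarrow> (\<exists>b\<in>Basis. \<alpha> = munit b)"
proof
  assume "\<alpha> \<in> mindex" "mdeg \<alpha> = 1"
  thus "\<exists>b\<in>Basis. \<alpha> = munit b"
  proof (cases rule: mindex_cases)
    case (2 b \<beta>)
    hence "\<beta> = 0" using \<open>mdeg \<alpha> = 1\<close> by (simp flip: mdeg_eq_0_iff)
    thus ?thesis using 2 by auto
  qed auto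
qed auto

lemma munit_eq_iff [simp]: "munit b = munit b' \<longleftrightarrow> b = b'"
  by (auto simp: munit_def fun_eq_iff)

lemma munit_neq_0 [simp]: "munit b \<noteq> 0"
  by (auto simp: munit_def fun_eq_iff)

lemma mpow_0 [simp]: "mpow H 0 = 1"
  by (simp add: mpow_def)

lemma mpow_add: "mpow H (\<alpha> + \<beta>) = mpow H \<alpha> * mpow H \<beta>"
  by (simp add: mpow_def power_add prod.distrib)

lemma mpow_munit [simp]: "b \<in> Basis \<Longrightarrow> mpow H (munit b) = H b"
  by (simp add: mpow_def munit_def if_distrib prod.If_cases power_0 cong: if_cong)

lemma mpow_cong: "(\<And>b. b \<in> Basis \<Longrightarrow> H b = H' b) \<Longrightarrow> mpow H \<alpha> = mpow H' \<alpha>"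
  by (simp add: mpow_def)

lemma norm_mpow_le:
  fixes H :: "'a::euclidean_space \<Rightarrow> 'b::{real_normed_algebra_1, comm_ring_1}"
  assumes "\<And>b. b \<in> Basis \<Longrightarrow> norm (H b) \<le> r"
  shows "norm (mpow H \<alpha>) \<le> r ^ mdeg \<alpha>"
proof -
  have "norm (mpow H \<alpha>) \<le> (\<Prod>b\<in>Basis. norm (H b ^ \<alpha> b))"
    unfolding mpow_def by (rule norm_prod_le)
  also have "\<dots> \<le> (\<Prod>b\<in>Basis. r ^ \<alpha> b)"
    by (intro prod_mono conjI norm_ge_zero order.trans[OF norm_power_ineq] power_mono assms)
  also have "\<dots> = r ^ mdeg \<alpha>"
    by (simp add: mdeg_def power_sum)
  finally show ?thesis .
qed

lemma mpow_scale:
  fixes H :: "'a::euclidean_space \<Rightarrow> 'b::{real_algebra_1, comm_ring_1}"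
  shows "mpow (\<lambda>b. c *\<^sub>R H b) \<alpha> = c ^ mdeg \<alpha> *\<^sub>R mpow H \<alpha>"
proof -
  have "mpow (\<lambda>b. c *\<^sub>R H b) \<alpha> = (\<Prod>b\<in>Basis. of_real (c ^ \<alpha> b) * H b ^ \<alpha> b)"
    unfolding mpow_def by (simp add: scaleR_conv_of_real power_mult_distrib)
  also have "\<dots> = of_real (\<Prod>b\<in>Basis. c ^ \<alpha> b) * mpow H \<alpha>"
    unfolding mpow_def prod.distrib by simp
  finally show ?thesis
    by (simp add: mdeg_def power_sum scaleR_conv_of_real)
qed

section \<open>Estimates for the weights\<close>

lemma mweight_pos [simp]: "mweight \<alpha> > 0"
  by (simp add: mweight_def prod_pos)

lemma mweight_nonneg [simp]: "mweight \<alpha> \<ge> 0"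
  using mweight_pos[of \<alpha>] by linarith

lemma mweight_neq_0 [simp]: "mweight \<alpha> \<noteq> 0"
  using mweight_pos[of \<alpha>] by linarith

lemma mweight_0 [simp]: "mweight 0 = 1"
  by (simp add: mweight_def)

text \<open>The left side is a single term of Vandermonde's sum for the right side.\<close>

lemma binomial_mult_le: "(m choose r) * (n choose s) \<le> (m + n) choose (r + s)"
proof -
  have "(m choose r) * (n choose (r + s - r)) \<le> (\<Sum>k\<le>r + s. (m choose k) * (n choose (r + s - k)))"
    by (rule member_le_sum) auto
  thus ?thesis by (simp add: vandermonde)
qed

lemma prod_binomial_le:
  assumes "finite B"
  shows "(\<Prod>b\<in>B. (n b choose k b)) \<le> ((\<Sum>b\<in>B. n b) choose (\<Sum>b\<in>B. k b))"
  using assms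
proof (induction B rule: finite_induct)
  case (insert x B)
  have "(n x choose k x) * (\<Prod>b\<in>B. (n b choose k b)) \<le> (n x choose k x) * ((\<Sum>b\<in>B. n b) choose (\<Sum>b\<in>B. k b))"
    using insert by simp
  also have "\<dots> \<le> (n x + (\<Sum>b\<in>B. n b)) choose (k x + (\<Sum>b\<in>B. k b))"
    by (rule binomial_mult_le)
  finally show ?case using insert by simp
qed simp

text \<open>The quotient of the two sides is a product of componentwise binomial coefficients over
  the binomial coefficient of the degrees, at most 1 by Vandermonde. This makes the weighted norm
  submultiplicative.\<close>

lemma mweight_add_le: "mweight (\<alpha> + \<beta>) \<le> mweight \<alpha> * mweight \<beta>"
proof -
  have fact_add: "fact (m + n) = real ((m + n) choose m) * fact m * fact n" for m n :: nat
    using binomial_fact[of m "m + n", where ?'a = real] by (simp add: field_simps)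
  define C where "C = real ((mdeg \<alpha> + mdeg \<beta>) choose mdeg \<alpha>)"
  define P where "P = (\<Prod>b\<in>Basis. real ((\<alpha> b + \<beta> b) choose \<alpha> b))"
  have "C > 0" by (simp add: C_def)
  have "P = real (\<Prod>b\<in>Basis. ((\<alpha> b + \<beta> b) choose \<alpha> b))" by (simp add: P_def)
  also have "\<dots> \<le> C"
    using prod_binomial_le[of Basis "\<lambda>b. \<alpha> b + \<beta> b" \<alpha>]
    unfolding C_def of_nat_le_iff mdeg_def by (simp add: sum.distrib)
  finally have "P \<le> C" .
  have "mweight (\<alpha> + \<beta>) = (P * (\<Prod>b\<in>Basis. fact (\<alpha> b)) * (\<Prod>b\<in>Basis. fact (\<beta> b))) / (C * fact (mdeg \<alpha>) * fact (mdeg \<beta>))"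
    by (simp add: mweight_def fact_add P_def C_def prod.distrib)
  also have "\<dots> = (P / C) * (mweight \<alpha> * mweight \<beta>)"
    by (simp add: mweight_def)
  also have "\<dots> \<le> 1 * (mweight \<alpha> * mweight \<beta>)"
    using \<open>P \<le> C\<close> \<open>C > 0\<close> by (intro mult_right_mono) auto
  finally show ?thesis by simp
qed

text \<open>Raising one exponent multiplies the numerator of the weight by \<beta>_b + 1 and the
  denominator by |\<beta>| + 1. Comparing two directions cancels the degree, which is how tangential
  differentiation is later traded against transversal multiplication.\<close>

lemma mweight_add_munit:
  assumes "b \<in> Basis"
  shows "mweight (\<beta> + munit b) * (real (mdeg \<beta>) + 1) = mweight \<beta> * (real (\<beta> b) + 1)"
proof -
  have "(\<Prod>x\<in>Basis. fact ((\<beta> + munit b) x)) = (\<Prod>x\<in>Basis - {b}. fact ((\<beta> + munit b) x)) * (fact (\<beta> b + 1) :: real)"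
    using assms by (simp add: prod.remove[of Basis b] munit_def del: fact_Suc)
  also have "(\<Prod>x\<in>Basis - {b}. fact ((\<beta> + munit b) x)) = (\<Prod>x\<in>Basis - {b}. fact (\<beta> x) :: real)"
    by (rule prod.cong) (auto simp: munit_def)
  finally have "(\<Prod>x\<in>Basis. fact ((\<beta> + munit b) x)) = (\<Prod>x\<in>Basis. fact (\<beta> x)) * (real (\<beta> b) + 1)"
    using assms by (simp add: prod.remove[of Basis b])
  thus ?thesis
    using assms by (simp add: mweight_def add.commute)
qed

lemma mweight_munit [simp]: "b \<in> Basis \<Longrightarrow> mweight (munit b) = 1"
  using mweight_add_munit[of b 0] by simp

text \<open>With d the dimension, this is the bound d^|\<alpha>| for multinomial coefficients. It
  ensures that monomials are bounded by their weights on the cube of half side 1/d, so that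
  evaluation there has norm at most 1.\<close>

lemma mweight_ge:
  fixes \<alpha> :: "'a::euclidean_space \<Rightarrow> nat"
  assumes "\<alpha> \<in> mindex"
  shows "(1 / real DIM('a)) ^ mdeg \<alpha> \<le> mweight \<alpha>"
  using assms
proof (induction "mdeg \<alpha>" arbitrary: \<alpha>)
  case 0
  thus ?case by (metis mdeg_eq_0_iff mweight_0 order_refl power_0)
next
  case (Suc n)
  \<comment> \<open>Pigeonhole: some exponent is at least the average. Lowering that one costs at
    most a factor of the dimension in the weight.\<close>
  have "\<exists>b\<in>Basis. real (mdeg \<alpha>) \<le> real DIM('a) * real (\<alpha> b)"
  proof (rule ccontr)
    assume "\<not> ?thesis"
    hence "real DIM('a) * real (\<alpha> b) < real (mdeg \<alpha>)" if "b \<in> Basis" for b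
      using that by (auto simp: not_le)
    hence "(\<Sum>b\<in>Basis. real DIM('a) * real (\<alpha> b)) < (\<Sum>b\<in>(Basis::'a set). real (mdeg \<alpha>))"
      by (intro sum_strict_mono) auto
    thus False by (simp add: mdeg_def flip: sum_distrib_left)
  qed
  then obtain b where b: "b \<in> Basis" "real (mdeg \<alpha>) \<le> real DIM('a) * real (\<alpha> b)" by blast
  hence pos: "\<alpha> b > 0" using Suc.hyps(2) by (cases "\<alpha> b") auto
  define \<beta> where "\<beta> = \<alpha> - munit b"
  have \<alpha>: "\<alpha> = \<beta> + munit b" using minus_munit_add[of \<alpha> b] pos by (simp add: \<beta>_def)
  have "\<beta> \<in> mindex" using Suc.prems by (simp add: \<beta>_def)
  moreover have n: "n = mdeg \<beta>" using Suc.hyps(2) b \<alpha> by simp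
  ultimately have IH: "(1 / real DIM('a)) ^ mdeg \<beta> \<le> mweight \<beta>" using Suc.hyps(1)[of \<beta>] by simp
  have "real (mdeg \<beta>) + 1 \<le> real DIM('a) * (real (\<beta> b) + 1)"
  proof -
    have "\<alpha> b = \<beta> b + 1" by (simp add: \<alpha> munit_def)
    moreover have "mdeg \<alpha> = mdeg \<beta> + 1" using b by (simp add: \<alpha>)
    ultimately show ?thesis using b(2) by (simp add: algebra_simps)
  qed
  hence "mweight \<beta> * (real (mdeg \<beta>) + 1) \<le> mweight \<beta> * (real DIM('a) * (real (\<beta> b) + 1))"
    by (intro mult_left_mono) auto
  also have "\<dots> = (real DIM('a) * mweight \<alpha>) * (real (mdeg \<beta>) + 1)"
    using mweight_add_munit[OF b(1), of \<beta>] unfolding \<alpha> by (simp only: mult_ac)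
  finally have "mweight \<beta> \<le> real DIM('a) * mweight \<alpha>"
    by (rule mult_right_le_imp_le) simp
  with IH have "(1 / real DIM('a)) ^ mdeg \<beta> \<le> real DIM('a) * mweight \<alpha>" by linarith
  thus ?case using n by (simp add: divide_le_eq mult.commute flip: Suc.hyps(2))
qed

section \<open>A Banach algebra of power series\<close>

text \<open>\<open>coef f \<alpha>\<close> is the Taylor coefficient already multiplied by the
  weight. The norm is then a plain l1 norm, and the weights appear only in the product, in
  evaluation and in the integral operators.\<close>

typedef (overloaded) 'a psr =
  "{f :: ('a::euclidean_space \<Rightarrow> nat) \<Rightarrow> real. (\<forall>\<alpha>. \<alpha> \<notin> mindex \<longrightarrow> f \<alpha> = 0) \<and> (\<lambda>\<alpha>. \<bar>f \<alpha>\<bar>) summable_on mindex}"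
  morphisms coef Psr
  by (rule exI[of _ "\<lambda>_. 0"]) auto

setup_lifting type_definition_psr

lemma coef_outside: "\<alpha> \<notin> mindex \<Longrightarrow> coef f \<alpha> = 0"
  using coef[of f] by auto

lemma abs_summable_coef: "(\<lambda>\<alpha>. \<bar>coef f \<alpha>\<bar>) summable_on mindex"
  using coef[of f] by auto

lemma psr_eqI: "(\<And>\<alpha>. \<alpha> \<in> mindex \<Longrightarrow> coef f \<alpha> = coef g \<alpha>) \<Longrightarrow> f = g"
  by (metis coef_inject coef_outside ext)

instantiation psr :: (euclidean_space) real_vector
begin

lift_definition zero_psr :: "'a psr" is "\<lambda>_. 0" by auto
lift_definition plus_psr :: "'a psr \<Rightarrow> 'a psr \<Rightarrow> 'a psr" is "\<lambda>f g \<alpha>. f \<alpha> + g \<alpha>"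
proof (intro conjI)
  fix f g :: "('a \<Rightarrow> nat) \<Rightarrow> real"
  assume f: "(\<forall>\<alpha>. \<alpha> \<notin> mindex \<longrightarrow> f \<alpha> = 0) \<and> (\<lambda>\<alpha>. \<bar>f \<alpha>\<bar>) summable_on mindex"
    and g: "(\<forall>\<alpha>. \<alpha> \<notin> mindex \<longrightarrow> g \<alpha> = 0) \<and> (\<lambda>\<alpha>. \<bar>g \<alpha>\<bar>) summable_on mindex"
  thus "\<forall>\<alpha>. \<alpha> \<notin> mindex \<longrightarrow> f \<alpha> + g \<alpha> = 0" by simp
  have "(\<lambda>\<alpha>. \<bar>f \<alpha>\<bar> + \<bar>g \<alpha>\<bar>) summable_on mindex"
    using f g by (intro summable_on_add) auto
  thus "(\<lambda>\<alpha>. \<bar>f \<alpha> + g \<alpha>\<bar>) summable_on mindex"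
    by (rule summable_on_comparison_test) auto
qed
lift_definition uminus_psr :: "'a psr \<Rightarrow> 'a psr" is "\<lambda>f \<alpha>. - f \<alpha>" by auto
lift_definition scaleR_psr :: "real \<Rightarrow> 'a psr \<Rightarrow> 'a psr" is "\<lambda>c f \<alpha>. c * f \<alpha>"
  by (auto simp: abs_mult intro!: summable_on_cmult_right)
definition minus_psr :: "'a psr \<Rightarrow> 'a psr \<Rightarrow> 'a psr" where "minus_psr f g = f + (- g)"

instance
proof
  fix f g h :: "'a psr" and a b :: real
  show "f + g + h = f + (g + h)" "f + g = g + f" "0 + f = f" "- f + f = 0"
    "a *\<^sub>R (f + g) = a *\<^sub>R f + a *\<^sub>R g" "(a + b) *\<^sub>R f = a *\<^sub>R f + b *\<^sub>R f"
    "a *\<^sub>R b *\<^sub>R f = (a * b) *\<^sub>R f" "1 *\<^sub>R f = f"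
    by (transfer; simp add: algebra_simps)+
  show "f - g = f + - g" by (rule minus_psr_def)
qed

end

instantiation psr :: (euclidean_space) real_normed_vector
begin

definition norm_psr :: "'a psr \<Rightarrow> real" where "norm_psr f = (\<Sum>\<^sub>\<infinity>\<alpha>\<in>mindex. \<bar>coef f \<alpha>\<bar>)"
definition dist_psr :: "'a psr \<Rightarrow> 'a psr \<Rightarrow> real" where "dist_psr f g = norm (f - g)"
definition sgn_psr :: "'a psr \<Rightarrow> 'a psr" where "sgn_psr f = f /\<^sub>R norm f"
definition uniformity_psr :: "('a psr \<times> 'a psr) filter" where
  "uniformity_psr = (INF e\<in>{0<..}. principal {(x, y). dist x y < e})"
definition open_psr :: "'a psr set \<Rightarrow> bool" where
  "open_psr U = (\<forall>x\<in>U. eventually (\<lambda>(x', y). x' = x \<longrightarrow> y \<in> U) uniformity)"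

instance
proof
  fix f g :: "'a psr" and a :: real
  show "dist f g = norm (f - g)" by (rule dist_psr_def)
  show "sgn f = f /\<^sub>R norm f" by (rule sgn_psr_def)
  show "uniformity = (INF e\<in>{0<..}. principal {(x::'a psr, y). dist x y < e})" by (rule uniformity_psr_def)
  show "open U = (\<forall>x\<in>U. \<forall>\<^sub>F (x', y) in uniformity. x' = x \<longrightarrow> y \<in> U)" for U :: "'a psr set"
    by (rule open_psr_def)
  show "norm f = 0 \<longleftrightarrow> f = 0"
  proof
    assume *: "norm f = 0"
    have "\<bar>coef f \<alpha>\<bar> = 0" if "\<alpha> \<in> mindex" for \<alpha>
      using * abs_summable_coef[of f] that
      by (intro nonneg_infsum_le_0D[of "\<lambda>\<alpha>. \<bar>coef f \<alpha>\<bar>" mindex]) (auto simp: norm_psr_def)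
    thus "f = 0" by (intro psr_eqI) (auto simp: zero_psr.rep_eq)
  qed (simp add: norm_psr_def zero_psr.rep_eq)
  have "norm (f + g) \<le> (\<Sum>\<^sub>\<infinity>\<alpha>\<in>mindex. \<bar>coef f \<alpha>\<bar> + \<bar>coef g \<alpha>\<bar>)"
    unfolding norm_psr_def
    by (intro infsum_mono abs_summable_coef summable_on_add) (auto simp: plus_psr.rep_eq)
  also have "\<dots> = norm f + norm g"
    unfolding norm_psr_def by (intro infsum_add abs_summable_coef)
  finally show "norm (f + g) \<le> norm f + norm g" .
  show "norm (a *\<^sub>R f) = \<bar>a\<bar> * norm f"
    by (simp add: norm_psr_def scaleR_psr.rep_eq abs_mult infsum_cmult_right')
qed

end

lemma coef_simps [simp]:
  "coef 0 \<alpha> = 0" "coef (f + g) \<alpha> = coef f \<alpha> + coef g \<alpha>" "coef (- f) \<alpha> = - coef f \<alpha>"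
  "coef (c *\<^sub>R f) \<alpha> = c * coef f \<alpha>"
  by (simp_all only: zero_psr.rep_eq plus_psr.rep_eq uminus_psr.rep_eq scaleR_psr.rep_eq)

lemma coef_diff [simp]: "coef (f - g) \<alpha> = coef f \<alpha> - coef g \<alpha>"
  by (simp only: minus_psr_def coef_simps diff_conv_add_uminus)

lemma sum_coef_le_norm:
  assumes "finite S" "S \<subseteq> mindex"
  shows "(\<Sum>\<alpha>\<in>S. \<bar>coef f \<alpha>\<bar>) \<le> norm f"
  unfolding norm_psr_def by (rule finite_sum_le_infsum) (use assms abs_summable_coef in auto)

lemma abs_coef_le_norm: "\<bar>coef f \<alpha>\<bar> \<le> norm f"
  using sum_coef_le_norm[of "{\<alpha>}" f] by (cases "\<alpha> \<in> mindex") (auto simp: coef_outside)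

lemma norm_psr_leI:
  assumes "\<And>S. finite S \<Longrightarrow> S \<subseteq> mindex \<Longrightarrow> (\<Sum>\<alpha>\<in>S. \<bar>coef f \<alpha>\<bar>) \<le> B"
  shows "norm f \<le> B"
  unfolding norm_psr_def
  by (rule infsum_le_finite_sums[OF abs_summable_coef]) (use assms in auto)

lemma bounded_linear_coef: "bounded_linear (\<lambda>f. coef f \<alpha>)"
  by (rule bounded_linear_intro[where K = 1]) (auto simp: abs_coef_le_norm)

instance psr :: (euclidean_space) banach
proof
  fix X :: "nat \<Rightarrow> 'a psr"
  assume X: "Cauchy X"
  have "Cauchy (\<lambda>n. coef (X n) \<alpha>)" for \<alpha>
    using bounded_linear.Cauchy[OF bounded_linear_coef X] .
  hence "\<exists>l. (\<lambda>n. coef (X n) \<alpha>) \<longlonglongrightarrow> l" for \<alpha>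
    by (simp add: real_Cauchy_convergent convergent_def[symmetric])
  then obtain l where l: "\<And>\<alpha>. (\<lambda>n. coef (X n) \<alpha>) \<longlonglongrightarrow> l \<alpha>" by metis
  \<comment> \<open>The tail estimate is stated over finite index sets, where the limit in the
    second Cauchy index may be taken termwise, with \<open>N\<close> independent of the set.\<close>
  have bound: "\<exists>N. \<forall>n\<ge>N. \<forall>S. finite S \<longrightarrow> S \<subseteq> mindex \<longrightarrow> (\<Sum>\<alpha>\<in>S. \<bar>coef (X n) \<alpha> - l \<alpha>\<bar>) \<le> e"
    if "e > 0" for e
  proof -
    from X \<open>e > 0\<close> obtain N where N: "\<And>m n. m \<ge> N \<Longrightarrow> n \<ge> N \<Longrightarrow> norm (X m - X n) < e"
      unfolding Cauchy_def dist_norm by blast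
    have "(\<Sum>\<alpha>\<in>S. \<bar>coef (X n) \<alpha> - l \<alpha>\<bar>) \<le> e" if "n \<ge> N" "finite S" "S \<subseteq> mindex" for n S
    proof (rule tendsto_upperbound[of _ _ sequentially])
      show "(\<lambda>m. \<Sum>\<alpha>\<in>S. \<bar>coef (X n) \<alpha> - coef (X m) \<alpha>\<bar>) \<longlonglongrightarrow> (\<Sum>\<alpha>\<in>S. \<bar>coef (X n) \<alpha> - l \<alpha>\<bar>)"
        by (intro tendsto_intros l)
      have "(\<Sum>\<alpha>\<in>S. \<bar>coef (X n) \<alpha> - coef (X m) \<alpha>\<bar>) \<le> e" if "m \<ge> N" for m
        using sum_coef_le_norm[of S "X n - X m"] N[of n m] \<open>n \<ge> N\<close> that \<open>finite S\<close> \<open>S \<subseteq> mindex\<close> by simp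
      thus "\<forall>\<^sub>F m in sequentially. (\<Sum>\<alpha>\<in>S. \<bar>coef (X n) \<alpha> - coef (X m) \<alpha>\<bar>) \<le> e"
        by (auto simp: eventually_sequentially)
    qed simp
    thus ?thesis by blast
  qed
  obtain N where N: "\<And>S. finite S \<Longrightarrow> S \<subseteq> mindex \<Longrightarrow> (\<Sum>\<alpha>\<in>S. \<bar>coef (X N) \<alpha> - l \<alpha>\<bar>) \<le> 1"
    using bound[of 1] by auto
  have "(\<Sum>\<alpha>\<in>S. \<bar>l \<alpha>\<bar>) \<le> 1 + norm (X N)" if S: "finite S" "S \<subseteq> mindex" for S
  proof -
    have "(\<Sum>\<alpha>\<in>S. \<bar>l \<alpha>\<bar>) \<le> (\<Sum>\<alpha>\<in>S. \<bar>coef (X N) \<alpha> - l \<alpha>\<bar> + \<bar>coef (X N) \<alpha>\<bar>)"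
      by (intro sum_mono) auto
    thus ?thesis using N[OF S] sum_coef_le_norm[OF S, of "X N"] by (simp add: sum.distrib)
  qed
  hence "(\<lambda>\<alpha>. \<bar>l \<alpha>\<bar>) summable_on mindex"
    by (intro nonneg_bdd_above_summable_on) (auto intro!: bdd_aboveI)
  moreover have "l \<alpha> = 0" if "\<alpha> \<notin> mindex" for \<alpha>
    using l[of \<alpha>] that by (simp add: coef_outside LIMSEQ_const_iff)
  ultimately have coef: "coef (Psr l) = l"
    by (intro Psr_inverse) auto
  have "X \<longlonglongrightarrow> Psr l"
  proof (rule LIMSEQ_I)
    fix e :: real assume "e > 0"
    then obtain N where N: "\<And>n S. n \<ge> N \<Longrightarrow> finite S \<Longrightarrow> S \<subseteq> mindex \<Longrightarrow> (\<Sum>\<alpha>\<in>S. \<bar>coef (X n) \<alpha> - l \<alpha>\<bar>) \<le> e / 2"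
      using bound[of "e / 2"] by auto
    have "norm (X n - Psr l) \<le> e / 2" if "n \<ge> N" for n
      using N[OF that] by (intro norm_psr_leI) (auto simp: coef)
    thus "\<exists>N. \<forall>n\<ge>N. norm (X n - Psr l) < e"
      using \<open>e > 0\<close> by (intro exI[of _ N]) fastforce
  qed
  thus "convergent X" by (auto simp: convergent_def)
qed

section \<open>Bounded linear maps out of the series space\<close>

text \<open>The universal property of l1: a bounded family of vectors extends to a bounded linear
  map taking \<open>pse \<alpha>\<close> to \<open>g \<alpha>\<close>. Products, evaluations,
  derivatives and radial integrals are all instances.\<close>

definition psr_lin :: "(('a::euclidean_space \<Rightarrow> nat) \<Rightarrow> 'b::banach) \<Rightarrow> 'a psr \<Rightarrow> 'b" where
  "psr_lin g f = (\<Sum>\<^sub>\<infinity>\<alpha>\<in>mindex. coef f \<alpha> *\<^sub>R g \<alpha>)"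

context
  fixes g :: "('a::euclidean_space \<Rightarrow> nat) \<Rightarrow> 'b::banach" and K :: real
  assumes g: "\<And>\<alpha>. \<alpha> \<in> mindex \<Longrightarrow> norm (g \<alpha>) \<le> K"
begin

lemma psr_lin_abs_summable: "(\<lambda>\<alpha>. norm (coef f \<alpha> *\<^sub>R g \<alpha>)) summable_on mindex"
proof (rule summable_on_comparison_test)
  show "(\<lambda>\<alpha>. \<bar>coef f \<alpha>\<bar> * K) summable_on mindex"
    by (intro summable_on_cmult_left abs_summable_coef)
qed (use g in \<open>auto intro!: mult_left_mono\<close>)

lemma psr_lin_has_sum: "((\<lambda>\<alpha>. coef f \<alpha> *\<^sub>R g \<alpha>) has_sum psr_lin g f) mindex"
  unfolding psr_lin_def by (rule has_sum_infsum[OF abs_summable_summable[OF psr_lin_abs_summable]])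

lemma norm_psr_lin_le: "norm (psr_lin g f) \<le> K * norm f"
proof -
  have "norm (psr_lin g f) \<le> (\<Sum>\<^sub>\<infinity>\<alpha>\<in>mindex. norm (coef f \<alpha> *\<^sub>R g \<alpha>))"
    unfolding psr_lin_def by (rule norm_infsum_bound[OF psr_lin_abs_summable])
  also have "\<dots> \<le> (\<Sum>\<^sub>\<infinity>\<alpha>\<in>mindex. K * \<bar>coef f \<alpha>\<bar>)"
    by (intro infsum_mono psr_lin_abs_summable summable_on_cmult_right abs_summable_coef)
       (use g in \<open>auto simp: mult.commute[of K] intro!: mult_left_mono\<close>)
  finally show ?thesis by (simp add: norm_psr_def infsum_cmult_right')
qed

lemma bounded_linear_psr_lin: "bounded_linear (psr_lin g)"
proof (rule bounded_linear_intro[where K = K])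
  fix f h :: "'a psr" and r :: real
  show "psr_lin g (f + h) = psr_lin g f + psr_lin g h"
    unfolding psr_lin_def
    by (simp add: scaleR_add_left infsum_add abs_summable_summable[OF psr_lin_abs_summable])
  show "psr_lin g (r *\<^sub>R f) = r *\<^sub>R psr_lin g f"
    unfolding psr_lin_def by (simp add: infsum_scaleR_right flip: scaleR_scaleR)
  show "norm (psr_lin g f) \<le> norm f * K"
    using norm_psr_lin_le[of f] by (simp add: mult.commute)
qed

end

lift_definition pse :: "('a::euclidean_space \<Rightarrow> nat) \<Rightarrow> 'a psr" is
  "\<lambda>\<alpha> \<beta>. if \<beta> = \<alpha> \<and> \<alpha> \<in> mindex then 1 else 0"
proof -
  fix \<alpha> :: "'a \<Rightarrow> nat"
  let ?f = "\<lambda>\<beta>. if \<beta> = \<alpha> \<and> \<alpha> \<in> mindex then 1 else 0 :: real"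
  have "(\<lambda>\<beta>. \<bar>?f \<beta>\<bar>) summable_on mindex"
  proof (rule finite_nonzero_values_imp_summable_on)
    show "finite {\<beta> \<in> mindex. \<bar>?f \<beta>\<bar> \<noteq> 0}"
      by (rule finite_subset[of _ "{\<alpha>}"]) (simp_all add: subset_iff)
  qed
  thus "(\<forall>\<beta>. \<beta> \<notin> mindex \<longrightarrow> ?f \<beta> = 0) \<and> (\<lambda>\<beta>. \<bar>?f \<beta>\<bar>) summable_on mindex" by auto
qed

lemma coef_pse: "coef (pse \<alpha>) \<beta> = (if \<beta> = \<alpha> \<and> \<alpha> \<in> mindex then 1 else 0)"
  by (simp add: pse.rep_eq)

lemma infsum_pse:
  assumes "\<alpha> \<in> mindex"
  shows "(\<Sum>\<^sub>\<infinity>\<beta>\<in>mindex. coef (pse \<alpha>) \<beta> *\<^sub>R g \<beta>) = (g \<alpha> :: 'b::real_normed_vector)"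
proof -
  have "(\<Sum>\<^sub>\<infinity>\<beta>\<in>mindex. coef (pse \<alpha>) \<beta> *\<^sub>R g \<beta>) = (\<Sum>\<^sub>\<infinity>\<beta>\<in>{\<alpha>}. coef (pse \<alpha>) \<beta> *\<^sub>R g \<beta>)"
    by (rule infsum_cong_neutral) (use assms in \<open>auto simp: coef_pse\<close>)
  thus ?thesis using assms by (simp add: coef_pse)
qed

lemma psr_lin_pse [simp]: "\<alpha> \<in> mindex \<Longrightarrow> psr_lin g (pse \<alpha>) = g \<alpha>"
  unfolding psr_lin_def by (rule infsum_pse)

lemma norm_pse [simp]: "\<alpha> \<in> mindex \<Longrightarrow> norm (pse \<alpha>) = 1"
  unfolding norm_psr_def
  by (subst infsum_pse[of \<alpha> "\<lambda>_. 1::real", symmetric]) (auto intro!: infsum_cong simp: coef_pse)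

lemma norm_pse_le: "norm (pse \<alpha>) \<le> 1"
proof (cases "\<alpha> \<in> mindex")
  case False
  hence "pse \<alpha> = 0" by (intro psr_eqI) (simp add: coef_pse)
  thus ?thesis by simp
qed simp

lemma psr_expand: "((\<lambda>\<alpha>. coef f \<alpha> *\<^sub>R pse \<alpha>) has_sum f) mindex"
proof -
  have "psr_lin pse f = f"
  proof (rule psr_eqI)
    fix \<beta> :: "'a \<Rightarrow> nat" assume "\<beta> \<in> mindex"
    have "((\<lambda>\<alpha>. coef (coef f \<alpha> *\<^sub>R pse \<alpha>) \<beta>) has_sum coef (psr_lin pse f) \<beta>) mindex"
      using has_sum_bounded_linear[OF bounded_linear_coef psr_lin_has_sum[of pse 1]] norm_pse_le by blast
    moreover have "((\<lambda>\<alpha>. coef (coef f \<alpha> *\<^sub>R pse \<alpha>) \<beta>) has_sum coef f \<beta>) mindex"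
      by (rule has_sum_finite_neutralI[of "{\<beta>}"]) (use \<open>\<beta> \<in> mindex\<close> in \<open>auto simp: coef_pse\<close>)
    ultimately show "coef (psr_lin pse f) \<beta> = coef f \<beta>" by (rule has_sum_unique)
  qed
  thus ?thesis using psr_lin_has_sum[of pse 1 f] norm_pse_le by simp
qed

text \<open>Continuity carries equality from the unit vectors to their convergent expansion.
  Operator identities, the ring axioms included, are reduced to monomials in this way.\<close>

lemma psr_linear_ext:
  assumes "bounded_linear S" "bounded_linear T" "\<And>\<alpha>. \<alpha> \<in> mindex \<Longrightarrow> S (pse \<alpha>) = T (pse \<alpha>)"
  shows "S f = T f"
proof -
  interpret S: bounded_linear S by fact
  interpret T: bounded_linear T by fact
  have "((\<lambda>\<alpha>. S (coef f \<alpha> *\<^sub>R pse \<alpha>)) has_sum S f) mindex"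
    by (rule has_sum_bounded_linear[OF assms(1) psr_expand])
  moreover have "((\<lambda>\<alpha>. T (coef f \<alpha> *\<^sub>R pse \<alpha>)) has_sum T f) mindex"
    by (rule has_sum_bounded_linear[OF assms(2) psr_expand])
  hence "((\<lambda>\<alpha>. S (coef f \<alpha> *\<^sub>R pse \<alpha>)) has_sum T f) mindex"
    by (rule has_sum_cong[THEN iffD1, rotated]) (simp add: S.scaleR T.scaleR assms(3))
  ultimately show ?thesis by (rule has_sum_unique)
qed

definition mweight_ratio :: "('a::euclidean_space \<Rightarrow> nat) \<Rightarrow> ('a \<Rightarrow> nat) \<Rightarrow> real" where
  "mweight_ratio \<alpha> \<beta> = mweight (\<alpha> + \<beta>) / (mweight \<alpha> * mweight \<beta>)"

lemma abs_mweight_ratio_le: "\<bar>mweight_ratio \<alpha> \<beta>\<bar> \<le> 1"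
  using mweight_add_le[of \<alpha> \<beta>] by (simp add: mweight_ratio_def divide_le_eq abs_of_pos)

lemma norm_ratio_pse_le: "norm (mweight_ratio \<alpha> \<beta> *\<^sub>R pse (\<alpha> + \<beta>)) \<le> 1"
  using mult_mono[OF abs_mweight_ratio_le norm_pse_le] by simp

instantiation psr :: (euclidean_space) "{real_normed_algebra_1, comm_ring_1}"
begin

definition one_psr :: "'a psr" where "one_psr = pse 0"
text \<open>\<^term>\<open>pse \<alpha>\<close> stands for the monomial \<open>x\<^sup>\<alpha>\<close> divided by its norm \<^term>\<open>mweight \<alpha>\<close>; hence the
  factor in the otherwise usual product of power series.\<close>
definition times_psr :: "'a psr \<Rightarrow> 'a psr \<Rightarrow> 'a psr" where
  "times_psr f g = psr_lin (\<lambda>\<alpha>. psr_lin (\<lambda>\<beta>. mweight_ratio \<alpha> \<beta> *\<^sub>R pse (\<alpha> + \<beta>)) g) f"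

instance
proof
  define G :: "'a psr \<Rightarrow> ('a \<Rightarrow> nat) \<Rightarrow> 'a psr"
    where "G = (\<lambda>g \<alpha>. psr_lin (\<lambda>\<beta>. mweight_ratio \<alpha> \<beta> *\<^sub>R pse (\<alpha> + \<beta>)) g)"
  have times: "f * g = psr_lin (G g) f" for f g :: "'a psr"
    unfolding times_psr_def G_def ..
  have G_le: "norm (G g \<alpha>) \<le> norm g" for \<alpha> and g :: "'a psr"
  proof -
    have "norm (psr_lin (\<lambda>\<beta>. mweight_ratio \<alpha> \<beta> *\<^sub>R pse (\<alpha> + \<beta>)) g) \<le> 1 * norm g"
      by (rule norm_psr_lin_le) (rule norm_ratio_pse_le)
    thus ?thesis by (simp add: G_def)
  qed
  have G_lin: "bounded_linear (\<lambda>g. G g \<alpha>)" for \<alpha> :: "'a \<Rightarrow> nat"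
    unfolding G_def by (rule bounded_linear_psr_lin[of _ 1]) (rule norm_ratio_pse_le)
  have G_add: "G (g + h) \<alpha> = G g \<alpha> + G h \<alpha>" for g h \<alpha>
    by (rule linear_add[OF bounded_linear.linear[OF G_lin]])
  have G_scale: "G (r *\<^sub>R g) \<alpha> = r *\<^sub>R G g \<alpha>" for g \<alpha> r
    by (rule linear_scale[OF bounded_linear.linear[OF G_lin]])
  have nm: "norm (f * g) \<le> norm f * norm g" for f g :: "'a psr"
    using norm_psr_lin_le[of "G g" "norm g" f] G_le by (simp add: times mult.commute[of "norm f"])
  thus "norm (f * g) \<le> norm f * norm g" for f g :: "'a psr" .
  have left: "bounded_linear (\<lambda>f. f * g)" for g :: "'a psr"
    unfolding times by (rule bounded_linear_psr_lin[of _ "norm g"]) (rule G_le)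
  have summ: "(\<lambda>\<alpha>. coef f \<alpha> *\<^sub>R G g \<alpha>) summable_on mindex" for f g :: "'a psr"
    by (rule abs_summable_summable, rule psr_lin_abs_summable[of _ "norm g"]) (rule G_le)
  \<comment> \<open>Continuity in the second factor is proved directly, because commutativity is
    itself deduced by comparing continuous maps in each factor.\<close>
  have right: "bounded_linear (\<lambda>g. f * g)" for f :: "'a psr"
  proof (rule bounded_linear_intro[where K = "norm f"])
    fix g h :: "'a psr" and r :: real
    show "f * (g + h) = f * g + f * h"
      unfolding times psr_lin_def G_add scaleR_add_right by (rule infsum_add[OF summ summ])
    show "f * (r *\<^sub>R g) = r *\<^sub>R (f * g)"
      unfolding times psr_lin_def G_scale scaleR_left_commute[of _ r] by (rule infsum_scaleR_right)
    show "norm (f * g) \<le> norm g * norm f" using nm[of f g] by (simp add: mult.commute)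
  qed
  have pse: "pse \<alpha> * pse \<beta> = mweight_ratio \<alpha> \<beta> *\<^sub>R pse (\<alpha> + \<beta>)" if "\<alpha> \<in> mindex" "\<beta> \<in> mindex" for \<alpha> \<beta> :: "'a \<Rightarrow> nat"
    using that by (simp add: times_psr_def)
  fix f g h :: "'a psr" and a :: real
  show "(f + g) * h = f * h + g * h"
    using left[of h] by (rule linear_add[OF bounded_linear.linear])
  show "a *\<^sub>R f * g = a *\<^sub>R (f * g)"
    using left[of g] by (rule linear_scale[OF bounded_linear.linear])
  show "f * a *\<^sub>R g = a *\<^sub>R (f * g)"
    using right[of f] by (rule linear_scale[OF bounded_linear.linear])
  show comm: "f * g = g * f" for f g :: "'a psr"
  proof (rule psr_linear_ext[OF left right])
    fix \<alpha> :: "'a \<Rightarrow> nat" assume \<alpha>: "\<alpha> \<in> mindex"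
    show "pse \<alpha> * g = g * pse \<alpha>"
      by (rule psr_linear_ext[OF right left])
         (use \<alpha> in \<open>simp add: pse add.commute mweight_ratio_def mult.commute\<close>)
  qed
  show one: "1 * f = f" for f :: "'a psr"
    by (rule psr_linear_ext[OF right bounded_linear_ident])
       (simp add: one_psr_def pse mweight_ratio_def)
  show "f * (g + h) = f * g + f * h"
    using right[of f] by (rule linear_add[OF bounded_linear.linear])
  show "f * 1 = f"
    using comm[of f 1] one[of f] by simp
  show "f * g * h = f * (g * h)"
  proof (rule psr_linear_ext[of "\<lambda>f. f * g * h" "\<lambda>f. f * (g * h)"])
    fix \<alpha> :: "'a \<Rightarrow> nat" assume \<alpha>: "\<alpha> \<in> mindex"
    show "pse \<alpha> * g * h = pse \<alpha> * (g * h)"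
    proof (rule psr_linear_ext[of "\<lambda>g. pse \<alpha> * g * h" "\<lambda>g. pse \<alpha> * (g * h)"])
      fix \<beta> :: "'a \<Rightarrow> nat" assume \<beta>: "\<beta> \<in> mindex"
      show "pse \<alpha> * pse \<beta> * h = pse \<alpha> * (pse \<beta> * h)"
      proof (rule psr_linear_ext[of "\<lambda>h. pse \<alpha> * pse \<beta> * h" "\<lambda>h. pse \<alpha> * (pse \<beta> * h)"])
        fix \<gamma> :: "'a \<Rightarrow> nat" assume \<gamma>: "\<gamma> \<in> mindex"
        show "pse \<alpha> * pse \<beta> * pse \<gamma> = pse \<alpha> * (pse \<beta> * pse \<gamma>)"
          using \<alpha> \<beta> \<gamma>
          by (simp add: pse linear_scale[OF bounded_linear.linear[OF left]]
              linear_scale[OF bounded_linear.linear[OF right]] mweight_ratio_def add.assoc)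
      qed (rule right, rule bounded_linear_compose[OF right right])
    qed (rule bounded_linear_compose[OF left right], rule bounded_linear_compose[OF right left])
  qed (rule bounded_linear_compose[OF left left], rule left)
  show "(0::'a psr) \<noteq> 1"
  proof
    assume "(0::'a psr) = 1"
    hence "coef (0::'a psr) 0 = coef 1 0" by simp
    thus False by (simp add: one_psr_def coef_pse)
  qed
  show "norm (1::'a psr) = 1" by (simp add: one_psr_def)
qed

end

lemma pse_mult:
  assumes "\<alpha> \<in> mindex" "\<beta> \<in> mindex"
  shows "pse \<alpha> * pse \<beta> = mweight_ratio \<alpha> \<beta> *\<^sub>R pse (\<alpha> + \<beta>)"
  using assms by (simp add: times_psr_def)

lemma psr_bilinear_ext:
  assumes "\<And>f. bounded_linear (S f)" "\<And>f. bounded_linear (T f)"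
      and "\<And>g. bounded_linear (\<lambda>f. S f g)" "\<And>g. bounded_linear (\<lambda>f. T f g)"
      and "\<And>\<alpha> \<beta>. \<alpha> \<in> mindex \<Longrightarrow> \<beta> \<in> mindex \<Longrightarrow> S (pse \<alpha>) (pse \<beta>) = T (pse \<alpha>) (pse \<beta>)"
  shows "S f g = T f g"
  by (rule psr_linear_ext[OF assms(3,4)], rule psr_linear_ext[OF assms(1,2)], rule assms(5))

section \<open>Substitution into power series\<close>

definition mconv :: "(('a::euclidean_space \<Rightarrow> nat) \<Rightarrow> real) \<Rightarrow> real \<Rightarrow> bool" where
  "mconv c r \<longleftrightarrow> (\<lambda>\<alpha>. \<bar>c \<alpha>\<bar> * r ^ mdeg \<alpha>) summable_on mindex"

definition mnorm :: "(('a::euclidean_space \<Rightarrow> nat) \<Rightarrow> real) \<Rightarrow> real \<Rightarrow> real" where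
  "mnorm c r = (\<Sum>\<^sub>\<infinity>\<alpha>\<in>mindex. \<bar>c \<alpha>\<bar> * r ^ mdeg \<alpha>)"

text \<open>The coefficients here are ordinary, unweighted ones. Two target algebras matter: the
  reals, giving values of functions, and \<open>psr\<close>, giving composition of power
  series.\<close>

definition msubst :: "(('a::euclidean_space \<Rightarrow> nat) \<Rightarrow> real) \<Rightarrow> ('a \<Rightarrow> 'b) \<Rightarrow> 'b::{real_normed_algebra_1, comm_ring_1, banach}" where
  "msubst c H = (\<Sum>\<^sub>\<infinity>\<alpha>\<in>mindex. c \<alpha> *\<^sub>R mpow H \<alpha>)"

lemma mconv_le:
  assumes "mconv c r" "\<And>\<alpha>. \<alpha> \<in> mindex \<Longrightarrow> \<bar>d \<alpha>\<bar> * s ^ mdeg \<alpha> \<le> K * (\<bar>c \<alpha>\<bar> * r ^ mdeg \<alpha>)" "s \<ge> 0"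
  shows "mconv d s"
  unfolding mconv_def
  by (rule summable_on_comparison_test[OF summable_on_cmult_right[of _ _ K]])
     (use assms in \<open>auto simp: mconv_def\<close>)

lemma mconv_mono: "mconv c r \<Longrightarrow> 0 \<le> s \<Longrightarrow> s \<le> r \<Longrightarrow> mconv c s"
  by (erule mconv_le[where K = 1]) (auto intro!: mult_left_mono power_mono)

lemma mnorm_nonneg: "r \<ge> 0 \<Longrightarrow> mnorm c r \<ge> 0"
  unfolding mnorm_def by (intro infsum_nonneg) auto

lemma mnorm_mono:
  assumes "mconv c r" "\<And>\<alpha>. \<alpha> \<in> mindex \<Longrightarrow> \<bar>d \<alpha>\<bar> \<le> \<bar>c \<alpha>\<bar>" "0 \<le> r"
  shows "mconv d r" "mnorm d r \<le> mnorm c r"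
proof -
  show *: "mconv d r"
    using assms(1) by (rule mconv_le[where K = 1]) (use assms in \<open>auto intro!: mult_right_mono\<close>)
  show "mnorm d r \<le> mnorm c r"
    unfolding mnorm_def by (rule infsum_mono) (use * assms in \<open>auto simp: mconv_def intro!: mult_right_mono\<close>)
qed

context
  fixes c :: "('a::euclidean_space \<Rightarrow> nat) \<Rightarrow> real" and r :: real
    and H :: "'a \<Rightarrow> 'b::{real_normed_algebra_1, comm_ring_1, banach}"
  assumes conv: "mconv c r" and H: "\<And>b. b \<in> Basis \<Longrightarrow> norm (H b) \<le> r"
begin

lemma norm_msubst_term_le: "norm (c \<alpha> *\<^sub>R mpow H \<alpha>) \<le> \<bar>c \<alpha>\<bar> * r ^ mdeg \<alpha>"
  using norm_mpow_le[of H r \<alpha>] H by (simp add: mult_left_mono)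

lemma msubst_abs_summable: "(\<lambda>\<alpha>. norm (c \<alpha> *\<^sub>R mpow H \<alpha>)) summable_on mindex"
  using conv unfolding mconv_def
  by (rule summable_on_comparison_test) (use norm_msubst_term_le in auto)

lemma msubst_has_sum: "((\<lambda>\<alpha>. c \<alpha> *\<^sub>R mpow H \<alpha>) has_sum msubst c H) mindex"
  unfolding msubst_def by (rule has_sum_infsum[OF abs_summable_summable[OF msubst_abs_summable]])

lemma norm_msubst_le: "norm (msubst c H) \<le> mnorm c r"
proof -
  have "norm (msubst c H) \<le> (\<Sum>\<^sub>\<infinity>\<alpha>\<in>mindex. norm (c \<alpha> *\<^sub>R mpow H \<alpha>))"
    unfolding msubst_def by (rule norm_infsum_bound[OF msubst_abs_summable])
  also have "\<dots> \<le> mnorm c r"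
    unfolding mnorm_def
    by (rule infsum_mono[OF msubst_abs_summable]) (use conv norm_msubst_term_le in \<open>auto simp: mconv_def\<close>)
  finally show ?thesis .
qed

text \<open>A continuous algebra homomorphism passes through the sum and through each monomial.
  Applied to evaluation at a point, it turns identities between series into identities between
  functions.\<close>

lemma msubst_hom:
  fixes \<phi> :: "'b \<Rightarrow> 'c::{real_normed_algebra_1, comm_ring_1, banach}"
  assumes "bounded_linear \<phi>" "\<phi> 1 = 1" "\<And>x y. \<phi> (x * y) = \<phi> x * \<phi> y"
  shows "\<phi> (msubst c H) = msubst c (\<lambda>b. \<phi> (H b))"
proof -
  have pow: "\<phi> (x ^ n) = \<phi> x ^ n" for x n
    by (induction n) (simp_all add: assms)
  have prod: "\<phi> (\<Prod>b\<in>S. g b) = (\<Prod>b\<in>S. \<phi> (g b))" if "finite S" for S :: "'a set" and g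
    using that by (induction S rule: finite_induct) (simp_all add: assms)
  have "\<phi> (c \<alpha> *\<^sub>R mpow H \<alpha>) = c \<alpha> *\<^sub>R mpow (\<lambda>b. \<phi> (H b)) \<alpha>" for \<alpha>
    using linear_scale[OF bounded_linear.linear[OF assms(1)]] by (simp add: mpow_def prod pow)
  hence "((\<lambda>\<alpha>. c \<alpha> *\<^sub>R mpow (\<lambda>b. \<phi> (H b)) \<alpha>) has_sum \<phi> (msubst c H)) mindex"
    using has_sum_bounded_linear[OF assms(1) msubst_has_sum] by simp
  thus ?thesis unfolding msubst_def by (metis infsumI)
qed

lemma msubst_split:
  assumes "finite S" "S \<subseteq> mindex"
  shows "msubst c H = (\<Sum>\<alpha>\<in>S. c \<alpha> *\<^sub>R mpow H \<alpha>) + msubst (\<lambda>\<alpha>. if \<alpha> \<in> S then 0 else c \<alpha>) H"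
proof -
  have "msubst (\<lambda>\<alpha>. if \<alpha> \<in> S then 0 else c \<alpha>) H = (\<Sum>\<^sub>\<infinity>\<alpha>\<in>mindex - S. c \<alpha> *\<^sub>R mpow H \<alpha>)"
    unfolding msubst_def by (rule infsum_cong_neutral) auto
  moreover have "msubst c H = infsum (\<lambda>\<alpha>. c \<alpha> *\<^sub>R mpow H \<alpha>) (S \<union> (mindex - S))"
    using assms unfolding msubst_def by (simp add: Un_absorb1)
  moreover have "\<dots> = infsum (\<lambda>\<alpha>. c \<alpha> *\<^sub>R mpow H \<alpha>) S + infsum (\<lambda>\<alpha>. c \<alpha> *\<^sub>R mpow H \<alpha>) (mindex - S)"
    by (rule infsum_Un_disjoint)
       (use assms abs_summable_summable[OF msubst_abs_summable] in \<open>auto intro: summable_on_subset_banach\<close>)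
  ultimately show ?thesis using assms by simp
qed

end

lemma msubst_cong: "(\<And>b. b \<in> Basis \<Longrightarrow> H b = H' b) \<Longrightarrow> msubst c H = msubst c H'"
  unfolding msubst_def by (simp cong: mpow_cong)

text \<open>An estimate of Schwarz type: every surviving monomial has degree at least
  \<open>k\<close>, so shrinking the radius from \<open>r\<close> to \<open>s\<close> gains the
  factor \<open>(s / r) ^ k\<close>.\<close>

lemma norm_msubst_vanish_le:
  fixes H :: "'a::euclidean_space \<Rightarrow> 'b::{real_normed_algebra_1, comm_ring_1, banach}"
  assumes "mconv c r" "\<And>b. b \<in> Basis \<Longrightarrow> norm (H b) \<le> s" "0 \<le> s" "s \<le> r" "r > 0"
    and "\<And>\<alpha>. \<alpha> \<in> mindex \<Longrightarrow> mdeg \<alpha> < k \<Longrightarrow> c \<alpha> = 0"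
  shows "norm (msubst c H) \<le> (s / r) ^ k * mnorm c r"
proof -
  have conv: "mconv c s" using assms(1,3,4) by (rule mconv_mono)
  have "norm (msubst c H) \<le> mnorm c s"
    by (rule norm_msubst_le[OF conv assms(2)])
  also have "\<dots> \<le> (\<Sum>\<^sub>\<infinity>\<alpha>\<in>mindex. (s / r) ^ k * (\<bar>c \<alpha>\<bar> * r ^ mdeg \<alpha>))"
    unfolding mnorm_def
  proof (rule infsum_mono)
    show "(\<lambda>\<alpha>. \<bar>c \<alpha>\<bar> * s ^ mdeg \<alpha>) summable_on mindex"
      using conv by (simp add: mconv_def)
    show "(\<lambda>\<alpha>. (s / r) ^ k * (\<bar>c \<alpha>\<bar> * r ^ mdeg \<alpha>)) summable_on mindex"
      using assms(1) by (intro summable_on_cmult_right) (simp add: mconv_def)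
    fix \<alpha> :: "'a \<Rightarrow> nat" assume \<alpha>: "\<alpha> \<in> mindex"
    show "\<bar>c \<alpha>\<bar> * s ^ mdeg \<alpha> \<le> (s / r) ^ k * (\<bar>c \<alpha>\<bar> * r ^ mdeg \<alpha>)"
    proof (cases "mdeg \<alpha> < k")
      case False
      have "s ^ mdeg \<alpha> = (s / r) ^ mdeg \<alpha> * r ^ mdeg \<alpha>"
        using assms by (simp add: power_divide)
      also have "\<dots> \<le> (s / r) ^ k * r ^ mdeg \<alpha>"
        using assms False by (intro mult_right_mono power_decreasing) (auto simp: divide_le_eq)
      finally have "\<bar>c \<alpha>\<bar> * s ^ mdeg \<alpha> \<le> \<bar>c \<alpha>\<bar> * ((s / r) ^ k * r ^ mdeg \<alpha>)"
        by (rule mult_left_mono) simp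
      thus ?thesis by (simp only: mult_ac)
    qed (use assms \<alpha> in auto)
  qed
  also have "\<dots> = (s / r) ^ k * mnorm c r"
    by (simp add: mnorm_def infsum_cmult_right')
  finally show ?thesis .
qed

text \<open>Telescoping: the factors of the monomial are exchanged one at a time, each exchange
  costing \<open>d\<close> times the remaining factors.\<close>

lemma norm_mpow_diff_le:
  fixes H H' :: "'a::euclidean_space \<Rightarrow> 'b::{real_normed_algebra_1, comm_ring_1}"
  assumes "\<And>b. b \<in> Basis \<Longrightarrow> norm (H b) \<le> r" "\<And>b. b \<in> Basis \<Longrightarrow> norm (H' b) \<le> r"
    "\<And>b. b \<in> Basis \<Longrightarrow> norm (H b - H' b) \<le> d" "\<alpha> \<in> mindex"
  shows "norm (mpow H \<alpha> - mpow H' \<alpha>) \<le> real (mdeg \<alpha>) * r ^ (mdeg \<alpha> - 1) * d"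
  using assms(4)
proof (induction "mdeg \<alpha>" arbitrary: \<alpha>)
  case 0
  hence "\<alpha> = 0" by (metis mdeg_eq_0_iff)
  show ?case unfolding \<open>\<alpha> = 0\<close> mpow_0 mdeg_0 by simp
next
  case (Suc n)
  have "\<alpha> \<noteq> 0" using Suc.hyps(2) by auto
  then obtain b \<beta> where \<beta>: "b \<in> Basis" "\<beta> \<in> mindex" "\<alpha> = \<beta> + munit b"
    using mindex_cases[OF Suc.prems] by metis
  have n: "n = mdeg \<beta>" using Suc.hyps(2) \<beta> by simp
  have r: "r \<ge> 0" using assms(1)[OF \<beta>(1)] norm_ge_zero order.trans by blast
  have d: "d \<ge> 0" using assms(3)[OF \<beta>(1)] norm_ge_zero order.trans by blast
  have "mpow H \<alpha> - mpow H' \<alpha> = (mpow H \<beta> - mpow H' \<beta>) * H b + mpow H' \<beta> * (H b - H' b)"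
    using \<beta> by (simp add: mpow_add algebra_simps)
  also have "norm \<dots> \<le> norm (mpow H \<beta> - mpow H' \<beta>) * norm (H b) + norm (mpow H' \<beta>) * norm (H b - H' b)"
    by (intro norm_triangle_le add_mono norm_mult_ineq)
  also have "\<dots> \<le> (real (mdeg \<beta>) * r ^ (mdeg \<beta> - 1) * d) * r + r ^ mdeg \<beta> * d"
    using r d \<beta> n Suc.hyps(1)[OF n \<beta>(2)] assms norm_mpow_le[of H' r \<beta>]
    by (intro add_mono mult_mono) auto
  also have "\<dots> = real (mdeg \<alpha>) * r ^ (mdeg \<alpha> - 1) * d"
    using \<beta> by (cases "mdeg \<beta>") (auto simp: algebra_simps)
  finally show ?case .
qed

text \<open>The arguments stay within half of the radius of convergence, so that the factor
  |\<alpha>| from differencing a monomial is absorbed by 2^(|\<alpha>| - 1).\<close>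

lemma msubst_lipschitz:
  fixes H H' :: "'a::euclidean_space \<Rightarrow> 'b::{real_normed_algebra_1, comm_ring_1, banach}"
  assumes conv: "mconv c r" and "r > 0"
    and H: "\<And>b. b \<in> Basis \<Longrightarrow> norm (H b) \<le> r / 2" and H': "\<And>b. b \<in> Basis \<Longrightarrow> norm (H' b) \<le> r / 2"
    and d: "\<And>b. b \<in> Basis \<Longrightarrow> norm (H b - H' b) \<le> d"
  shows "norm (msubst c H - msubst c H') \<le> mnorm c r / r * d"
proof -
  have d0: "d \<ge> 0" using d[OF SOME_Basis] norm_ge_zero order.trans by blast
  have conv2: "mconv c (r / 2)" using conv \<open>r > 0\<close> by (auto intro: mconv_mono)
  let ?D = "\<lambda>\<alpha>. c \<alpha> *\<^sub>R mpow H \<alpha> - c \<alpha> *\<^sub>R mpow H' \<alpha>"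
  have D: "norm (?D \<alpha>) \<le> (d / r) * (\<bar>c \<alpha>\<bar> * r ^ mdeg \<alpha>)" if "\<alpha> \<in> mindex" for \<alpha>
  proof -
    have "norm (?D \<alpha>) = \<bar>c \<alpha>\<bar> * norm (mpow H \<alpha> - mpow H' \<alpha>)"
      by (simp flip: scaleR_diff_right)
    also have "\<dots> \<le> \<bar>c \<alpha>\<bar> * (real (mdeg \<alpha>) * (r / 2) ^ (mdeg \<alpha> - 1) * d)"
      using H H' d that by (intro mult_left_mono norm_mpow_diff_le) auto
    also have "\<dots> \<le> \<bar>c \<alpha>\<bar> * (r ^ mdeg \<alpha> / r * d)"
    proof (intro mult_left_mono mult_right_mono d0)
      have "n \<le> 2 ^ (n - 1)" for n :: nat
        using less_exp[of "n - 1"] by (cases n) (auto simp: Suc_le_eq)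
      from of_nat_mono[OF this, where ?'a = real] have "real n \<le> 2 ^ (n - 1)" for n
        by simp
      hence "real (mdeg \<alpha>) * (r / 2) ^ (mdeg \<alpha> - 1) \<le> 2 ^ (mdeg \<alpha> - 1) * (r / 2) ^ (mdeg \<alpha> - 1)"
        using \<open>r > 0\<close> by (intro mult_right_mono) auto
      also have "\<dots> = r ^ (mdeg \<alpha> - 1)" by (simp flip: power_mult_distrib)
      finally show "real (mdeg \<alpha>) * (r / 2) ^ (mdeg \<alpha> - 1) \<le> r ^ mdeg \<alpha> / r"
        using \<open>r > 0\<close> by (cases "mdeg \<alpha>") auto
    qed auto
    finally show ?thesis by (simp add: algebra_simps)
  qed
  have conv': "(\<lambda>\<alpha>. (d / r) * (\<bar>c \<alpha>\<bar> * r ^ mdeg \<alpha>)) summable_on mindex"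
    using conv by (intro summable_on_cmult_right) (simp add: mconv_def)
  have summ: "(\<lambda>\<alpha>. norm (?D \<alpha>)) summable_on mindex"
    using conv' by (rule summable_on_comparison_test) (use D in auto)
  have sumH: "((\<lambda>\<alpha>. c \<alpha> *\<^sub>R mpow H \<alpha>) has_sum msubst c H) mindex"
    by (rule msubst_has_sum[OF conv2]) (rule H)
  have sumH': "((\<lambda>\<alpha>. c \<alpha> *\<^sub>R mpow H' \<alpha>) has_sum msubst c H') mindex"
    by (rule msubst_has_sum[OF conv2]) (rule H')
  have "(?D has_sum (msubst c H - msubst c H')) mindex"
    using has_sum_add[OF sumH has_sum_uminusI[OF sumH']] by simp
  hence "norm (msubst c H - msubst c H') \<le> (\<Sum>\<^sub>\<infinity>\<alpha>\<in>mindex. norm (?D \<alpha>))"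
    using norm_infsum_bound[OF summ] by (simp add: infsumI)
  also have "\<dots> \<le> (\<Sum>\<^sub>\<infinity>\<alpha>\<in>mindex. (d / r) * (\<bar>c \<alpha>\<bar> * r ^ mdeg \<alpha>))"
    by (rule infsum_mono[OF summ conv' D])
  also have "\<dots> = mnorm c r / r * d"
    unfolding mnorm_def infsum_cmult_right' by simp
  finally show ?thesis .
qed

section \<open>Pointwise evaluation of weighted series\<close>

text \<open>Division by the weight undoes the normalisation of \<open>coef\<close>. On the cube of
  half side \<open>1 / DIM\<close> the family defining the map is bounded by 1, and evaluation is a
  continuous ring homomorphism there.\<close>

definition psr_eval :: "'a::euclidean_space \<Rightarrow> 'a psr \<Rightarrow> real" where
  "psr_eval h = psr_lin (\<lambda>\<alpha>. mpow (\<lambda>b. h \<bullet> b) \<alpha> / mweight \<alpha>)"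

definition psr_coeff :: "'a::euclidean_space psr \<Rightarrow> ('a \<Rightarrow> nat) \<Rightarrow> real" where
  "psr_coeff f \<alpha> = coef f \<alpha> / mweight \<alpha>"

lemma psr_eval_eq_msubst: "psr_eval h f = msubst (psr_coeff f) (\<lambda>b. h \<bullet> b)"
  by (simp add: psr_eval_def psr_lin_def msubst_def psr_coeff_def)

lemma mconv_psr_coeff: "mconv (psr_coeff f) (1 / real DIM('a))" for f :: "'a::euclidean_space psr"
proof -
  have "(\<lambda>\<alpha>. \<bar>psr_coeff f \<alpha>\<bar> * (1 / real DIM('a)) ^ mdeg \<alpha>) summable_on mindex"
    using abs_summable_coef[of f]
  proof (rule summable_on_comparison_test)
    fix \<alpha> :: "'a \<Rightarrow> nat" assume "\<alpha> \<in> mindex"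
    hence "\<bar>psr_coeff f \<alpha>\<bar> * (1 / real DIM('a)) ^ mdeg \<alpha> \<le> \<bar>psr_coeff f \<alpha>\<bar> * mweight \<alpha>"
      by (intro mult_left_mono mweight_ge) auto
    thus "\<bar>psr_coeff f \<alpha>\<bar> * (1 / real DIM('a)) ^ mdeg \<alpha> \<le> \<bar>coef f \<alpha>\<bar>"
      by (simp add: psr_coeff_def abs_divide)
  qed auto
  thus ?thesis by (simp add: mconv_def)
qed

context
  fixes h :: "'a::euclidean_space"
  assumes h: "\<And>b. b \<in> Basis \<Longrightarrow> \<bar>h \<bullet> b\<bar> \<le> 1 / real DIM('a)"
begin

lemma psr_eval_bound: "\<alpha> \<in> mindex \<Longrightarrow> norm (mpow (\<lambda>b. h \<bullet> b) \<alpha> / mweight \<alpha>) \<le> 1"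
  using norm_mpow_le[of "\<lambda>b. h \<bullet> b" "1 / real DIM('a)" \<alpha>] mweight_ge[of \<alpha>] h
  by (simp add: divide_le_eq abs_of_pos)

lemma bounded_linear_psr_eval: "bounded_linear (psr_eval h)"
  unfolding psr_eval_def by (rule bounded_linear_psr_lin[OF psr_eval_bound])

lemma abs_psr_eval_le: "\<bar>psr_eval h f\<bar> \<le> norm f"
proof -
  have "norm (psr_lin (\<lambda>\<alpha>. mpow (\<lambda>b. h \<bullet> b) \<alpha> / mweight \<alpha>) f) \<le> 1 * norm f"
    by (rule norm_psr_lin_le) (rule psr_eval_bound)
  thus ?thesis by (simp add: psr_eval_def)
qed

lemma psr_eval_mult: "psr_eval h (f * g) = psr_eval h f * psr_eval h g"
proof (rule psr_bilinear_ext[of "\<lambda>f g. psr_eval h (f * g)" "\<lambda>f g. psr_eval h f * psr_eval h g"])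
  fix \<alpha> \<beta> :: "'a \<Rightarrow> nat" assume "\<alpha> \<in> mindex" "\<beta> \<in> mindex"
  thus "psr_eval h (pse \<alpha> * pse \<beta>) = psr_eval h (pse \<alpha>) * psr_eval h (pse \<beta>)"
    using linear_scale[OF bounded_linear.linear[OF bounded_linear_psr_eval]]
    by (simp add: pse_mult) (simp add: psr_eval_def mweight_ratio_def mpow_add)
qed (intro bounded_linear_compose[OF bounded_linear_psr_eval] bounded_linear_mult_left bounded_linear_mult_right
      bounded_linear_compose[OF bounded_linear_mult_left] bounded_linear_compose[OF bounded_linear_mult_right] bounded_linear_psr_eval)+

lemma psr_eval_1: "psr_eval h 1 = 1"
  by (simp add: one_psr_def psr_eval_def)

lemma psr_eval_add: "psr_eval h (f + g) = psr_eval h f + psr_eval h g"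
  by (rule linear_add[OF bounded_linear.linear[OF bounded_linear_psr_eval]])

lemma psr_eval_scaleR: "psr_eval h (c *\<^sub>R f) = c * psr_eval h f"
  using linear_scale[OF bounded_linear.linear[OF bounded_linear_psr_eval]] by simp

lemma psr_eval_sum: "psr_eval h (\<Sum>i\<in>I. f i) = (\<Sum>i\<in>I. psr_eval h (f i))"
  by (rule linear_sum[OF bounded_linear.linear[OF bounded_linear_psr_eval]])

lemma psr_eval_msubst:
  assumes "mconv c r" "\<And>b. b \<in> Basis \<Longrightarrow> norm (H b) \<le> r"
  shows "psr_eval h (msubst c H) = msubst c (\<lambda>b. psr_eval h (H b))"
  by (rule msubst_hom[OF assms bounded_linear_psr_eval psr_eval_1 psr_eval_mult])

end

lemma psr_eval_munit [simp]: "b \<in> Basis \<Longrightarrow> psr_eval h (pse (munit b)) = h \<bullet> b"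
  by (simp add: psr_eval_def)

section \<open>Real analytic functions\<close>

text \<open>A closed cube replaces the ball of \<open>real_analytic_on\<close>: absolute convergence
  on the whole cube is the same as absolute convergence at its corner, which is what
  \<open>mconv c r\<close> expresses.\<close>

definition mexpand :: "('a::euclidean_space \<Rightarrow> real) \<Rightarrow> 'a \<Rightarrow> real \<Rightarrow> (('a \<Rightarrow> nat) \<Rightarrow> real) \<Rightarrow> bool" where
  "mexpand f a r c \<longleftrightarrow> r > 0 \<and> mconv c r \<and>
     (\<forall>h. (\<forall>b\<in>Basis. \<bar>h \<bullet> b\<bar> \<le> r) \<longrightarrow> f (a + h) = msubst c (\<lambda>b. h \<bullet> b))"

lemma mexpandD:
  assumes "mexpand f a r c"
  shows "r > 0" "mconv c r" "\<And>h. (\<And>b. b \<in> Basis \<Longrightarrow> \<bar>h \<bullet> b\<bar> \<le> r) \<Longrightarrow> f (a + h) = msubst c (\<lambda>b. h \<bullet> b)"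
  using assms by (auto simp: mexpand_def)

lemma mexpand_mono: "mexpand f a r c \<Longrightarrow> 0 < s \<Longrightarrow> s \<le> r \<Longrightarrow> mexpand f a s c"
  unfolding mexpand_def by (metis mconv_mono less_imp_le order.trans)

lemma real_analytic_on_iff_mexpand:
  fixes f :: "'a::euclidean_space \<Rightarrow> real"
  shows "real_analytic_on f S \<longleftrightarrow> (\<forall>a\<in>S. \<exists>r c. mexpand f a r c)"
  unfolding real_analytic_on_def mindex_def[symmetric] mpow_def[symmetric]
proof (intro ball_cong refl iffI)
  fix a assume "\<exists>r>0. \<exists>c. \<forall>x\<in>ball a r. ((\<lambda>\<alpha>. c \<alpha> * mpow (\<lambda>b. (x - a) \<bullet> b) \<alpha>) has_sum f x) mindex"
  then obtain r c where r: "r > 0"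
    and c: "\<And>x. x \<in> ball a r \<Longrightarrow> ((\<lambda>\<alpha>. c \<alpha> * mpow (\<lambda>b. (x - a) \<bullet> b) \<alpha>) has_sum f x) mindex" by blast
  \<comment> \<open>The cube of half side \<open>s\<close> lies within norm r/2, since the norm is
    at most the sum of the coordinates' absolute values.\<close>
  define s where "s = r / (2 * real DIM('a))"
  have s: "s > 0" using r by (simp add: s_def)
  have small: "a + h \<in> ball a r" if "\<And>b. b \<in> Basis \<Longrightarrow> \<bar>h \<bullet> b\<bar> \<le> s" for h
  proof -
    have "norm h \<le> (\<Sum>b\<in>Basis. \<bar>h \<bullet> b\<bar>)" by (rule norm_le_l1)
    also have "\<dots> \<le> (\<Sum>b\<in>(Basis::'a set). s)" by (intro sum_mono that)
    also have "\<dots> < r" using r by (simp add: s_def)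
    finally show ?thesis by (simp add: dist_norm)
  qed
  have "mconv c s"
  proof -
    \<comment> \<open>The corner of the cube. The series converges there, and unconditional
      convergence of real families is absolute.\<close>
    define h where "h = (\<Sum>b\<in>(Basis::'a set). s *\<^sub>R b)"
    have h: "h \<bullet> b = s" if "b \<in> Basis" for b
      using that by (simp add: h_def inner_sum_left inner_Basis if_distrib sum.delta cong: if_cong)
    have "a + h \<in> ball a r" by (rule small) (use h s in auto)
    from c[OF this] have "(\<lambda>\<alpha>. c \<alpha> * mpow (\<lambda>b. h \<bullet> b) \<alpha>) summable_on mindex"
      by (auto simp: summable_on_def)
    also have "(\<lambda>\<alpha>. c \<alpha> * mpow (\<lambda>b. h \<bullet> b) \<alpha>) = (\<lambda>\<alpha>. c \<alpha> * s ^ mdeg \<alpha>)"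
      by (simp add: mpow_def h mdeg_def power_sum)
    finally have "(\<lambda>\<alpha>. norm (c \<alpha> * s ^ mdeg \<alpha>)) summable_on mindex"
      by (rule summable_on_iff_abs_summable_on_real[THEN iffD1])
    thus ?thesis using s by (simp add: mconv_def abs_mult)
  qed
  moreover have "f (a + h) = msubst c (\<lambda>b. h \<bullet> b)" if "\<forall>b\<in>Basis. \<bar>h \<bullet> b\<bar> \<le> s" for h
    using c[OF small[of h]] that by (simp add: msubst_def infsumI)
  ultimately show "\<exists>r c. mexpand f a r c" using s unfolding mexpand_def by blast
next
  fix a assume "\<exists>r c. mexpand f a r c"
  then obtain r c where e: "mexpand f a r c" by blast
  have "((\<lambda>\<alpha>. c \<alpha> * mpow (\<lambda>b. (x - a) \<bullet> b) \<alpha>) has_sum f x) mindex" if x: "x \<in> ball a r" for x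
  proof -
    have small: "\<bar>(x - a) \<bullet> b\<bar> \<le> r" if "b \<in> Basis" for b
      using Basis_le_norm[OF that, of "x - a"] x by (simp add: dist_norm norm_minus_commute)
    have "((\<lambda>\<alpha>. c \<alpha> *\<^sub>R mpow (\<lambda>b. (x - a) \<bullet> b) \<alpha>) has_sum msubst c (\<lambda>b. (x - a) \<bullet> b)) mindex"
      by (rule msubst_has_sum[OF mexpandD(2)[OF e]]) (use small in simp)
    thus ?thesis using mexpandD(3)[OF e, of "x - a"] small by simp
  qed
  thus "\<exists>r>0. \<exists>c. \<forall>x\<in>ball a r. ((\<lambda>\<alpha>. c \<alpha> * mpow (\<lambda>b. (x - a) \<bullet> b) \<alpha>) has_sum f x) mindex"
    using mexpandD(1)[OF e] by blast
qed

lemma real_analytic_on_subset: "real_analytic_on f S \<Longrightarrow> T \<subseteq> S \<Longrightarrow> real_analytic_on f T"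
  by (auto simp: real_analytic_on_def)

text \<open>The main source of analyticity: a function that is the evaluation of a series in
  coordinates scaled by \<open>s\<close> inherits convergence from the norm. The radius
  \<open>s / DIM\<close> is the evaluation cube in the original scale.\<close>

lemma mexpandI_psr:
  fixes a :: "'a::euclidean_space"
  assumes s: "s > 0"
    and eq: "\<And>h. (\<And>b. b \<in> Basis \<Longrightarrow> \<bar>h \<bullet> b\<bar> \<le> s / real DIM('a)) \<Longrightarrow> f (a + h) = psr_eval (h /\<^sub>R s) \<phi>"
  shows "mexpand f a (s / real DIM('a)) (\<lambda>\<alpha>. psr_coeff \<phi> \<alpha> / s ^ mdeg \<alpha>)"
  unfolding mexpand_def
proof (intro conjI allI impI)
  show "s / real DIM('a) > 0" using s by simp
  show "mconv (\<lambda>\<alpha>. psr_coeff \<phi> \<alpha> / s ^ mdeg \<alpha>) (s / real DIM('a))"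
    by (rule mconv_le[OF mconv_psr_coeff[of \<phi>], where K = 1])
       (use s in \<open>auto simp: power_divide abs_divide abs_of_pos\<close>)
  fix h :: 'a assume "\<forall>b\<in>Basis. \<bar>h \<bullet> b\<bar> \<le> s / real DIM('a)"
  hence "f (a + h) = psr_eval (h /\<^sub>R s) \<phi>" by (intro eq) blast
  also have "\<dots> = msubst (psr_coeff \<phi>) (\<lambda>b. (1 / s) *\<^sub>R (h \<bullet> b))"
    by (simp add: psr_eval_eq_msubst divide_inverse mult.commute)
  also have "\<dots> = msubst (\<lambda>\<alpha>. psr_coeff \<phi> \<alpha> / s ^ mdeg \<alpha>) (\<lambda>b. h \<bullet> b)"
    unfolding msubst_def mpow_scale by (simp add: power_divide)
  finally show "f (a + h) = msubst (\<lambda>\<alpha>. psr_coeff \<phi> \<alpha> / s ^ mdeg \<alpha>) (\<lambda>b. h \<bullet> b)" .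
qed

lemma box_scale:
  fixes h :: "'a::euclidean_space"
  assumes "s > 0" "b \<in> Basis" "\<And>b. b \<in> Basis \<Longrightarrow> \<bar>h \<bullet> b\<bar> \<le> s / real DIM('a)"
  shows "\<bar>(h /\<^sub>R s) \<bullet> b\<bar> \<le> 1 / real DIM('a)"
  using assms(3)[OF assms(2)] assms(1) by (simp add: abs_mult field_simps)

lemma mexpandI_msubst:
  fixes a :: "'a::euclidean_space" and \<Phi> :: "'b::euclidean_space \<Rightarrow> 'a psr"
  assumes s: "s > 0" and conv: "mconv c r" "\<And>b. b \<in> Basis \<Longrightarrow> norm (\<Phi> b) \<le> r"
    and eq: "\<And>h. (\<And>b. b \<in> Basis \<Longrightarrow> \<bar>h \<bullet> b\<bar> \<le> s / real DIM('a)) \<Longrightarrow>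
       f (a + h) = msubst c (\<lambda>b. psr_eval (h /\<^sub>R s) (\<Phi> b))"
  shows "mexpand f a (s / real DIM('a)) (\<lambda>\<alpha>. psr_coeff (msubst c \<Phi>) \<alpha> / s ^ mdeg \<alpha>)"
proof (rule mexpandI_psr[OF s])
  fix h :: 'a assume h: "\<And>b. b \<in> Basis \<Longrightarrow> \<bar>h \<bullet> b\<bar> \<le> s / real DIM('a)"
  have h': "\<bar>(h /\<^sub>R s) \<bullet> b\<bar> \<le> 1 / real DIM('a)" if "b \<in> Basis" for b
    using box_scale[OF s that h] .
  show "f (a + h) = psr_eval (h /\<^sub>R s) (msubst c \<Phi>)"
    using eq[OF h] psr_eval_msubst[OF h' conv] by simp
qed

text \<open>Substituting \<open>r *\<^sub>R pse (munit b)\<close> for the variables turns an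
  expansion of radius \<open>r\<close> into an element of the algebra in the coordinates h/r, at the
  cost of the factor \<open>DIM\<close> in the radius.\<close>

lemma mexpand_psr:
  fixes a :: "'a::euclidean_space"
  assumes e: "mexpand f a r c"
    and h: "\<And>b. b \<in> Basis \<Longrightarrow> \<bar>h \<bullet> b\<bar> \<le> r / real DIM('a)"
  shows "f (a + h) = psr_eval (h /\<^sub>R r) (msubst c (\<lambda>b. r *\<^sub>R pse (munit b)))"
proof -
  note r = mexpandD(1)[OF e]
  have h': "\<bar>(h /\<^sub>R r) \<bullet> b\<bar> \<le> 1 / real DIM('a)" if "b \<in> Basis" for b
    using box_scale[OF r that h] .
  have "psr_eval (h /\<^sub>R r) (msubst c (\<lambda>b. r *\<^sub>R pse (munit b))) = msubst c (\<lambda>b. psr_eval (h /\<^sub>R r) (r *\<^sub>R pse (munit b)))"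
    by (rule psr_eval_msubst[OF h' mexpandD(2)[OF e]]) (use r in auto)
  also have "\<dots> = msubst c (\<lambda>b. h \<bullet> b)"
    by (rule msubst_cong) (use r psr_eval_scaleR[OF h'] in simp)
  also have "\<dots> = f (a + h)"
  proof (rule mexpandD(3)[OF e, symmetric])
    fix b :: 'a assume "b \<in> Basis"
    have "r / real DIM('a) \<le> r" using r DIM_positive[where 'a='a] by (simp add: divide_le_eq Suc_le_eq)
    thus "\<bar>h \<bullet> b\<bar> \<le> r" using h[OF \<open>b \<in> Basis\<close>] by linarith
  qed
  finally show ?thesis ..
qed

section \<open>Closure properties of analytic functions\<close>

text \<open>Since evaluation is a ring homomorphism, sums and products of functions are represented
  by sums and products of their series, with no rearrangement of double series.\<close>

lemma real_analytic_on_combine: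
  fixes f g :: "'a::euclidean_space \<Rightarrow> real"
  assumes "real_analytic_on f S" "real_analytic_on g S"
  shows real_analytic_on_add: "real_analytic_on (\<lambda>x. f x + g x) S"
    and real_analytic_on_mult: "real_analytic_on (\<lambda>x. f x * g x) S"
proof -
  have "(\<exists>r c. mexpand (\<lambda>x. f x + g x) a r c) \<and> (\<exists>r c. mexpand (\<lambda>x. f x * g x) a r c)" if "a \<in> S" for a
  proof -
    from assms that obtain r1 c r2 d where e: "mexpand f a r1 c" "mexpand g a r2 d"
      unfolding real_analytic_on_iff_mexpand by blast
    define r where "r = min r1 r2"
    have e': "mexpand f a r c" "mexpand g a r d"
      using e mexpandD(1)[OF e(1)] mexpandD(1)[OF e(2)] by (auto intro: mexpand_mono simp: r_def)
    note r = mexpandD(1)[OF e'(1)]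
    define \<phi> where "\<phi> = msubst c (\<lambda>b. r *\<^sub>R pse (munit b))"
    define \<psi> where "\<psi> = msubst d (\<lambda>b. r *\<^sub>R pse (munit b))"
    show ?thesis
    proof (intro conjI exI)
      show "mexpand (\<lambda>x. f x + g x) a (r / real DIM('a)) (\<lambda>\<alpha>. psr_coeff (\<phi> + \<psi>) \<alpha> / r ^ mdeg \<alpha>)"
      proof (rule mexpandI_psr[OF r])
        fix h :: 'a assume h: "\<And>b. b \<in> Basis \<Longrightarrow> \<bar>h \<bullet> b\<bar> \<le> r / real DIM('a)"
        show "f (a + h) + g (a + h) = psr_eval (h /\<^sub>R r) (\<phi> + \<psi>)"
          using mexpand_psr[OF e'(1) h] mexpand_psr[OF e'(2) h] psr_eval_add[OF box_scale[OF r _ h]]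
          by (simp add: \<phi>_def \<psi>_def)
      qed
      show "mexpand (\<lambda>x. f x * g x) a (r / real DIM('a)) (\<lambda>\<alpha>. psr_coeff (\<phi> * \<psi>) \<alpha> / r ^ mdeg \<alpha>)"
      proof (rule mexpandI_psr[OF r])
        fix h :: 'a assume h: "\<And>b. b \<in> Basis \<Longrightarrow> \<bar>h \<bullet> b\<bar> \<le> r / real DIM('a)"
        show "f (a + h) * g (a + h) = psr_eval (h /\<^sub>R r) (\<phi> * \<psi>)"
          using mexpand_psr[OF e'(1) h] mexpand_psr[OF e'(2) h] psr_eval_mult[OF box_scale[OF r _ h]]
          by (simp add: \<phi>_def \<psi>_def)
      qed
    qed
  qed
  thus "real_analytic_on (\<lambda>x. f x + g x) S" "real_analytic_on (\<lambda>x. f x * g x) S"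
    unfolding real_analytic_on_iff_mexpand by blast+
qed

lemma real_analytic_on_const: "real_analytic_on (\<lambda>x. k) (S :: 'a::euclidean_space set)"
  unfolding real_analytic_on_iff_mexpand
proof (intro ballI exI)
  fix a :: 'a
  show "mexpand (\<lambda>x. k) a (1 / real DIM('a)) (\<lambda>\<alpha>. psr_coeff (k *\<^sub>R 1) \<alpha> / 1 ^ mdeg \<alpha>)"
  proof (rule mexpandI_psr)
    fix h :: 'a assume h: "\<And>b. b \<in> Basis \<Longrightarrow> \<bar>h \<bullet> b\<bar> \<le> 1 / real DIM('a)"
    show "k = psr_eval (h /\<^sub>R 1) (k *\<^sub>R 1)"
      using psr_eval_scaleR[of h k 1] psr_eval_1[of h] h by simp
  qed simp
qed

lemma real_analytic_on_inner_Basis: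
  fixes S :: "'a::euclidean_space set"
  assumes b: "b \<in> Basis"
  shows "real_analytic_on (\<lambda>x. x \<bullet> b) S"
  unfolding real_analytic_on_iff_mexpand
proof (intro ballI exI)
  fix a :: 'a
  show "mexpand (\<lambda>x. x \<bullet> b) a (1 / real DIM('a)) (\<lambda>\<alpha>. psr_coeff ((a \<bullet> b) *\<^sub>R 1 + pse (munit b)) \<alpha> / 1 ^ mdeg \<alpha>)"
  proof (rule mexpandI_psr)
    fix h :: 'a assume h: "\<And>b. b \<in> Basis \<Longrightarrow> \<bar>h \<bullet> b\<bar> \<le> 1 / real DIM('a)"
    show "(a + h) \<bullet> b = psr_eval (h /\<^sub>R 1) ((a \<bullet> b) *\<^sub>R 1 + pse (munit b))"
      using h b by (simp add: psr_eval_add psr_eval_scaleR psr_eval_1 inner_add_left)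
  qed simp
qed

lemma real_analytic_on_cmult: "real_analytic_on f S \<Longrightarrow> real_analytic_on (\<lambda>x. k * f x) S"
  by (rule real_analytic_on_mult[OF real_analytic_on_const])

lemma real_analytic_on_diff:
  assumes "real_analytic_on f S" "real_analytic_on g S"
  shows "real_analytic_on (\<lambda>x. f x - g x) S"
  using real_analytic_on_add[OF assms(1) real_analytic_on_cmult[OF assms(2), of "-1"]] by simp

lemma real_analytic_on_sum:
  "(\<And>i. i \<in> I \<Longrightarrow> real_analytic_on (f i) S) \<Longrightarrow> real_analytic_on (\<lambda>x. \<Sum>i\<in>I. f i x) S"
  by (induction I rule: infinite_finite_induct)
     (auto intro: real_analytic_on_const real_analytic_on_add)

lemma real_analytic_on_inner: "real_analytic_on (\<lambda>x. x \<bullet> v) (S :: 'a::euclidean_space set)"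
proof -
  have "real_analytic_on (\<lambda>x. \<Sum>b\<in>Basis. (v \<bullet> b) * (x \<bullet> b)) S"
    by (intro real_analytic_on_sum real_analytic_on_cmult real_analytic_on_inner_Basis)
  moreover have "(\<lambda>x. x \<bullet> v) = (\<lambda>x. \<Sum>b\<in>Basis. (v \<bullet> b) * (x \<bullet> b))"
    by (rule ext) (subst euclidean_inner, simp only: mult.commute)
  ultimately show ?thesis by simp
qed

lemma real_analytic_on_cong:
  assumes "open T" "S \<subseteq> T" "\<And>x. x \<in> T \<Longrightarrow> f x = g x" "real_analytic_on f S"
  shows "real_analytic_on g S"
  unfolding real_analytic_on_iff_mexpand
proof
  fix a assume a: "a \<in> S"
  then obtain r c where e: "mexpand f a r c"
    using assms(4) unfolding real_analytic_on_iff_mexpand by blast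
  obtain e where e0: "e > 0" "ball a e \<subseteq> T" using a assms(1,2) open_contains_ball by blast
  define s where "s = min r (e / (2 * real DIM('a)))"
  have s: "0 < s" "s \<le> r" using mexpandD(1)[OF e] e0 by (auto simp: s_def)
  have "mexpand f a s c" using mexpand_mono[OF e s] .
  moreover have "a + h \<in> T" if "\<forall>b\<in>Basis. \<bar>h \<bullet> b\<bar> \<le> s" for h
  proof -
    have "norm h \<le> (\<Sum>b\<in>Basis. \<bar>h \<bullet> b\<bar>)" by (rule norm_le_l1)
    also have "\<dots> \<le> (\<Sum>b\<in>(Basis::'a set). s)" using that by (intro sum_mono) auto
    also have "\<dots> = real DIM('a) * s" by simp
    also have "\<dots> \<le> real DIM('a) * (e / (2 * real DIM('a)))"
      by (intro mult_left_mono) (auto simp: s_def)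
    also have "\<dots> < e" using e0 by simp
    finally show ?thesis using e0 by (auto simp: dist_norm)
  qed
  ultimately have "mexpand g a s c"
    using assms(3) unfolding mexpand_def by auto
  thus "\<exists>r c. mexpand g a r c" by blast
qed

lemma msubst_minus_const:
  fixes H :: "'a::euclidean_space \<Rightarrow> 'b::{real_normed_algebra_1, comm_ring_1, banach}"
  assumes "mconv c r" "\<And>b. b \<in> Basis \<Longrightarrow> norm (H b) \<le> s" "0 \<le> s" "s \<le> r" "r > 0"
  shows "norm (msubst c H - c 0 *\<^sub>R 1) \<le> s / r * mnorm c r"
    and "msubst c H - c 0 *\<^sub>R 1 = msubst (c(0 := 0)) H"
proof -
  have le: "mconv (c(0 := 0)) r" "mnorm (c(0 := 0)) r \<le> mnorm c r"
    using mnorm_mono[OF assms(1), of "c(0 := 0)"] assms(5) by auto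
  have "msubst c H = (\<Sum>\<alpha>\<in>{0}. c \<alpha> *\<^sub>R mpow H \<alpha>) + msubst (\<lambda>\<alpha>. if \<alpha> \<in> {0} then 0 else c \<alpha>) H"
    by (rule msubst_split[OF mconv_mono[OF assms(1,3,4)] assms(2)]) auto
  moreover have "(\<lambda>\<alpha>. if \<alpha> \<in> {0} then 0 else c \<alpha>) = c(0 := 0)" by (auto simp: fun_eq_iff)
  ultimately show eq: "msubst c H - c 0 *\<^sub>R 1 = msubst (c(0 := 0)) H" by simp
  have "norm (msubst (c(0 := 0)) H) \<le> (s / r) ^ 1 * mnorm (c(0 := 0)) r"
    by (rule norm_msubst_vanish_le[OF le(1) assms(2-5)]) (auto simp: mdeg_eq_0_iff)
  also have "\<dots> \<le> s / r * mnorm c r"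
    using le(2) assms by (simp add: divide_right_mono mult_left_mono)
  finally show "norm (msubst c H - c 0 *\<^sub>R 1) \<le> s / r * mnorm c r" by (simp add: eq)
qed

lemma mexpand_center: "mexpand f a r c \<Longrightarrow> f a = c 0"
  using mexpandD(3)[of f a r c 0] msubst_minus_const(1)[OF mexpandD(2), of f a r c "\<lambda>b. 0 \<bullet> b :: real" 0]
    mexpandD(1)[of f a r c] by simp

text \<open>Deprived of their constant terms, the series of the inner components become as small as
  desired when the scale shrinks, hence admissible for substitution into the outer
  expansion.\<close>

lemma real_analytic_on_compose:
  fixes f :: "'b::euclidean_space \<Rightarrow> real" and g :: "'a::euclidean_space \<Rightarrow> 'b"
  assumes f: "real_analytic_on f T" and g: "\<And>b. b \<in> Basis \<Longrightarrow> real_analytic_on (\<lambda>x. g x \<bullet> b) S"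
    and "g ` S \<subseteq> T"
  shows "real_analytic_on (\<lambda>x. f (g x)) S"
  unfolding real_analytic_on_iff_mexpand
proof
  fix a assume a: "a \<in> S"
  then obtain r c where e: "mexpand f (g a) r c"
    using assms unfolding real_analytic_on_iff_mexpand by blast
  note r = mexpandD(1)[OF e]
  have "\<forall>b\<in>Basis. \<exists>r c. mexpand (\<lambda>x. g x \<bullet> b) a r c"
    using g a unfolding real_analytic_on_iff_mexpand by blast
  then obtain rr cc where ee: "\<And>b. b \<in> Basis \<Longrightarrow> mexpand (\<lambda>x. g x \<bullet> b) a (rr b) (cc b)" by metis
  define r0 where "r0 = Min (rr ` Basis)"
  have r0: "r0 > 0" "\<And>b. b \<in> Basis \<Longrightarrow> r0 \<le> rr b"
    using mexpandD(1)[OF ee] by (auto simp: r0_def)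
  have ee0: "mexpand (\<lambda>x. g x \<bullet> b) a r0 (cc b)" if "b \<in> Basis" for b
    using mexpand_mono[OF ee[OF that] r0(1) r0(2)[OF that]] .
  define M where "M = (\<Sum>b\<in>Basis. mnorm (cc b) r0)"
  have M: "mnorm (cc b) r0 \<le> M" if "b \<in> Basis" for b
    unfolding M_def by (rule member_le_sum) (use that r0 in \<open>auto intro: mnorm_nonneg\<close>)
  have M0: "M \<ge> 0" unfolding M_def using r0 by (intro sum_nonneg mnorm_nonneg) auto
  \<comment> \<open>The second bound gives \<open>s / r0 * M \<le> r\<close>; the summand 1 keeps
    the denominator positive.\<close>
  define s where "s = min r0 (r * r0 / (M + 1))"
  have s: "s > 0" "s \<le> r0" "s / r0 * M \<le> r"
  proof -
    show "s > 0" "s \<le> r0" using r0 r M0 by (auto simp: s_def)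
    have "s \<le> r * r0 / (M + 1)" by (simp add: s_def)
    hence "s / r0 \<le> r / (M + 1)" using r0 by (simp add: field_simps)
    hence "s / r0 * M \<le> r / (M + 1) * M" using M0 by (intro mult_right_mono)
    also have "\<dots> \<le> r" using M0 r by (simp add: field_simps)
    finally show "s / r0 * M \<le> r" .
  qed
  define \<Phi> where "\<Phi> b = msubst (cc b) (\<lambda>b'. s *\<^sub>R pse (munit b')) - cc b 0 *\<^sub>R 1" for b
  have \<Phi>: "norm (\<Phi> b) \<le> r" if "b \<in> Basis" for b
  proof -
    have "norm (\<Phi> b) \<le> s / r0 * mnorm (cc b) r0"
      unfolding \<Phi>_def by (rule msubst_minus_const(1)[OF mexpandD(2)[OF ee0[OF that]]]) (use s r0 in auto)
    also have "\<dots> \<le> s / r0 * M" using M[OF that] s r0 by (intro mult_left_mono) auto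
    finally show ?thesis using s by simp
  qed
  have "mexpand (\<lambda>x. f (g x)) a (s / real DIM('a)) (\<lambda>\<alpha>. psr_coeff (msubst c \<Phi>) \<alpha> / s ^ mdeg \<alpha>)"
  proof (rule mexpandI_msubst[OF s(1) mexpandD(2)[OF e] \<Phi>])
    fix h :: 'a assume h: "\<And>b. b \<in> Basis \<Longrightarrow> \<bar>h \<bullet> b\<bar> \<le> s / real DIM('a)"
    have h': "\<bar>(h /\<^sub>R s) \<bullet> b\<bar> \<le> 1 / real DIM('a)" if "b \<in> Basis" for b
      using box_scale[OF s(1) that h] .
    have eval: "psr_eval (h /\<^sub>R s) (\<Phi> b) = (g (a + h) - g a) \<bullet> b" if b: "b \<in> Basis" for b
    proof -
      have "psr_eval (h /\<^sub>R s) (msubst (cc b) (\<lambda>b'. s *\<^sub>R pse (munit b'))) = g (a + h) \<bullet> b"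
        using mexpand_psr[OF mexpand_mono[OF ee0[OF b] s(1,2)] h] by simp
      moreover have "psr_eval (h /\<^sub>R s) (cc b 0 *\<^sub>R 1) = g a \<bullet> b"
        using mexpand_center[OF ee0[OF b]] psr_eval_scaleR[OF h'] psr_eval_1[OF h'] by simp
      ultimately show ?thesis
        using linear_diff[OF bounded_linear.linear[OF bounded_linear_psr_eval[OF h']]]
        by (simp add: \<Phi>_def inner_diff_left)
    qed
    have "f (g a + (g (a + h) - g a)) = msubst c (\<lambda>b. (g (a + h) - g a) \<bullet> b)"
    proof (rule mexpandD(3)[OF e])
      fix b :: 'b assume b: "b \<in> Basis"
      show "\<bar>(g (a + h) - g a) \<bullet> b\<bar> \<le> r"
        using abs_psr_eval_le[OF h', of "\<Phi> b"] \<Phi>[OF b] eval[OF b] by simp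
    qed
    thus "f (g (a + h)) = msubst c (\<lambda>b. psr_eval (h /\<^sub>R s) (\<Phi> b))"
      using msubst_cong[of "\<lambda>b. psr_eval (h /\<^sub>R s) (\<Phi> b)" "\<lambda>b. (g (a + h) - g a) \<bullet> b" c] eval by simp
  qed
  thus "\<exists>r c. mexpand (\<lambda>x. f (g x)) a r c" by blast
qed

section \<open>Derivatives of real analytic functions\<close>

lemma pdiff_eq_derivative:
  assumes "(f has_derivative D) (at x)"
  shows "pdiff f v x = D v"
proof -
  interpret D: bounded_linear D using assms by (rule has_derivative_bounded_linear)
  have "((\<lambda>t::real. x + t *\<^sub>R v) has_derivative (\<lambda>t. t *\<^sub>R v)) (at 0)"
    by (auto intro!: derivative_eq_intros)
  moreover have "(f has_derivative D) (at (x + 0 *\<^sub>R v))" using assms by simp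
  ultimately have "((\<lambda>t. f (x + t *\<^sub>R v)) has_derivative (\<lambda>t. D (t *\<^sub>R v))) (at 0)"
    by (rule has_derivative_compose)
  hence "((\<lambda>t. f (x + t *\<^sub>R v)) has_field_derivative D v) (at 0)"
    by (simp add: has_field_derivative_def D.scaleR mult_commute_abs)
  thus ?thesis unfolding pdiff_def by (rule DERIV_imp_deriv)
qed

lemma pdiff_cong:
  assumes "open S" "x \<in> S" "\<And>y. y \<in> S \<Longrightarrow> f y = g y"
  shows "pdiff f v x = pdiff g v x"
  unfolding pdiff_def
proof (rule deriv_cong_ev)
  have "open ((\<lambda>t. x + t *\<^sub>R v) -` S)"
    by (intro open_vimage assms(1) continuous_intros)
  hence "\<forall>\<^sub>F t in nhds 0. x + t *\<^sub>R v \<in> S"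
    unfolding eventually_nhds using assms(2) by (intro exI[of _ "(\<lambda>t. x + t *\<^sub>R v) -` S"]) auto
  thus "\<forall>\<^sub>F t in nhds 0. f (x + t *\<^sub>R v) = g (x + t *\<^sub>R v)"
    by eventually_elim (rule assms(3))
qed simp

lemma mexpand_has_derivative:
  fixes f :: "'a::euclidean_space \<Rightarrow> real"
  assumes e: "mexpand f a r c"
  shows "(f has_derivative (\<lambda>h. \<Sum>b\<in>Basis. c (munit b) * (h \<bullet> b))) (at a)"
proof -
  note r = mexpandD(1)[OF e] and conv = mexpandD(2)[OF e]
  let ?D = "\<lambda>h::'a. \<Sum>b\<in>Basis. c (munit b) * (h \<bullet> b)"
  \<comment> \<open>The exponents of degree at most one. Once they are split off, the remainder
    vanishes to second order and the Schwarz-type bound makes it quadratic in the increment.\<close>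
  define S :: "('a \<Rightarrow> nat) set" where "S = insert 0 (munit ` Basis)"
  define d where "d \<alpha> = (if \<alpha> \<in> S then 0 else c \<alpha>)" for \<alpha>
  define M where "M = mnorm d r"
  have d: "mconv d r" using mnorm_mono(1)[OF conv, of d] r by (simp add: d_def)
  have rest: "norm (f (a + h) - f a - ?D h) \<le> (norm h / r)\<^sup>2 * M" if h: "norm h \<le> r" for h
  proof -
    have h': "\<bar>h \<bullet> b\<bar> \<le> norm h" if "b \<in> Basis" for b using Basis_le_norm[OF that] .
    hence "f (a + h) = msubst c (\<lambda>b. h \<bullet> b)" using h by (intro mexpandD(3)[OF e]) force
    also have "\<dots> = (\<Sum>\<alpha>\<in>S. c \<alpha> *\<^sub>R mpow (\<lambda>b. h \<bullet> b) \<alpha>) + msubst (\<lambda>\<alpha>. if \<alpha> \<in> S then 0 else c \<alpha>) (\<lambda>b. h \<bullet> b)"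
      by (rule msubst_split[OF conv]) (use h h' in \<open>force simp: S_def\<close>)+
    also have "(\<Sum>\<alpha>\<in>S. c \<alpha> *\<^sub>R mpow (\<lambda>b. h \<bullet> b) \<alpha>) = c 0 + (\<Sum>\<alpha>\<in>munit ` Basis. c \<alpha> *\<^sub>R mpow (\<lambda>b. h \<bullet> b) \<alpha>)"
      unfolding S_def by (subst sum.insert) auto
    also have "(\<Sum>\<alpha>\<in>munit ` Basis. c \<alpha> *\<^sub>R mpow (\<lambda>b. h \<bullet> b) \<alpha>) = ?D h"
      by (subst sum.reindex) (auto simp: inj_on_def)
    finally have "f (a + h) - f a - ?D h = msubst d (\<lambda>b. h \<bullet> b)"
      using mexpand_center[OF e] by (simp add: d_def[abs_def] flip: zero_fun_def)
    moreover have "norm (msubst d (\<lambda>b. h \<bullet> b)) \<le> (norm h / r) ^ 2 * mnorm d r"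
    proof (rule norm_msubst_vanish_le[OF d])
      fix \<alpha> :: "'a \<Rightarrow> nat" assume "\<alpha> \<in> mindex" "mdeg \<alpha> < 2"
      hence "mdeg \<alpha> = 0 \<or> mdeg \<alpha> = 1" by auto
      thus "d \<alpha> = 0" using \<open>\<alpha> \<in> mindex\<close> by (auto simp: d_def S_def mdeg_eq_0_iff dest: mdeg_eq_1_iff[THEN iffD1])
    qed (use h h' r in auto)
    ultimately show ?thesis by (simp add: M_def)
  qed
  show ?thesis unfolding has_derivative_at
  proof
    show "bounded_linear ?D"
      by (intro bounded_linear_sum bounded_linear_mult_const bounded_linear_const_mult bounded_linear_inner_left)
    have lim: "(\<lambda>h::'a. norm h * (M / r\<^sup>2)) \<midarrow>0\<rightarrow> 0"
      by (rule tendsto_eq_intros refl | simp)+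
    show "(\<lambda>h. norm (f (a + h) - f a - ?D h) / norm h) \<midarrow>0\<rightarrow> 0"
    proof (rule Lim_null_comparison[OF _ lim])
      have "norm (norm (f (a + h) - f a - ?D h) / norm h) \<le> norm h * (M / r\<^sup>2)" if "h \<noteq> 0" "norm h < r" for h
      proof -
        have "norm (f (a + h) - f a - ?D h) \<le> (norm h * (M / r\<^sup>2)) * norm h"
          using rest[of h] that by (simp add: power2_eq_square power_divide field_simps)
        thus ?thesis using that by (simp add: divide_le_eq)
      qed
      thus "\<forall>\<^sub>F h in at 0. norm (norm (f (a + h) - f a - ?D h) / norm h) \<le> norm h * (M / r\<^sup>2)"
        unfolding eventually_at by (intro exI[of _ r]) (use r in auto)
    qed
  qed
qed

lemma mexpand_pdiff_center:
  assumes "mexpand f a r c" "b \<in> Basis"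
  shows "pdiff f b a = c (munit b)"
  using pdiff_eq_derivative[OF mexpand_has_derivative[OF assms(1)], of b] assms(2)
  by (simp add: inner_Basis if_distrib sum.delta cong: if_cong)

lemma real_analytic_on_has_derivative:
  fixes f :: "'a::euclidean_space \<Rightarrow> real"
  assumes "real_analytic_on f S" "x \<in> S"
  shows "(f has_derivative (\<lambda>h. \<Sum>b\<in>Basis. pdiff f b x * (h \<bullet> b))) (at x)"
proof -
  obtain r c where e: "mexpand f x r c" using assms unfolding real_analytic_on_iff_mexpand by blast
  have "(\<lambda>h. \<Sum>b\<in>Basis. pdiff f b x * (h \<bullet> b)) = (\<lambda>h. \<Sum>b\<in>Basis. c (munit b) * (h \<bullet> b))"
    by (intro ext sum.cong refl) (simp add: mexpand_pdiff_center[OF e])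
  thus ?thesis using mexpand_has_derivative[OF e] by simp
qed

section \<open>First-order coefficients, recentring and termwise differentiation\<close>

lemma munit_same [simp]: "munit b b = 1"
  by (simp add: munit_def)

lemma munit_eq_add_iff: "munit b = \<alpha> + \<beta> \<longleftrightarrow> \<alpha> = munit b \<and> \<beta> = 0 \<or> \<alpha> = 0 \<and> \<beta> = munit b"
proof
  assume *: "munit b = \<alpha> + \<beta>"
  hence b: "\<alpha> b + \<beta> b = 1" by (metis munit_def plus_fun_apply)
  have x: "\<alpha> x = 0" "\<beta> x = 0" if "x \<noteq> b" for x
    using fun_cong[OF *, of x] that by (auto simp: munit_def)
  from b consider "\<alpha> b = 1" "\<beta> b = 0" | "\<alpha> b = 0" "\<beta> b = 1" by (cases "\<alpha> b") auto
  thus "\<alpha> = munit b \<and> \<beta> = 0 \<or> \<alpha> = 0 \<and> \<beta> = munit b"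
  proof cases
    case 1
    have "\<alpha> y = munit b y \<and> \<beta> y = 0" for y using 1 x by (cases "y = b") (auto simp: munit_def)
    thus ?thesis by (auto simp: fun_eq_iff)
  next
    case 2
    have "\<alpha> y = 0 \<and> \<beta> y = munit b y" for y using 2 x by (cases "y = b") (auto simp: munit_def)
    thus ?thesis by (auto simp: fun_eq_iff)
  qed
qed auto

lemma zero_eq_add_iff: "0 = \<alpha> + \<beta> \<longleftrightarrow> \<alpha> = 0 \<and> \<beta> = 0" for \<alpha> \<beta> :: "'a \<Rightarrow> nat"
  by (auto simp: fun_eq_iff)

lemma coef_mult_0: "coef (f * g) 0 = coef f 0 * coef g 0"
proof (rule psr_bilinear_ext[of "\<lambda>f g. coef (f * g) 0" "\<lambda>f g. coef f 0 * coef g 0"])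
  fix \<alpha> \<beta> :: "'a \<Rightarrow> nat" assume "\<alpha> \<in> mindex" "\<beta> \<in> mindex"
  thus "coef (pse \<alpha> * pse \<beta>) 0 = coef (pse \<alpha>) 0 * coef (pse \<beta>) 0"
    by (auto simp: pse_mult coef_pse mweight_ratio_def zero_eq_add_iff)
qed (intro bounded_linear_compose[OF bounded_linear_coef] bounded_linear_mult_right bounded_linear_mult_left
      bounded_linear_const_mult bounded_linear_mult_const bounded_linear_coef)+

text \<open>The weights of 0 and of the unit multi-indices are 1, so the Leibniz rule for
  first-order coefficients needs no correction factor.\<close>

lemma coef_mult_munit:
  assumes "b \<in> Basis"
  shows "coef (f * g) (munit b) = coef f (munit b) * coef g 0 + coef f 0 * coef g (munit b)"
proof (rule psr_bilinear_ext[of "\<lambda>f g. coef (f * g) (munit b)"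
      "\<lambda>f g. coef f (munit b) * coef g 0 + coef f 0 * coef g (munit b)"])
  fix \<alpha> \<beta> :: "'a \<Rightarrow> nat" assume "\<alpha> \<in> mindex" "\<beta> \<in> mindex"
  thus "coef (pse \<alpha> * pse \<beta>) (munit b) = coef (pse \<alpha>) (munit b) * coef (pse \<beta>) 0 + coef (pse \<alpha>) 0 * coef (pse \<beta>) (munit b)"
    using assms munit_neq_0[of b] by (auto simp: pse_mult coef_pse mweight_ratio_def munit_eq_add_iff dest: sym)
qed (intro bounded_linear_compose[OF bounded_linear_coef] bounded_linear_mult_right bounded_linear_mult_left
      bounded_linear_add bounded_linear_const_mult bounded_linear_mult_const bounded_linear_coef)+

lemma coef_mpow_0:
  assumes "\<alpha> \<in> mindex"
  shows "coef (mpow H \<alpha>) 0 = mpow (\<lambda>b. coef (H b) 0) \<alpha>"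
  using assms
proof (induction "mdeg \<alpha>" arbitrary: \<alpha>)
  case 0
  hence "\<alpha> = 0" by (metis mdeg_eq_0_iff)
  show ?case unfolding \<open>\<alpha> = 0\<close> mpow_0 by (simp add: one_psr_def coef_pse flip: zero_fun_def)
next
  case (Suc n)
  have "\<alpha> \<noteq> 0" using Suc.hyps(2) by auto
  then obtain b \<beta> where "b \<in> Basis" "\<beta> \<in> mindex" "\<alpha> = \<beta> + munit b"
    using mindex_cases[OF Suc.prems] by metis
  thus ?case using Suc.hyps by (simp add: mpow_add coef_mult_0)
qed

lemma minus_munit_add_swap:
  assumes "\<beta> b > 0"
  shows "(\<beta> + munit b') - munit b = (\<beta> - munit b) + munit b'"
  using assms by (auto simp: fun_eq_iff munit_def fun_diff_def)

text \<open>The derivative of a monomial, obtained by repeated use of the Leibniz rule. The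
  truncated subtraction in \<alpha> - \<open>munit b\<close> is harmless because the factor
  \<open>\<alpha> b\<close> vanishes when it truncates.\<close>

lemma coef_mpow_munit:
  assumes "\<alpha> \<in> mindex" "b \<in> Basis"
    and "\<And>b'. b' \<in> Basis \<Longrightarrow> coef (H b') (munit b) = (if b' = b then d else 0)"
  shows "coef (mpow H \<alpha>) (munit b) = real (\<alpha> b) * mpow (\<lambda>b. coef (H b) 0) (\<alpha> - munit b) * d"
  using assms(1)
proof (induction "mdeg \<alpha>" arbitrary: \<alpha>)
  case 0
  hence "\<alpha> = 0" by (metis mdeg_eq_0_iff)
  show ?case unfolding \<open>\<alpha> = 0\<close> mpow_0 by (simp add: one_psr_def coef_pse flip: zero_fun_def)
next
  case (Suc n)
  have "\<alpha> \<noteq> 0" using Suc.hyps(2) by auto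
  then obtain b' \<beta> where \<beta>: "b' \<in> Basis" "\<beta> \<in> mindex" "\<alpha> = \<beta> + munit b'"
    using mindex_cases[OF Suc.prems] by metis
  let ?H = "\<lambda>b. coef (H b) 0"
  have IH: "coef (mpow H \<beta>) (munit b) = real (\<beta> b) * mpow ?H (\<beta> - munit b) * d"
    using Suc.hyps \<beta> by simp
  have shift: "real (\<beta> b) * mpow ?H (\<beta> - munit b) * ?H b' = real (\<beta> b) * mpow ?H ((\<beta> + munit b') - munit b)"
  proof (cases "\<beta> b = 0")
    case False
    thus ?thesis using \<beta>(1) by (simp add: minus_munit_add_swap mpow_add)
  qed simp
  have "coef (mpow H \<alpha>) (munit b) = real (\<beta> b) * mpow ?H (\<beta> - munit b) * d * ?H b' + mpow ?H \<beta> * (if b' = b then d else 0)"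
    using \<beta> assms(2) assms(3)[OF \<beta>(1)] by (simp add: mpow_add coef_mult_munit IH coef_mpow_0)
  also have "\<dots> = real (\<beta> b) * mpow ?H (\<alpha> - munit b) * d + mpow ?H \<beta> * (if b' = b then d else 0)"
    using shift \<beta>(3) by (metis (no_types, lifting) mult.commute mult.left_commute)
  also have "\<dots> = real (\<alpha> b) * mpow ?H (\<alpha> - munit b) * d"
  proof (cases "b' = b")
    case True
    have "\<alpha> - munit b = \<beta>" using \<beta> True by (auto simp: fun_eq_iff fun_diff_def)
    moreover have "\<alpha> b = \<beta> b + 1" using \<beta> True by (simp add: munit_def)
    ultimately show ?thesis using True by (simp add: algebra_simps)
  next
    case False
    have "\<alpha> b = \<beta> b" using \<beta> False by (simp add: munit_def)
    thus ?thesis using False by simp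
  qed
  finally show ?case .
qed

definition mderiv :: "'a::euclidean_space \<Rightarrow> (('a \<Rightarrow> nat) \<Rightarrow> real) \<Rightarrow> ('a \<Rightarrow> nat) \<Rightarrow> real" where
  "mderiv b c \<beta> = (real (\<beta> b) + 1) * c (\<beta> + munit b)"

text \<open>A shift of the index by \<open>munit b\<close>; the exponents not reached by the shift
  have \<open>\<alpha> b = 0\<close> and contribute nothing.\<close>

lemma infsum_mderiv:
  assumes b: "b \<in> Basis"
  shows "(\<Sum>\<^sub>\<infinity>\<alpha>\<in>mindex. c \<alpha> * (real (\<alpha> b) * mpow x (\<alpha> - munit b))) = (msubst (mderiv b c) x :: real)"
proof -
  have inj: "inj_on (\<lambda>\<beta>. \<beta> + munit b) mindex" by (auto simp: inj_on_def)
  have "(\<Sum>\<^sub>\<infinity>\<alpha>\<in>mindex. c \<alpha> * (real (\<alpha> b) * mpow x (\<alpha> - munit b)))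
      = infsum (\<lambda>\<alpha>. c \<alpha> * (real (\<alpha> b) * mpow x (\<alpha> - munit b))) ((\<lambda>\<beta>. \<beta> + munit b) ` mindex)"
  proof (rule infsum_cong_neutral)
    fix \<alpha> assume \<alpha>: "\<alpha> \<in> mindex - (\<lambda>\<beta>. \<beta> + munit b) ` mindex"
    hence "\<alpha> b = 0" using minus_munit_add[of \<alpha> b] by (metis DiffD1 DiffD2 diff_mindex image_eqI neq0_conv)
    thus "c \<alpha> * (real (\<alpha> b) * mpow x (\<alpha> - munit b)) = 0" by simp
  next
    fix \<alpha> assume \<alpha>: "\<alpha> \<in> (\<lambda>\<beta>. \<beta> + munit b) ` mindex - mindex"
    thus "c \<alpha> * (real (\<alpha> b) * mpow x (\<alpha> - munit b)) = 0" using b by auto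
  qed simp
  also have "\<dots> = msubst (mderiv b c) x"
    unfolding msubst_def by (subst infsum_reindex[OF inj])
      (auto simp: o_def mderiv_def intro!: infsum_cong)
  finally show ?thesis .
qed

text \<open>Halving the radius pays for the factor \<beta>_b + 1, which is at most
  2^|\<beta>|.\<close>

lemma mconv_mderiv:
  assumes conv: "mconv c r" and r: "r > 0" and b: "b \<in> Basis"
  shows "mconv (mderiv b c) (r / 2)"
proof -
  have inj: "inj_on (\<lambda>\<beta>. \<beta> + munit b) mindex" by (auto simp: inj_on_def)
  have "(\<lambda>\<alpha>. \<bar>c \<alpha>\<bar> * r ^ mdeg \<alpha>) summable_on (\<lambda>\<beta>. \<beta> + munit b) ` mindex"
    using conv unfolding mconv_def by (rule summable_on_subset_banach) (use b in auto)
  hence "(\<lambda>\<beta>. \<bar>c (\<beta> + munit b)\<bar> * r ^ mdeg (\<beta> + munit b)) summable_on mindex"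
    by (simp add: summable_on_reindex[OF inj] o_def)
  hence *: "(\<lambda>\<beta>. (1 / r) * (\<bar>c (\<beta> + munit b)\<bar> * r ^ mdeg (\<beta> + munit b))) summable_on mindex"
    by (rule summable_on_cmult_right)
  show ?thesis unfolding mconv_def
  proof (rule summable_on_comparison_test[OF *])
    fix \<beta> :: "'a \<Rightarrow> nat" assume "\<beta> \<in> mindex"
    have "\<beta> b + 1 \<le> mdeg \<beta> + 1" using component_le_mdeg[OF b, of \<beta>] by simp
    also have "\<dots> \<le> 2 ^ mdeg \<beta>" using less_exp[of "mdeg \<beta>"] by (simp add: Suc_le_eq)
    finally have "real (\<beta> b + 1) \<le> real (2 ^ mdeg \<beta>)" by (rule of_nat_mono)
    hence "\<bar>c (\<beta> + munit b)\<bar> * (r / 2) ^ mdeg \<beta> * (real (\<beta> b) + 1) \<le> \<bar>c (\<beta> + munit b)\<bar> * (r / 2) ^ mdeg \<beta> * 2 ^ mdeg \<beta>"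
      using r by (intro mult_left_mono) auto
    also have "\<dots> = \<bar>c (\<beta> + munit b)\<bar> * r ^ mdeg \<beta>"
      by (simp add: power_divide)
    finally show "\<bar>mderiv b c \<beta>\<bar> * (r / 2) ^ mdeg \<beta> \<le> (1 / r) * (\<bar>c (\<beta> + munit b)\<bar> * r ^ mdeg (\<beta> + munit b))"
      using r b by (simp add: mderiv_def abs_mult mult_ac)
  qed (use r in auto)
qed

text \<open>Recentring is the substitution of x + s X for the variables, so no binomial
  rearrangement is needed. The linear coefficients of the result identify the derivative at every
  interior point of the cube with the termwise one.\<close>

lemma mexpand_shift:
  fixes a :: "'a::euclidean_space"
  assumes e: "mexpand f a r c" and x: "\<And>b. b \<in> Basis \<Longrightarrow> \<bar>x \<bullet> b\<bar> < r"
  obtains r' c' where "mexpand f (a + x) r' c'"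
    "\<And>b. b \<in> Basis \<Longrightarrow> c' (munit b) = msubst (mderiv b c) (\<lambda>b. x \<bullet> b)"
proof -
  note conv = mexpandD(2)[OF e]
  \<comment> \<open>The distance from x to the boundary of the cube, the largest scale for which x +
    s X still has norm at most \<open>r\<close> in every component.\<close>
  define s where "s = Min ((\<lambda>b. r - \<bar>x \<bullet> b\<bar>) ` (Basis::'a set))"
  have s: "s > 0" using x by (auto simp: s_def)
  have s_le: "\<bar>x \<bullet> b\<bar> + s \<le> r" if "b \<in> Basis" for b
  proof -
    have "s \<le> r - \<bar>x \<bullet> b\<bar>" unfolding s_def by (rule Min_le) (use that in auto)
    thus ?thesis by simp
  qed
  define \<Phi> :: "'a \<Rightarrow> 'a psr" where "\<Phi> b = (x \<bullet> b) *\<^sub>R 1 + s *\<^sub>R pse (munit b)" for b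
  have \<Phi>: "norm (\<Phi> b) \<le> r" if "b \<in> Basis" for b
    unfolding \<Phi>_def by (rule norm_triangle_le) (use s_le[OF that] s that in simp)
  have e': "mexpand f (a + x) (s / real DIM('a)) (\<lambda>\<alpha>. psr_coeff (msubst c \<Phi>) \<alpha> / s ^ mdeg \<alpha>)"
  proof (rule mexpandI_msubst[OF s conv \<Phi>])
    fix h :: 'a assume h: "\<And>b. b \<in> Basis \<Longrightarrow> \<bar>h \<bullet> b\<bar> \<le> s / real DIM('a)"
    have h': "\<bar>(h /\<^sub>R s) \<bullet> b\<bar> \<le> 1 / real DIM('a)" if "b \<in> Basis" for b
      using box_scale[OF s that h] .
    have eval: "psr_eval (h /\<^sub>R s) (\<Phi> b) = (x + h) \<bullet> b" if "b \<in> Basis" for b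
      using s that unfolding \<Phi>_def
      by (simp add: psr_eval_add[OF h'] psr_eval_scaleR[OF h'] psr_eval_1[OF h'] inner_add_left)
    have "f (a + (x + h)) = msubst c (\<lambda>b. (x + h) \<bullet> b)"
    proof (rule mexpandD(3)[OF e])
      fix b :: 'a assume b: "b \<in> Basis"
      show "\<bar>(x + h) \<bullet> b\<bar> \<le> r"
        using abs_psr_eval_le[OF h', of "\<Phi> b"] \<Phi>[OF b] eval[OF b] by simp
    qed
    thus "f (a + x + h) = msubst c (\<lambda>b. psr_eval (h /\<^sub>R s) (\<Phi> b))"
      using msubst_cong[of "\<lambda>b. psr_eval (h /\<^sub>R s) (\<Phi> b)" "\<lambda>b. (x + h) \<bullet> b" c] eval by (simp add: add.assoc)
  qed
  have "psr_coeff (msubst c \<Phi>) (munit b) / s ^ mdeg (munit b) = msubst (mderiv b c) (\<lambda>b. x \<bullet> b)" if b: "b \<in> Basis" for b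
  proof -
    have c0: "coef (\<Phi> b') 0 = x \<bullet> b'" if "b' \<in> Basis" for b'
      using munit_neq_0[of b', symmetric] by (simp add: \<Phi>_def one_psr_def coef_pse)
    have c1: "coef (\<Phi> b') (munit b) = (if b' = b then s else 0)" if "b' \<in> Basis" for b'
      using that by (auto simp: \<Phi>_def one_psr_def coef_pse)
    have "((\<lambda>\<alpha>. coef (c \<alpha> *\<^sub>R mpow \<Phi> \<alpha>) (munit b)) has_sum coef (msubst c \<Phi>) (munit b)) mindex"
      by (rule has_sum_bounded_linear[OF bounded_linear_coef]) (rule msubst_has_sum[OF conv \<Phi>])
    hence "coef (msubst c \<Phi>) (munit b) = (\<Sum>\<^sub>\<infinity>\<alpha>\<in>mindex. coef (c \<alpha> *\<^sub>R mpow \<Phi> \<alpha>) (munit b))"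
      by (simp add: infsumI)
    also have "\<dots> = (\<Sum>\<^sub>\<infinity>\<alpha>\<in>mindex. s * (c \<alpha> * (real (\<alpha> b) * mpow (\<lambda>b. x \<bullet> b) (\<alpha> - munit b))))"
    proof (rule infsum_cong)
      fix \<alpha> :: "'a \<Rightarrow> nat" assume "\<alpha> \<in> mindex"
      moreover have "mpow (\<lambda>b. coef (\<Phi> b) 0) (\<alpha> - munit b) = mpow (\<lambda>b. x \<bullet> b) (\<alpha> - munit b)"
        by (rule mpow_cong) (rule c0)
      ultimately show "coef (c \<alpha> *\<^sub>R mpow \<Phi> \<alpha>) (munit b) = s * (c \<alpha> * (real (\<alpha> b) * mpow (\<lambda>b. x \<bullet> b) (\<alpha> - munit b)))"
        using coef_mpow_munit[OF _ b c1, of \<alpha>] by simp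
    qed
    also have "\<dots> = s * msubst (mderiv b c) (\<lambda>b. x \<bullet> b)"
      unfolding infsum_cmult_right' infsum_mderiv[OF b] ..
    finally show ?thesis using s b by (simp add: psr_coeff_def)
  qed
  with e' that show ?thesis by blast
qed

lemma real_analytic_on_box:
  assumes "mexpand f a r c" "\<And>x b. x \<in> S \<Longrightarrow> b \<in> Basis \<Longrightarrow> \<bar>(x - a) \<bullet> b\<bar> < r"
  shows "real_analytic_on f S"
  unfolding real_analytic_on_iff_mexpand
proof
  fix x assume "x \<in> S"
  then obtain r' c' where "mexpand f (a + (x - a)) r' c'"
    using mexpand_shift[OF assms(1), of "x - a"] assms(2) by metis
  thus "\<exists>r c. mexpand f x r c" by auto
qed

lemma pdiff_mexpand:
  fixes a :: "'a::euclidean_space"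
  assumes e: "mexpand f a r c" and "b \<in> Basis" "\<And>b. b \<in> Basis \<Longrightarrow> \<bar>h \<bullet> b\<bar> < r"
  shows "pdiff f b (a + h) = msubst (mderiv b c) (\<lambda>b. h \<bullet> b)"
  using mexpand_shift[OF e, of h] mexpand_pdiff_center assms by metis

lemma mexpand_pdiff:
  fixes a :: "'a::euclidean_space"
  assumes e: "mexpand f a r c" and b: "b \<in> Basis"
  shows "mexpand (pdiff f b) a (r / 2) (mderiv b c)"
  unfolding mexpand_def
proof (intro conjI allI impI)
  show "r / 2 > 0" using mexpandD(1)[OF e] by simp
  show "mconv (mderiv b c) (r / 2)" by (rule mconv_mderiv[OF mexpandD(2,1)[OF e] b])
  fix h :: 'a assume h: "\<forall>b\<in>Basis. \<bar>h \<bullet> b\<bar> \<le> r / 2"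
  have "\<bar>h \<bullet> b\<bar> < r" if "b \<in> Basis" for b
    using bspec[OF h that] mexpandD(1)[OF e] by linarith
  thus "pdiff f b (a + h) = msubst (mderiv b c) (\<lambda>b. h \<bullet> b)"
    by (rule pdiff_mexpand[OF e b])
qed

lemma real_analytic_on_pdiff:
  assumes "real_analytic_on f S" "b \<in> Basis"
  shows "real_analytic_on (pdiff f b) S"
  using assms mexpand_pdiff unfolding real_analytic_on_iff_mexpand by blast

lemma pdiff_commute:
  assumes "real_analytic_on f S" "x \<in> S" "b \<in> Basis" "b' \<in> Basis"
  shows "pdiff (pdiff f b) b' x = pdiff (pdiff f b') b x"
proof -
  obtain r c where e: "mexpand f x r c" using assms unfolding real_analytic_on_iff_mexpand by blast
  have "pdiff (pdiff f b) b' x = mderiv b c (munit b')" "pdiff (pdiff f b') b x = mderiv b' c (munit b)"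
    using mexpand_pdiff_center[OF mexpand_pdiff[OF e]] assms by auto
  moreover have "munit b' b = munit b b'" by (auto simp: munit_def)
  ultimately show ?thesis by (simp add: mderiv_def add.commute)
qed

section \<open>Vanishing of Taylor coefficients\<close>

text \<open>\<open>Z\<close> is a class of functions closed under partial derivatives. It is
  instantiated with the functions that vanish on an open set and with those that vanish to every
  order along the initial manifold.\<close>

lemma mexpand_coeff_zero:
  assumes "\<And>f. Z f \<Longrightarrow> f a = 0" "\<And>f b. Z f \<Longrightarrow> b \<in> Basis \<Longrightarrow> Z (pdiff f b)"
    and "Z f" "mexpand f a r c" "\<alpha> \<in> mindex"
  shows "c \<alpha> = 0"
  using assms(3-)
proof (induction "mdeg \<alpha>" arbitrary: \<alpha> f r c)
  case 0
  hence "\<alpha> = 0" by (metis mdeg_eq_0_iff)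
  thus ?case using mexpand_center[OF 0(3)] assms(1)[OF 0(2)] by simp
next
  case (Suc n)
  have "\<alpha> \<noteq> 0" using Suc.hyps(2) by auto
  then obtain b \<beta> where \<beta>: "b \<in> Basis" "\<beta> \<in> mindex" "\<alpha> = \<beta> + munit b"
    using mindex_cases[OF Suc.prems(3)] by metis
  have "mderiv b c \<beta> = 0"
    by (rule Suc.hyps(1)[OF _ assms(2)[OF Suc.prems(1) \<beta>(1)] mexpand_pdiff[OF Suc.prems(2) \<beta>(1)] \<beta>(2)])
       (use \<beta> Suc.hyps(2) in simp)
  moreover have "real (\<beta> b) + 1 \<noteq> 0" by linarith
  ultimately show ?case using \<beta>(3) by (simp add: mderiv_def)
qed

lemma pdiff_zero: "pdiff (\<lambda>_. k) v x = 0"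
  by (simp add: pdiff_def)

lemma mexpand_unique_zero:
  fixes a :: "'a::euclidean_space"
  assumes "open S" "a \<in> S" "\<And>x. x \<in> S \<Longrightarrow> f x = 0" "mexpand f a r c" "\<alpha> \<in> mindex"
  shows "c \<alpha> = 0"
proof (rule mexpand_coeff_zero[of "\<lambda>f. \<forall>x\<in>S. f x = 0"])
  fix f :: "'a \<Rightarrow> real" and b :: 'a assume "\<forall>x\<in>S. f x = 0"
  thus "\<forall>x\<in>S. pdiff f b x = 0"
    using pdiff_cong[OF assms(1), of _ f "\<lambda>_. 0" b] pdiff_zero[of 0] by auto
qed (use assms in auto)

lemma mexpand_zero:
  assumes "mexpand f a r c" "\<And>\<alpha>. \<alpha> \<in> mindex \<Longrightarrow> c \<alpha> = 0" "x \<in> ball a r"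
  shows "f x = 0"
proof -
  have "f (a + (x - a)) = msubst c (\<lambda>b. (x - a) \<bullet> b)"
  proof (rule mexpandD(3)[OF assms(1)])
    fix b :: 'a assume "b \<in> Basis"
    thus "\<bar>(x - a) \<bullet> b\<bar> \<le> r"
      using Basis_le_norm[of b "x - a"] assms(3) by (simp add: dist_norm norm_minus_commute)
  qed
  also have "\<dots> = 0" unfolding msubst_def by (intro infsum_0) (simp add: assms(2))
  finally show ?thesis by simp
qed

text \<open>Strong induction on the degree k. Along a ray t h the homogeneous part contributes t^k
  P(h), while the lower degrees are already zero and all other terms are O(t^(k+1)). Hence P
  vanishes on a cube, and so do its coefficients.\<close>

lemma mexpand_bigo_coeff_zero:
  fixes f :: "'a::euclidean_space \<Rightarrow> real"
  assumes e: "mexpand f a r c" and "d > 0"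
    and bound: "\<And>h. norm h < d \<Longrightarrow> \<bar>f (a + h)\<bar> \<le> K * norm h ^ n"
    and "\<alpha> \<in> mindex" "mdeg \<alpha> < n"
  shows "c \<alpha> = 0"
proof -
  note r = mexpandD(1)[OF e] and conv = mexpandD(2)[OF e]
  have "\<forall>\<alpha>\<in>mindex. mdeg \<alpha> = k \<longrightarrow> c \<alpha> = 0" if "k < n" for k
    using that
  proof (induction k rule: less_induct)
    case (less k)
    hence IH: "c \<alpha> = 0" if "\<alpha> \<in> mindex" "mdeg \<alpha> < k" for \<alpha>
      using that by (metis order.strict_trans)
    define p where "p \<alpha> = (if mdeg \<alpha> = k then c \<alpha> else 0)" for \<alpha>
    define q where "q \<alpha> = (if mdeg \<alpha> = k then 0 else c \<alpha>)" for \<alpha>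
    have pq: "mconv p r" "mconv q r"
      using mnorm_mono(1)[OF conv, of p] mnorm_mono(1)[OF conv, of q] r by (auto simp: p_def q_def)
    have zero: "msubst p (\<lambda>b. h \<bullet> b) = 0" if h: "\<And>b. b \<in> Basis \<Longrightarrow> \<bar>h \<bullet> b\<bar> \<le> r" for h
    proof -
      define P where "P = msubst p (\<lambda>b. h \<bullet> b)"
      define C where "C = \<bar>K\<bar> * norm h ^ n + mnorm q r"
      have C: "C \<ge> 0" using mnorm_nonneg[of r q] r by (simp add: C_def)
      have le: "\<bar>P\<bar> \<le> t * C" if t: "0 < t" "t \<le> 1" "t * norm h < d" for t
      proof -
        have th: "\<bar>(t *\<^sub>R h) \<bullet> b\<bar> \<le> t * r" if "b \<in> Basis" for b
          using h[OF that] t by (simp add: abs_mult)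
        have tr: "t * r \<le> r" using t r by simp
        have th': "\<bar>(t *\<^sub>R h) \<bullet> b\<bar> \<le> r" if "b \<in> Basis" for b
          using th[OF that] tr by linarith
        have "((\<lambda>\<alpha>. p \<alpha> *\<^sub>R mpow (\<lambda>b. (t *\<^sub>R h) \<bullet> b) \<alpha> + q \<alpha> *\<^sub>R mpow (\<lambda>b. (t *\<^sub>R h) \<bullet> b) \<alpha>) has_sum
            (msubst p (\<lambda>b. (t *\<^sub>R h) \<bullet> b) + msubst q (\<lambda>b. (t *\<^sub>R h) \<bullet> b))) mindex"
          by (intro has_sum_add msubst_has_sum[OF pq(1)] msubst_has_sum[OF pq(2)]) (use th' in simp_all)
        moreover have "(\<lambda>\<alpha>. p \<alpha> *\<^sub>R mpow (\<lambda>b. (t *\<^sub>R h) \<bullet> b) \<alpha> + q \<alpha> *\<^sub>R mpow (\<lambda>b. (t *\<^sub>R h) \<bullet> b) \<alpha>)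
            = (\<lambda>\<alpha>. c \<alpha> *\<^sub>R mpow (\<lambda>b. (t *\<^sub>R h) \<bullet> b) \<alpha>)"
          by (auto simp: p_def q_def)
        ultimately have "((\<lambda>\<alpha>. c \<alpha> *\<^sub>R mpow (\<lambda>b. (t *\<^sub>R h) \<bullet> b) \<alpha>) has_sum
            (msubst p (\<lambda>b. (t *\<^sub>R h) \<bullet> b) + msubst q (\<lambda>b. (t *\<^sub>R h) \<bullet> b))) mindex"
          by (simp only:)
        hence "msubst c (\<lambda>b. (t *\<^sub>R h) \<bullet> b) = msubst p (\<lambda>b. (t *\<^sub>R h) \<bullet> b) + msubst q (\<lambda>b. (t *\<^sub>R h) \<bullet> b)"
          unfolding msubst_def[of c] by (rule infsumI)
        moreover have "msubst p (\<lambda>b. (t *\<^sub>R h) \<bullet> b) = t ^ k * P"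
        proof -
          have "msubst p (\<lambda>b. t *\<^sub>R (h \<bullet> b)) = (\<Sum>\<^sub>\<infinity>\<alpha>\<in>mindex. t ^ k * (p \<alpha> * mpow (\<lambda>b. h \<bullet> b) \<alpha>))"
            unfolding msubst_def mpow_scale by (intro infsum_cong) (auto simp: p_def)
          thus ?thesis by (simp add: P_def msubst_def infsum_cmult_right')
        qed
        moreover have "f (a + t *\<^sub>R h) = msubst c (\<lambda>b. (t *\<^sub>R h) \<bullet> b)"
          by (rule mexpandD(3)[OF e th'])
        ultimately have "t ^ k * P = f (a + t *\<^sub>R h) - msubst q (\<lambda>b. (t *\<^sub>R h) \<bullet> b)" by simp
        hence "t ^ k * \<bar>P\<bar> \<le> \<bar>f (a + t *\<^sub>R h)\<bar> + \<bar>msubst q (\<lambda>b. (t *\<^sub>R h) \<bullet> b)\<bar>"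
          using t by (metis abs_mult abs_of_pos abs_triangle_ineq4 zero_less_power)
        also have "\<bar>f (a + t *\<^sub>R h)\<bar> \<le> t ^ Suc k * (\<bar>K\<bar> * norm h ^ n)"
        proof -
          have "\<bar>f (a + t *\<^sub>R h)\<bar> \<le> K * norm (t *\<^sub>R h) ^ n" by (rule bound) (use t in simp)
          also have "\<dots> \<le> \<bar>K\<bar> * norm (t *\<^sub>R h) ^ n" by (intro mult_right_mono) auto
          also have "\<dots> = t ^ n * (\<bar>K\<bar> * norm h ^ n)" using t by (simp add: power_mult_distrib)
          also have "\<dots> \<le> t ^ Suc k * (\<bar>K\<bar> * norm h ^ n)"
            using t less.prems by (intro mult_right_mono power_decreasing) auto
          finally show ?thesis .
        qed
        also have "\<bar>msubst q (\<lambda>b. (t *\<^sub>R h) \<bullet> b)\<bar> \<le> t ^ Suc k * mnorm q r"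
        proof -
          have "norm (msubst q (\<lambda>b. (t *\<^sub>R h) \<bullet> b)) \<le> (t * r / r) ^ Suc k * mnorm q r"
            by (rule norm_msubst_vanish_le[OF pq(2)]) (use th tr r t IH in \<open>auto simp: q_def less_Suc_eq\<close>)
          thus ?thesis using r by simp
        qed
        finally have "t ^ k * \<bar>P\<bar> \<le> t ^ k * (t * C)"
          by (simp add: C_def algebra_simps)
        thus ?thesis using t by simp
      qed
      have "\<bar>P\<bar> \<le> 0"
      proof (rule field_le_epsilon)
        fix \<epsilon> :: real assume "\<epsilon> > 0"
        \<comment> \<open>The three bounds give \<open>t \<le> 1\<close>,
          \<open>t * C \<le> \<epsilon>\<close> and \<open>t * norm h < d\<close>.\<close>
        define t where "t = min 1 (min (\<epsilon> / (C + 1)) (d / (norm h + 1)))"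
        have t: "t > 0" "t \<le> 1" using \<open>\<epsilon> > 0\<close> C \<open>d > 0\<close> by (auto simp: t_def add_nonneg_pos)
        have "t * norm h \<le> d / (norm h + 1) * norm h" by (intro mult_right_mono) (auto simp: t_def)
        also have "\<dots> < d" using \<open>d > 0\<close> by (simp add: divide_less_eq add_nonneg_pos)
        finally have "\<bar>P\<bar> \<le> t * C" using t by (intro le)
        also have "\<dots> \<le> \<epsilon> / (C + 1) * C" using C by (intro mult_right_mono) (auto simp: t_def)
        also have "\<dots> \<le> \<epsilon>" using \<open>\<epsilon> > 0\<close> C by (simp add: divide_le_eq add_nonneg_pos)
        finally show "\<bar>P\<bar> \<le> 0 + \<epsilon>" by simp
      qed
      thus ?thesis by (simp add: P_def)
    qed
    have ep: "mexpand (\<lambda>x. msubst p (\<lambda>b. x \<bullet> b)) 0 r p"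
      using r pq unfolding mexpand_def by auto
    have "p \<alpha> = 0" if "\<alpha> \<in> mindex" for \<alpha>
    proof (rule mexpand_unique_zero[OF _ _ _ ep that, of "ball 0 r"])
      fix x :: 'a assume "x \<in> ball 0 r"
      thus "msubst p (\<lambda>b. x \<bullet> b) = 0"
        using Basis_le_norm[of _ x] by (intro zero) fastforce
    qed (use r in auto)
    thus ?case by (metis p_def)
  qed
  thus ?thesis using assms by blast
qed

section \<open>Rules for partial derivatives\<close>

lemma pdiff_compose:
  fixes f :: "'b::euclidean_space \<Rightarrow> real" and g :: "'a::euclidean_space \<Rightarrow> 'b"
  assumes f: "real_analytic_on f T" "g x \<in> T"
    and g: "\<And>b. b \<in> Basis \<Longrightarrow> real_analytic_on (\<lambda>x. g x \<bullet> b) S" "x \<in> S"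
  shows "pdiff (\<lambda>x. f (g x)) v x = (\<Sum>b\<in>Basis. pdiff f b (g x) * pdiff (\<lambda>x. g x \<bullet> b) v x)"
proof -
  have "\<exists>G. ((\<lambda>x. g x \<bullet> b) has_derivative G) (at x)" if "b \<in> Basis" for b
    using real_analytic_on_has_derivative[OF g(1)[OF that] g(2)] by blast
  then obtain G where G: "\<And>b. b \<in> Basis \<Longrightarrow> ((\<lambda>x. g x \<bullet> b) has_derivative G b) (at x)" by metis
  define G' where "G' h = (\<Sum>b\<in>Basis. G b h *\<^sub>R b)" for h
  have G': "G' h \<bullet> b = G b h" if "b \<in> Basis" for h b
    using that by (simp add: G'_def inner_sum_left inner_Basis if_distrib sum.delta cong: if_cong)
  have "(g has_derivative G') (at x)"
    by (subst has_derivative_componentwise_within) (simp add: G' G)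
  from has_derivative_compose[OF this real_analytic_on_has_derivative[OF f]]
  have "((\<lambda>x. f (g x)) has_derivative (\<lambda>h. \<Sum>b\<in>Basis. pdiff f b (g x) * (G' h \<bullet> b))) (at x)" .
  from pdiff_eq_derivative[OF this, of v]
  show ?thesis using pdiff_eq_derivative[OF G] by (simp add: G')
qed

lemma pdiff_add:
  assumes "real_analytic_on f S" "real_analytic_on g S" "x \<in> S"
  shows "pdiff (\<lambda>x. f x + g x) v x = pdiff f v x + pdiff g v x"
proof -
  obtain D where D: "(f has_derivative D) (at x)" using real_analytic_on_has_derivative[OF assms(1,3)] ..
  obtain E where E: "(g has_derivative E) (at x)" using real_analytic_on_has_derivative[OF assms(2,3)] ..
  show ?thesis
    using pdiff_eq_derivative[OF has_derivative_add[OF D E]] pdiff_eq_derivative[OF D] pdiff_eq_derivative[OF E]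
    by (simp add: algebra_simps)
qed

lemma pdiff_diff:
  assumes "real_analytic_on f S" "real_analytic_on g S" "x \<in> S"
  shows "pdiff (\<lambda>x. f x - g x) v x = pdiff f v x - pdiff g v x"
proof -
  obtain D where D: "(f has_derivative D) (at x)" using real_analytic_on_has_derivative[OF assms(1,3)] ..
  obtain E where E: "(g has_derivative E) (at x)" using real_analytic_on_has_derivative[OF assms(2,3)] ..
  show ?thesis
    using pdiff_eq_derivative[OF has_derivative_diff[OF D E]] pdiff_eq_derivative[OF D] pdiff_eq_derivative[OF E]
    by (simp add: algebra_simps)
qed

lemma pdiff_mult:
  assumes "real_analytic_on f S" "real_analytic_on g S" "x \<in> S"
  shows "pdiff (\<lambda>x. f x * g x) v x = pdiff f v x * g x + f x * pdiff g v x"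
proof -
  obtain D where D: "(f has_derivative D) (at x)" using real_analytic_on_has_derivative[OF assms(1,3)] ..
  obtain E where E: "(g has_derivative E) (at x)" using real_analytic_on_has_derivative[OF assms(2,3)] ..
  show ?thesis
    using pdiff_eq_derivative[OF has_derivative_mult[OF D E]] pdiff_eq_derivative[OF D] pdiff_eq_derivative[OF E]
    by (simp add: algebra_simps)
qed

lemma pdiff_sum:
  assumes "\<And>i. i \<in> I \<Longrightarrow> real_analytic_on (f i) S" "x \<in> S"
  shows "pdiff (\<lambda>x. \<Sum>i\<in>I. f i x) v x = (\<Sum>i\<in>I. pdiff (f i) v x)"
  using assms(1)
proof (induction I rule: infinite_finite_induct)
  case (insert i I)
  thus ?case using pdiff_add[OF _ real_analytic_on_sum[of I f S] assms(2), of "f i"] by simp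
qed (simp_all add: pdiff_zero)

lemma pdiff_cmult:
  "real_analytic_on f S \<Longrightarrow> x \<in> S \<Longrightarrow> pdiff (\<lambda>x. k * f x) v x = k * pdiff f v x"
  using pdiff_mult[OF real_analytic_on_const] by (simp add: pdiff_zero)

lemma pdiff_inner: "pdiff (\<lambda>x. x \<bullet> w) v x = v \<bullet> w"
  by (rule pdiff_eq_derivative) (auto intro!: derivative_eq_intros)

section \<open>Coordinates on jet space\<close>

lemma sum_Basis_vec:
  "(\<Sum>b\<in>Basis. f b) = (\<Sum>i\<in>UNIV. \<Sum>u\<in>Basis. f (axis i u :: 'a::euclidean_space ^ 'n::finite))"
proof -
  have Basis: "(Basis :: ('a ^ 'n) set) = (\<lambda>(i, u). axis i u) ` (UNIV \<times> Basis)"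
    by (auto simp: Basis_vec_def)
  have inj: "inj_on (\<lambda>(i, u). axis i u :: 'a ^ 'n) (UNIV \<times> Basis)"
    by (auto simp: inj_on_def axis_eq_axis nonzero_Basis)
  show ?thesis
    unfolding Basis sum.reindex[OF inj] by (simp add: sum.cartesian_product case_prod_unfold o_def)
qed

lemma exk_Basis [simp]: "exk G \<in> Basis" and exl_Basis [simp]: "exl j \<in> Basis"
  by (auto simp: exk_def exl_def Basis_prod_def Basis_vec_def)

lemma Basis_base_cases:
  fixes b :: "(real^'k::finite) \<times> (real^'l::finite)"
  assumes "b \<in> Basis"
  obtains G where "b = exk G" | j where "b = exl j"
  using assms by (auto simp: exk_def exl_def Basis_prod_def Basis_vec_def)

lemma sum_Basis_prod:
  fixes f :: "'a::euclidean_space \<times> 'b::euclidean_space \<Rightarrow> real"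
  shows "sum f Basis = (\<Sum>b\<in>Basis. f (b, 0)) + (\<Sum>b\<in>Basis. f (0, b))"
proof -
  have inj: "inj_on (\<lambda>b::'a. (b, 0::'b)) Basis" "inj_on (\<lambda>b::'b. (0::'a, b)) Basis"
    by (auto simp: inj_on_def)
  have "sum f Basis = sum f ((\<lambda>b. (b, 0)) ` Basis) + sum f ((\<lambda>b. (0, b)) ` Basis)"
    unfolding Basis_prod_def by (rule sum.union_disjoint) (auto simp: nonzero_Basis)
  thus ?thesis by (simp add: sum.reindex[OF inj(1)] sum.reindex[OF inj(2)])
qed

lemma sum_Basis_base:
  fixes f :: "(real^'k::finite) \<times> (real^'l::finite) \<Rightarrow> real"
  shows "sum f Basis = (\<Sum>G\<in>UNIV. f (exk G)) + (\<Sum>j\<in>UNIV. f (exl j))"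
  by (simp add: sum_Basis_prod sum_Basis_vec exk_def exl_def)

lemma sum_Basis_jet:
  fixes f :: "('k::finite, 'l::finite, 'm::finite) jetpt \<Rightarrow> real"
  shows "sum f Basis = (\<Sum>G\<in>UNIV. f (dxk G)) + (\<Sum>j\<in>UNIV. f (dxl j)) + (\<Sum>B\<in>UNIV. f (dp B))
     + (\<Sum>B\<in>UNIV. \<Sum>G\<in>UNIV. f (dp' B G))"
  by (simp add: sum_Basis_prod sum_Basis_vec dxk_def dxl_def dp_def dp'_def exk_def exl_def zero_prod_def add.assoc)

lemma Basis_jet_cases:
  fixes b :: "('k::finite, 'l::finite, 'm::finite) jetpt"
  assumes "b \<in> Basis"
  obtains G where "b = dxk G" | j where "b = dxl j" | B where "b = dp B" | B G where "b = dp' B G"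
proof -
  from assms consider i where "b = (i, 0)" "i \<in> Basis" | i where "b = (0, i)" "i \<in> Basis"
    unfolding Basis_prod_def[where ?'a = "(real^'k) \<times> (real^'l)"] by blast
  thus ?thesis
  proof cases
    case 1
    from 1(2) show ?thesis using 1(1) that
      by (cases rule: Basis_base_cases) (auto simp: dxk_def dxl_def zero_prod_def)
  next
    case 2
    from 2(2) consider B where "i = (axis B 1, 0)" | B G where "i = (0, axis B (axis G 1))"
      unfolding Basis_prod_def Basis_vec_def by auto
    thus ?thesis using that 2(1) by cases (auto simp: dp_def dp'_def zero_prod_def)
  qed
qed

lemma jet_Basis [simp]: "dxk G \<in> Basis" "dxl j \<in> Basis" "dp B \<in> Basis" "dp' B G \<in> Basis"
proof -
  have pair: "b \<in> Basis \<Longrightarrow> (b, 0) \<in> Basis" "c \<in> Basis \<Longrightarrow> (0, c) \<in> Basis"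
    for b :: "'x::euclidean_space" and c :: "'y::euclidean_space"
    by (auto simp: Basis_prod_def)
  have ax: "axis i v \<in> Basis" if "v \<in> Basis" for i and v :: "'x::euclidean_space"
    using that by (auto simp: Basis_vec_def)
  show "dxk G \<in> Basis" "dxl j \<in> Basis" "dp B \<in> Basis" "dp' B G \<in> Basis"
    unfolding dxk_def dxl_def dp_def dp'_def zero_prod_def[symmetric]
    by (intro pair ax exk_Basis exl_Basis, (simp; fail)?)+
qed

lemma inner_exk [simp]: "x \<bullet> exk G = fst x $ G" and inner_exl [simp]: "x \<bullet> exl j = snd x $ j"
  by (simp_all add: exk_def exl_def inner_prod_def inner_axis)

lemma inner_jet [simp]:
  "w \<bullet> dxk G = fst (fst w) $ G" "w \<bullet> dxl j = snd (fst w) $ j"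
  "w \<bullet> dp B = fst (snd w) $ B" "w \<bullet> dp' B G = snd (snd w) $ B $ G"
  by (simp_all add: dxk_def dxl_def dp_def dp'_def exk_def exl_def inner_prod_def inner_axis)

lemma jet_of_simps [simp]:
  "fst (jet_of u x) = x" "fst (snd (jet_of u x)) = u x"
  "snd (snd (jet_of u x)) $ A $ G = pdiff (\<lambda>y. u y $ A) (exk G) x"
  by (simp_all add: jet_of_def)

lemma real_analytic_on_coord:
  "real_analytic_on (\<lambda>x. fst x $ G) S" "real_analytic_on (\<lambda>x. snd x $ j) S"
  for S :: "((real^'k::finite) \<times> (real^'l::finite)) set"
  using real_analytic_on_inner[of "exk G" S] real_analytic_on_inner[of "exl j" S] by simp_all

lemma pdiff_coord:
  "pdiff (\<lambda>x. fst x $ G) v x = fst v $ G" "pdiff (\<lambda>x. snd x $ j) v x = snd v $ j"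
  for x v :: "(real^'k::finite) \<times> (real^'l::finite)"
  using pdiff_inner[of "exk G" v x] pdiff_inner[of "exl j" v x] by simp_all

lemma real_analytic_on_jet_of:
  fixes u :: "(real^'k::finite) \<times> (real^'l::finite) \<Rightarrow> real^'m::finite"
  assumes "\<And>A. real_analytic_on (\<lambda>x. u x $ A) V" "b \<in> Basis"
  shows "real_analytic_on (\<lambda>x. jet_of u x \<bullet> b) V"
  using assms(2) by (cases rule: Basis_jet_cases)
    (auto simp: real_analytic_on_coord assms(1) intro!: real_analytic_on_pdiff)

lemma pdiff_jet_compose:
  fixes u :: "(real^'k::finite) \<times> (real^'l::finite) \<Rightarrow> real^'m::finite"
  assumes f: "real_analytic_on f U" and u: "\<And>A. real_analytic_on (\<lambda>x. u x $ A) V"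
    and x: "x \<in> V" "jet_of u x \<in> U"
  shows "pdiff (\<lambda>x. f (jet_of u x)) v x =
    (\<Sum>G\<in>UNIV. pdiff f (dxk G) (jet_of u x) * fst v $ G) + (\<Sum>j\<in>UNIV. pdiff f (dxl j) (jet_of u x) * snd v $ j)
    + (\<Sum>B\<in>UNIV. pdiff f (dp B) (jet_of u x) * pdiff (\<lambda>y. u y $ B) v x)
    + (\<Sum>B\<in>UNIV. \<Sum>G\<in>UNIV. pdiff f (dp' B G) (jet_of u x) * pdiff (pdiff (\<lambda>y. u y $ B) (exk G)) v x)"
  by (subst pdiff_compose[OF f x(2) real_analytic_on_jet_of[OF u] x(1)])
     (simp_all add: sum_Basis_jet pdiff_coord)

section \<open>Defects and total derivatives\<close>

text \<open>The residual is carried along explicitly so that one formula for total derivatives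
  serves both approximate solutions, where it is small to second order at the base point, and radial
  solutions, where only its contraction with the transversal coordinates is known.\<close>

definition defect ::
  "('m::finite \<Rightarrow> 'l::finite \<Rightarrow> ('k::finite,'l,'m) jetpt \<Rightarrow> real) \<Rightarrow> ((real^'k) \<times> (real^'l) \<Rightarrow> real^'m)
    \<Rightarrow> 'm \<Rightarrow> 'l \<Rightarrow> (real^'k) \<times> (real^'l) \<Rightarrow> real" where
  "defect F u A j x = pdiff (\<lambda>y. u y $ A) (exl j) x - F A j (jet_of u x)"

lemma pdiff_exl_eq: "pdiff (\<lambda>y. u y $ A) (exl j) = (\<lambda>x. F A j (jet_of u x) + defect F u A j x)"
  by (simp add: defect_def)

lemma real_analytic_on_F_jet:
  fixes u :: "(real^'k::finite) \<times> (real^'l::finite) \<Rightarrow> real^'m::finite"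
  assumes u: "\<And>A. real_analytic_on (\<lambda>x. u x $ A) V" and "jet_of u ` V \<subseteq> U" and f: "real_analytic_on f U"
  shows "real_analytic_on (\<lambda>x. f (jet_of u x)) V"
  by (rule real_analytic_on_compose[OF f real_analytic_on_jet_of[OF u]]) (use assms in auto)

text \<open>Renaming G and L costs nothing against the symmetric \<open>H\<close>, so the sum equals
  the average of itself and its transpose. This is where the two summands of \<open>Psi\<close> come
  from.\<close>

lemma symmetric_contraction:
  fixes q :: "'m::finite \<Rightarrow> 'k::finite \<Rightarrow> real"
  assumes "\<And>C G L. H C L G = H C G L"
  shows "(\<Sum>B\<in>UNIV. \<Sum>G\<in>UNIV. q B G * (\<Sum>C\<in>UNIV. \<Sum>L\<in>UNIV. z B C L * H C L G))
    = (1/2) * (\<Sum>C\<in>UNIV. \<Sum>G\<in>UNIV. \<Sum>L\<in>UNIV. (\<Sum>B\<in>UNIV. q B G * z B C L + q B L * z B C G) * (H C L G :: real))"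
proof -
  define T where "T = (\<Sum>C\<in>UNIV. \<Sum>G\<in>UNIV. \<Sum>L\<in>UNIV. \<Sum>B\<in>UNIV. q B G * z B C L * H C L G)"
  have "(\<Sum>C\<in>UNIV. \<Sum>G\<in>UNIV. \<Sum>L\<in>UNIV. \<Sum>B\<in>UNIV. q B L * z B C G * H C L G)
      = (\<Sum>C\<in>UNIV. \<Sum>L\<in>UNIV. \<Sum>G\<in>UNIV. \<Sum>B\<in>UNIV. q B L * z B C G * H C L G)"
    by (intro sum.cong refl sum.swap)
  also have "\<dots> = T" unfolding T_def by (intro sum.cong refl) (simp add: assms)
  finally have "(\<Sum>C\<in>UNIV. \<Sum>G\<in>UNIV. \<Sum>L\<in>UNIV. (\<Sum>B\<in>UNIV. q B G * z B C L + q B L * z B C G) * H C L G) = 2 * T"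
    by (simp add: T_def sum_distrib_right sum.distrib distrib_right)
  moreover have "T = (\<Sum>B\<in>UNIV. \<Sum>G\<in>UNIV. q B G * (\<Sum>C\<in>UNIV. \<Sum>L\<in>UNIV. z B C L * H C L G))"
  proof -
    have "T = (\<Sum>C\<in>UNIV. \<Sum>G\<in>UNIV. \<Sum>B\<in>UNIV. \<Sum>L\<in>UNIV. q B G * z B C L * H C L G)"
      unfolding T_def by (intro sum.cong refl sum.swap)
    also have "\<dots> = (\<Sum>C\<in>UNIV. \<Sum>B\<in>UNIV. \<Sum>G\<in>UNIV. \<Sum>L\<in>UNIV. q B G * z B C L * H C L G)"
      by (intro sum.cong refl sum.swap)
    also have "\<dots> = (\<Sum>B\<in>UNIV. \<Sum>C\<in>UNIV. \<Sum>G\<in>UNIV. \<Sum>L\<in>UNIV. q B G * z B C L * H C L G)"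
      by (rule sum.swap)
    also have "\<dots> = (\<Sum>B\<in>UNIV. \<Sum>G\<in>UNIV. \<Sum>C\<in>UNIV. \<Sum>L\<in>UNIV. q B G * z B C L * H C L G)"
      by (intro sum.cong refl sum.swap)
    finally show ?thesis by (simp add: sum_distrib_left mult.assoc)
  qed
  ultimately show ?thesis by simp
qed

context
  fixes F :: "'m::finite \<Rightarrow> 'l::finite \<Rightarrow> ('k::finite,'l,'m) jetpt \<Rightarrow> real" and U
    and u :: "(real^'k) \<times> (real^'l) \<Rightarrow> real^'m" and V
  assumes F: "\<And>A j. real_analytic_on (F A j) U"
    and u: "\<And>A. real_analytic_on (\<lambda>x. u x $ A) V"
    and jet: "jet_of u ` V \<subseteq> U"
begin

lemma real_analytic_on_defect: "real_analytic_on (defect F u A j) V"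
  unfolding defect_def by (intro real_analytic_on_diff real_analytic_on_pdiff u real_analytic_on_F_jet[OF u jet] F) simp

text \<open>Only the part of the second total derivative that is symmetric in the indices of the
  second derivatives of \<^term>\<open>u\<close> survives, which is why \<^const>\<open>Psi\<close> is symmetrised.\<close>
lemma total_derivative:
  assumes x: "x \<in> V"
  shows "pdiff (\<lambda>x. F A i (jet_of u x)) (exl j) x = Phi F A i j (jet_of u x)
    + (1/2) * (\<Sum>C\<in>UNIV. \<Sum>G\<in>UNIV. \<Sum>L\<in>UNIV. Psi F A G L i j C (jet_of u x) * pdiff (pdiff (\<lambda>y. u y $ C) (exk L)) (exk G) x)
    + (\<Sum>B\<in>UNIV. pdiff (F A i) (dp B) (jet_of u x) * defect F u B j x)
    + (\<Sum>B\<in>UNIV. \<Sum>G\<in>UNIV. pdiff (F A i) (dp' B G) (jet_of u x) * pdiff (defect F u B j) (exk G) x)"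
proof -
  let ?J = "jet_of u x"
  have jet_x: "?J \<in> U" using jet x by blast
  define f where "f B = pdiff (F A i) (dp B) ?J" for B
  define q where "q B G = pdiff (F A i) (dp' B G) ?J" for B G
  define z where "z B C L = pdiff (F B j) (dp' C L) ?J" for B C L
  define H where "H C L G = pdiff (pdiff (\<lambda>y. u y $ C) (exk L)) (exk G) x" for C L G
  define y where "y B G = pdiff (F B j) (dxk G) ?J + (\<Sum>C\<in>UNIV. pdiff (F B j) (dp C) ?J * pdiff (\<lambda>y. u y $ C) (exk G) x)" for B G
  define d where "d B G = pdiff (defect F u B j) (exk G) x" for B G
  have H: "H C L G = H C G L" for C L G
    unfolding H_def by (rule pdiff_commute[OF u x]) auto
  \<comment> \<open>Exchanging the derivatives brings the transversal one inside, where it equals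
    \<open>F\<close> plus the defect. A second chain rule then leaves tangential second derivatives
    only.\<close>
  have mixed: "pdiff (pdiff (\<lambda>y. u y $ B) (exk G)) (exl j) x = y B G + (\<Sum>C\<in>UNIV. \<Sum>L\<in>UNIV. z B C L * H C L G) + d B G" for B G
  proof -
    have "pdiff (pdiff (\<lambda>y. u y $ B) (exk G)) (exl j) x = pdiff (pdiff (\<lambda>y. u y $ B) (exl j)) (exk G) x"
      by (rule pdiff_commute[OF u x]) auto
    also have "\<dots> = pdiff (\<lambda>x. F B j (jet_of u x)) (exk G) x + d B G"
      unfolding pdiff_exl_eq[of u B j F] d_def by (rule pdiff_add[OF real_analytic_on_F_jet[OF u jet F] real_analytic_on_defect x])
    also have "pdiff (\<lambda>x. F B j (jet_of u x)) (exk G) x = y B G + (\<Sum>C\<in>UNIV. \<Sum>L\<in>UNIV. z B C L * H C L G)"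
      unfolding pdiff_jet_compose[OF F u x jet_x]
      by (simp add: exk_def axis_def if_distrib sum.delta y_def z_def H_def cong: if_cong)
    finally show ?thesis by simp
  qed
  have "pdiff (\<lambda>x. F A i (jet_of u x)) (exl j) x = pdiff (F A i) (dxl j) ?J
      + (\<Sum>B\<in>UNIV. f B * (F B j ?J + defect F u B j x))
      + (\<Sum>B\<in>UNIV. \<Sum>G\<in>UNIV. q B G * (y B G + (\<Sum>C\<in>UNIV. \<Sum>L\<in>UNIV. z B C L * H C L G) + d B G))"
    unfolding pdiff_jet_compose[OF F u x jet_x] mixed
    by (simp add: exl_def axis_def if_distrib sum.delta f_def q_def defect_def cong: if_cong)
  also have "\<dots> = (pdiff (F A i) (dxl j) ?J + (\<Sum>B\<in>UNIV. f B * F B j ?J) + (\<Sum>B\<in>UNIV. \<Sum>G\<in>UNIV. q B G * y B G))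
      + (\<Sum>B\<in>UNIV. \<Sum>G\<in>UNIV. q B G * (\<Sum>C\<in>UNIV. \<Sum>L\<in>UNIV. z B C L * H C L G))
      + (\<Sum>B\<in>UNIV. f B * defect F u B j x) + (\<Sum>B\<in>UNIV. \<Sum>G\<in>UNIV. q B G * d B G)"
    by (simp add: distrib_left sum.distrib)
  also have "(\<Sum>B\<in>UNIV. \<Sum>G\<in>UNIV. q B G * y B G) = (\<Sum>G\<in>UNIV. \<Sum>B\<in>UNIV. q B G * y B G)"
    by (rule sum.swap)
  finally show ?thesis
    unfolding symmetric_contraction[OF H, of q z] Phi_def Psi_def
    by (simp add: f_def q_def z_def H_def y_def d_def)
qed

end

section \<open>Necessity of the compatibility conditions\<close>

lemma real_analytic_on_slice:
  fixes f :: "(real^'k::finite) \<times> (real^'l::finite) \<Rightarrow> real"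
  assumes "real_analytic_on f V" "\<And>y. y \<in> S \<Longrightarrow> (y, z) \<in> V"
  shows "real_analytic_on (\<lambda>y. f (y, z)) S"
proof (rule real_analytic_on_compose[OF assms(1)])
  fix b :: "(real^'k) \<times> (real^'l)" assume "b \<in> Basis"
  thus "real_analytic_on (\<lambda>y. (y, z) \<bullet> b) S"
    using real_analytic_on_add[OF real_analytic_on_inner[of "fst b" S] real_analytic_on_const[of "z \<bullet> snd b"]]
    by (simp add: inner_prod_def)
qed (use assms in auto)

lemma pdiff_slice: "pdiff (\<lambda>y. f (y, z)) (axis G 1) = (\<lambda>y. pdiff f (exk G) (y, z))"
  by (rule ext) (simp add: pdiff_def exk_def)

lemma second_order_contact:
  assumes "real_analytic_on f S" "a \<in> S" "d > 0" "\<And>x. norm (x - a) < d \<Longrightarrow> \<bar>f x\<bar> \<le> K * norm (x - a) ^ 3"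
    and "b \<in> Basis" "b' \<in> Basis"
  shows "f a = 0" "pdiff f b a = 0" "pdiff (pdiff f b) b' a = 0"
proof -
  obtain r c where e: "mexpand f a r c" using assms(1,2) unfolding real_analytic_on_iff_mexpand by blast
  have c: "c \<alpha> = 0" if "\<alpha> \<in> mindex" "mdeg \<alpha> < 3" for \<alpha>
    by (rule mexpand_bigo_coeff_zero[OF e assms(3) _ that, of K]) (use assms(4)[of "a + _"] in simp)
  show "f a = 0" using mexpand_center[OF e] c[of 0] by simp
  show "pdiff f b a = 0" using mexpand_pdiff_center[OF e assms(5)] c[of "munit b"] assms by simp
  show "pdiff (pdiff f b) b' a = 0"
    using mexpand_pdiff_center[OF mexpand_pdiff[OF e assms(5)] assms(6)] c[of "munit b' + munit b"] assms
    by (simp add: mderiv_def)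
qed

lemma first_order_contact:
  assumes "real_analytic_on f S" "a \<in> S" "d > 0" "\<And>x. norm (x - a) < d \<Longrightarrow> \<bar>f x\<bar> \<le> K * norm (x - a) ^ 2"
    and "b \<in> Basis"
  shows "f a = 0" "pdiff f b a = 0"
proof -
  obtain r c where e: "mexpand f a r c" using assms(1,2) unfolding real_analytic_on_iff_mexpand by blast
  have c: "c \<alpha> = 0" if "\<alpha> \<in> mindex" "mdeg \<alpha> < 2" for \<alpha>
    by (rule mexpand_bigo_coeff_zero[OF e assms(3) _ that, of K]) (use assms(4)[of "a + _"] in simp)
  show "f a = 0" using mexpand_center[OF e] c[of 0] by simp
  show "pdiff f b a = 0" using mexpand_pdiff_center[OF e assms(5)] c[of "munit b"] assms by simp
qed

section \<open>Quadratic test data\<close>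

text \<open>The 1-jet is prescribed, while the Hessian is a free multiple \<open>s\<close> of one
  elementary symmetric matrix in one component; it probes a single coefficient of
  \<open>Psi\<close>.\<close>

definition quadratic_datum ::
  "real^'k::finite \<Rightarrow> real^'m::finite \<Rightarrow> real^'k^'m \<Rightarrow> 'm \<Rightarrow> 'k \<Rightarrow> 'k \<Rightarrow> real \<Rightarrow> real^'k \<Rightarrow> real^'m" where
  "quadratic_datum y0 p0 p1 C G L s y =
     (\<chi> A. p0 $ A + (y - y0) \<bullet> (p1 $ A) + (if A = C then s else 0) * (((y - y0) \<bullet> axis G 1) * ((y - y0) \<bullet> axis L 1)))"

lemma affine_inner:
  fixes y0 v :: "'a::euclidean_space"
  shows "real_analytic_on (\<lambda>y. (y - y0) \<bullet> v) S" "pdiff (\<lambda>y. (y - y0) \<bullet> v) w y = w \<bullet> v"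
proof -
  show "real_analytic_on (\<lambda>y. (y - y0) \<bullet> v) S"
    unfolding inner_diff_left by (intro real_analytic_on_diff real_analytic_on_inner real_analytic_on_const)
  show "pdiff (\<lambda>y. (y - y0) \<bullet> v) w y = w \<bullet> v"
    by (rule pdiff_eq_derivative) (auto intro!: derivative_eq_intros)
qed

lemma quadratic_datum_analytic: "real_analytic_on (\<lambda>y. quadratic_datum y0 p0 p1 C G L s y $ A) S"
  unfolding quadratic_datum_def
  by (simp only: vec_lambda_beta, intro real_analytic_on_add real_analytic_on_mult real_analytic_on_const affine_inner)

lemma quadratic_datum_pdiff:
  "pdiff (\<lambda>y. quadratic_datum y0 p0 p1 C G L s y $ A) v =
    (\<lambda>y. v \<bullet> (p1 $ A) + (if A = C then s else 0) * ((v $ G) * ((y - y0) \<bullet> axis L 1) + ((y - y0) \<bullet> axis G 1) * (v $ L)))"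
proof
  fix y
  note an = real_analytic_on_add[of _ UNIV] real_analytic_on_mult[of _ UNIV] real_analytic_on_const[of _ UNIV] affine_inner(1)[of _ _ UNIV]
  show "pdiff (\<lambda>y. quadratic_datum y0 p0 p1 C G L s y $ A) v y =
    v \<bullet> (p1 $ A) + (if A = C then s else 0) * ((v $ G) * ((y - y0) \<bullet> axis L 1) + ((y - y0) \<bullet> axis G 1) * (v $ L))"
    unfolding quadratic_datum_def vec_lambda_beta
    apply (subst pdiff_add[where S = UNIV], (intro an)+, simp)
    apply (subst pdiff_add[where S = UNIV], (intro an)+, simp)
    apply (subst pdiff_mult[where S = UNIV], (intro an)+, simp)
    apply (subst pdiff_mult[where S = UNIV], (intro an)+, simp)
    apply (simp only: pdiff_zero affine_inner(2))
    apply (simp add: inner_axis)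
    done
qed

lemma quadratic_datum_pdiff2:
  "pdiff (pdiff (\<lambda>y. quadratic_datum y0 p0 p1 C G L s y $ A) v) w y =
    (if A = C then s else 0) * (v $ G * w $ L + w $ G * v $ L)"
proof -
  have "((\<lambda>y. v \<bullet> (p1 $ A) + (if A = C then s else 0) * ((v $ G) * ((y - y0) \<bullet> axis L 1) + ((y - y0) \<bullet> axis G 1) * (v $ L)))
     has_derivative (\<lambda>h. (if A = C then s else 0) * ((v $ G) * (h \<bullet> axis L 1) + (h \<bullet> axis G 1) * (v $ L)))) (at y)"
    by (auto intro!: derivative_eq_intros)
  from pdiff_eq_derivative[OF this, of w] show ?thesis
    unfolding quadratic_datum_pdiff by (simp add: inner_axis)
qed

lemma Psi_commute: "Psi F A G L a b C w = Psi F A L G a b C w"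
  by (simp add: Psi_def add.commute)

text \<open>The Hessian of the quadratic datum hits the positions (G, L) and (L, G). Their
  contributions agree by symmetry and cancel the factor 1/2, also when G = L.\<close>

lemma contraction_quadratic:
  fixes P :: "'k::finite \<Rightarrow> 'k \<Rightarrow> 'm::finite \<Rightarrow> real"
  assumes "\<And>G L C. P G L C = P L G C"
  shows "(1/2) * (\<Sum>C'\<in>UNIV. \<Sum>G'\<in>UNIV. \<Sum>L'\<in>UNIV. P G' L' C' *
     ((if C' = C then s else 0) * (axis L' 1 $ G * axis G' 1 $ L + axis G' 1 $ G * axis L' 1 $ L))) = s * P G L C"
proof -
  have "P G' L' C' * ((if C' = C then s else 0) * (axis L' 1 $ G * axis G' 1 $ L + axis G' 1 $ G * axis L' 1 $ L))
     = (if C' = C then s * ((if L' = G then (if G' = L then P G' L' C' else 0) else 0) + (if L' = L then (if G' = G then P G' L' C' else 0) else 0)) else 0)"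
    for C' G' L' by (auto simp: axis_def)
  hence "(\<Sum>C'\<in>UNIV. \<Sum>G'\<in>UNIV. \<Sum>L'\<in>UNIV. P G' L' C' * ((if C' = C then s else 0) * (axis L' 1 $ G * axis G' 1 $ L + axis G' 1 $ G * axis L' 1 $ L)))
     = (\<Sum>C'\<in>UNIV. if C' = C then (\<Sum>G'\<in>UNIV. \<Sum>L'\<in>UNIV. s * ((if L' = G then (if G' = L then P G' L' C' else 0) else 0) + (if L' = L then (if G' = G then P G' L' C' else 0) else 0))) else 0)"
    by (intro sum.cong refl) auto
  also have "\<dots> = (\<Sum>G'\<in>UNIV. \<Sum>L'\<in>UNIV. s * ((if L' = G then (if G' = L then P G' L' C else 0) else 0) + (if L' = L then (if G' = G then P G' L' C else 0) else 0)))"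
    by simp
  also have "\<dots> = s * (P L G C + P G L C)"
    by (simp add: sum.distrib distrib_left sum_distrib_left[symmetric])
  finally show ?thesis using assms[of L G C] by (simp only:) (simp add: field_simps)
qed

text \<open>Third-order contact with the datum fixes the value and the first and second tangential
  derivatives of \<open>u\<close> at the base point; the second-order bound on the defects makes
  them and their first derivatives vanish there. The mixed transversal derivatives of
  \<open>u\<close> are then total derivatives of \<open>F\<close> at a known 2-jet, and their
  symmetry is the claim.\<close>

lemma approx_solvable_imp_symmetric:
  fixes F :: "'m::finite \<Rightarrow> 'l::finite \<Rightarrow> ('k::finite,'l,'m) jetpt \<Rightarrow> real"
  assumes F: "\<And>A j. real_analytic_on (F A j) U" and solvable: "approx_solvable_at F U w"
  shows "Phi F A i j w + s * Psi F A G L i j C w = Phi F A j i w + s * Psi F A G L j i C w"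
proof -
  obtain x0 p0 p1 where w: "w = (x0, p0, p1)" by (metis surj_pair)
  obtain y0 z0 where x0: "x0 = (y0, z0)" by (metis surj_pair)
  define a where "a = quadratic_datum y0 p0 p1 C G L s"
  have a_an: "real_analytic_on (\<lambda>y. a y $ B) S" for B S
    unfolding a_def by (rule quadratic_datum_analytic)
  have a0: "a y0 = p0" by (simp add: a_def quadratic_datum_def vec_eq_iff)
  have a1: "pdiff (\<lambda>y. a y $ B) (axis H 1) y0 = p1 $ B $ H" for B H
    unfolding a_def quadratic_datum_pdiff by (simp add: inner_axis')
  have "admissible_datum a x0 p0 p1"
    unfolding admissible_datum_def using a_an a0 a1 by (intro exI[of _ UNIV]) (simp add: x0)
  then obtain u where "approx_solution F U a x0 u"
    using solvable unfolding approx_solvable_at_def w by auto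
  then obtain V K e where V: "open V" "x0 \<in> V" and u0: "\<And>A. real_analytic_on (\<lambda>x. u x $ A) V" and e: "e > 0"
    and eq: "\<And>x. x \<in> V \<Longrightarrow> dist x x0 < e \<Longrightarrow> jet_of u x \<in> U \<and>
             (\<forall>A j. \<bar>pdiff (\<lambda>y. u y $ A) (exl j) x - F A j (jet_of u x)\<bar> \<le> K * (norm (x - x0))^2)"
    and init: "\<And>y A. (y, z0) \<in> V \<Longrightarrow> dist y y0 < e \<Longrightarrow> \<bar>u (y, z0) $ A - a y $ A\<bar> \<le> K * (norm (y - y0))^3"
    unfolding approx_solution_def x0 fst_conv snd_conv by blast
  obtain d0 where d0: "d0 > 0" "ball x0 d0 \<subseteq> V" using V open_contains_ball by blast
  define d where "d = min d0 e"
  have d: "d > 0" "d \<le> d0" "d \<le> e" using d0 e by (auto simp: d_def)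
  define W where "W = ball x0 d"
  have W: "open W" "x0 \<in> W" "W \<subseteq> V" using d d0 by (auto simp: W_def)
  have u: "real_analytic_on (\<lambda>x. u x $ A) W" for A using real_analytic_on_subset[OF u0 W(3)] .
  have jet: "jet_of u ` W \<subseteq> U"
    using eq W(3) d by (auto simp: W_def dist_commute)
  have slice: "(y, z0) \<in> W" if "norm (y - y0) < d" for y
    using that by (simp add: W_def x0 dist_norm norm_minus_commute norm_Pair)
  define g where "g A y = u (y, z0) $ A - a y $ A" for A y
  define S where "S = {y. (y, z0) \<in> W}"
  have y0: "y0 \<in> S" using W by (simp add: S_def x0)
  have us: "real_analytic_on (\<lambda>y. u (y, z0) $ A) S" for A
    by (rule real_analytic_on_slice[OF u]) (simp add: S_def)
  have g: "real_analytic_on (g A) S" for A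
    unfolding g_def by (intro real_analytic_on_diff us a_an)
  have gK: "\<bar>g A y\<bar> \<le> K * norm (y - y0) ^ 3" if "norm (y - y0) < d" for A y
    using init[of y A] slice[OF that] W(3) that d by (auto simp: g_def dist_norm)
  have ax: "axis H (1::real) \<in> Basis" for H :: 'k by simp
  note contact = second_order_contact[OF g y0 d(1) gK]
  have u_0: "u x0 = p0"
    using contact(1)[OF _ ax ax] a0 by (simp add: g_def vec_eq_iff x0)
  have du: "pdiff (g A) (axis H 1) y = pdiff (\<lambda>x. u x $ A) (exk H) (y, z0) - pdiff (\<lambda>y. a y $ A) (axis H 1) y" if "y \<in> S" for A H y
    unfolding g_def pdiff_diff[OF us a_an that] pdiff_slice[of "\<lambda>x. u x $ A"] ..
  have u_1: "pdiff (\<lambda>x. u x $ A) (exk H) x0 = p1 $ A $ H" for A H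
    using contact(2)[OF _ ax ax, of A H] du[OF y0, of A H] a1[of A H] by (simp add: x0)
  have jet0: "jet_of u x0 = w"
    using u_0 u_1 by (simp add: jet_of_def w vec_eq_iff)
  have S_open: "open S"
  proof -
    have "S = (\<lambda>y. (y, z0)) -` W" by (auto simp: S_def)
    thus ?thesis using W(1) by (auto intro!: open_vimage continuous_intros)
  qed
  have u_2: "pdiff (pdiff (\<lambda>x. u x $ A) (exk L')) (exk G') x0
     = (if A = C then s else 0) * (axis L' 1 $ G * axis G' 1 $ L + axis G' 1 $ G * axis L' 1 $ L)" for A G' L'
  proof -
    have "pdiff (pdiff (g A) (axis L' 1)) (axis G' 1) y0
      = pdiff (\<lambda>y. pdiff (\<lambda>x. u x $ A) (exk L') (y, z0) - pdiff (\<lambda>y. a y $ A) (axis L' 1) y) (axis G' 1) y0"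
      by (rule pdiff_cong[OF S_open y0 du])
    also have "\<dots> = pdiff (\<lambda>y. pdiff (\<lambda>x. u x $ A) (exk L') (y, z0)) (axis G' 1) y0
        - pdiff (pdiff (\<lambda>y. a y $ A) (axis L' 1)) (axis G' 1) y0"
    proof (rule pdiff_diff[OF _ _ y0])
      show "real_analytic_on (\<lambda>y. pdiff (\<lambda>x. u x $ A) (exk L') (y, z0)) S"
        by (rule real_analytic_on_slice[OF real_analytic_on_pdiff[OF u]]) (auto simp: S_def)
      show "real_analytic_on (pdiff (\<lambda>y. a y $ A) (axis L' 1)) S"
        by (intro real_analytic_on_pdiff a_an ax)
    qed
    also have "pdiff (\<lambda>y. pdiff (\<lambda>x. u x $ A) (exk L') (y, z0)) (axis G' 1) y0 = pdiff (pdiff (\<lambda>x. u x $ A) (exk L')) (exk G') x0"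
      unfolding pdiff_slice x0 ..
    also have "pdiff (pdiff (\<lambda>y. a y $ A) (axis L' 1)) (axis G' 1) y0
      = (if A = C then s else 0) * (axis L' 1 $ G * axis G' 1 $ L + axis G' 1 $ G * axis L' 1 $ L)"
      unfolding a_def by (rule quadratic_datum_pdiff2)
    finally show ?thesis using contact(3)[OF _ ax ax, of A L' G'] by simp
  qed
  note defect_an = real_analytic_on_defect[where F = F, OF F u jet]
  have defect_le: "\<bar>defect F u A j x\<bar> \<le> K * norm (x - x0) ^ 2" if "norm (x - x0) < d" for A j x
  proof -
    have "x \<in> W" using that by (simp add: W_def dist_norm norm_minus_commute)
    thus ?thesis using eq[of x] W(3) that d by (auto simp: defect_def dist_norm)
  qed
  have defect0: "defect F u A j x0 = 0" for A j
    by (rule first_order_contact(1)[OF defect_an W(2) d(1) defect_le exl_Basis[of j]])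
  have defect1: "pdiff (defect F u A j) b x0 = 0" if "b \<in> Basis" for A j b
    by (rule first_order_contact(2)[OF defect_an W(2) d(1) defect_le that])
  have total: "pdiff (\<lambda>x. F A i (jet_of u x)) (exl j) x0 = Phi F A i j w + s * Psi F A G L i j C w" for i j
    unfolding total_derivative[where F = F, OF F u jet W(2)] jet0 u_2
    by (subst contraction_quadratic[of "\<lambda>G L C. Psi F A G L i j C w"]) (simp_all add: Psi_commute[of F A _ _ i j] defect0 defect1)
  have "pdiff (pdiff (\<lambda>y. u y $ A) (exl i)) (exl j) x0 = pdiff (\<lambda>x. F A i (jet_of u x)) (exl j) x0" for i j
    unfolding pdiff_exl_eq[of u A i F]
    using pdiff_add[OF real_analytic_on_F_jet[OF u jet F] defect_an W(2), of A i A i "exl j"] defect1 by simp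
  from this[of i j] this[of j i] total[of i j] total[of j i] pdiff_commute[OF u W(2) exl_Basis exl_Basis, of A i j]
  show ?thesis by simp
qed

section \<open>Vanishing order along the initial manifold\<close>

text \<open>Vanishing to order \<open>n\<close> along the slice with transversal coordinate
  \<open>z\<close>. Only transversal derivatives are iterated, since tangential ones preserve
  vanishing on the slice.\<close>

fun van :: "nat \<Rightarrow> real^'l::finite \<Rightarrow> ((real^'k::finite) \<times> (real^'l)) set \<Rightarrow> ((real^'k) \<times> (real^'l) \<Rightarrow> real) \<Rightarrow> bool" where
  "van 0 z D f \<longleftrightarrow> real_analytic_on f D"
| "van (Suc n) z D f \<longleftrightarrow> real_analytic_on f D \<and> (\<forall>y. (y, z) \<in> D \<longrightarrow> f (y, z) = 0) \<and> (\<forall>j. van n z D (pdiff f (exl j)))"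

lemma van_analytic: "van n z D f \<Longrightarrow> real_analytic_on f D"
  by (cases n) auto

lemma van_SucD: "van (Suc n) z D f \<Longrightarrow> van n z D f"
  by (induction n arbitrary: f) auto

context
  fixes D :: "((real^'k::finite) \<times> (real^'l::finite)) set" and z :: "real^'l"
  assumes D: "open D"
begin

lemma van_cong:
  assumes "\<And>x. x \<in> D \<Longrightarrow> f x = g x" "van n z D f"
  shows "van n z D g"
  using assms
proof (induction n arbitrary: f g)
  case 0
  thus ?case using real_analytic_on_cong[OF D order_refl] by auto
next
  case (Suc n)
  have "van n z D (pdiff g (exl j))" for j
  proof (rule Suc.IH)
    show "pdiff f (exl j) x = pdiff g (exl j) x" if "x \<in> D" for x
      by (rule pdiff_cong[OF D that Suc.prems(1)])
  qed (use Suc.prems in simp)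
  thus ?case using Suc.prems real_analytic_on_cong[OF D order_refl, of f g] by auto
qed

lemma van_add:
  assumes "van n z D f" "van n z D g"
  shows "van n z D (\<lambda>x. f x + g x)"
  using assms
proof (induction n arbitrary: f g)
  case (Suc n)
  have "van n z D (pdiff (\<lambda>x. f x + g x) (exl j))" for j
    by (rule van_cong[of "\<lambda>x. pdiff f (exl j) x + pdiff g (exl j) x"])
       (use Suc pdiff_add[of f D g] in auto)
  thus ?case using Suc.prems by (auto intro: real_analytic_on_add)
qed (auto intro: real_analytic_on_add)

lemma van_mult:
  assumes "real_analytic_on g D" "van n z D f"
  shows "van n z D (\<lambda>x. g x * f x)"
  using assms
proof (induction n arbitrary: f g)
  case (Suc n)
  have "van n z D (pdiff (\<lambda>x. g x * f x) (exl j))" for j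
  proof (rule van_cong)
    show "van n z D (\<lambda>x. pdiff g (exl j) x * f x + g x * pdiff f (exl j) x)"
      using Suc.prems van_SucD[OF Suc.prems(2)]
      by (intro van_add Suc.IH real_analytic_on_pdiff) auto
    show "pdiff g (exl j) x * f x + g x * pdiff f (exl j) x = pdiff (\<lambda>x. g x * f x) (exl j) x" if "x \<in> D" for x
      using pdiff_mult[OF Suc.prems(1) van_analytic[OF Suc.prems(2)] that] by simp
  qed
  thus ?case using Suc.prems by (auto intro: real_analytic_on_mult)
qed (auto intro: real_analytic_on_mult)

lemma van_zero: "van n z D (\<lambda>_. 0)"
proof (induction n)
  case (Suc n)
  have "pdiff (\<lambda>_. 0) v = (\<lambda>_. 0)" for v :: "(real^'k) \<times> (real^'l)" by (simp add: fun_eq_iff pdiff_zero)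
  thus ?case using Suc by (simp add: real_analytic_on_const)
qed (simp add: real_analytic_on_const)

lemma van_sum: "(\<And>i. i \<in> I \<Longrightarrow> van n z D (f i)) \<Longrightarrow> van n z D (\<lambda>x. \<Sum>i\<in>I. f i x)"
  by (induction I rule: infinite_finite_induct) (auto intro: van_zero van_add)

lemma van_diff: "van n z D f \<Longrightarrow> van n z D g \<Longrightarrow> van n z D (\<lambda>x. f x - g x)"
  using van_add[of n f "\<lambda>x. - 1 * g x"] van_mult[OF real_analytic_on_const, of n g "-1"] by simp

lemma pdiff_exk_slice_zero:
  assumes "\<And>y. (y, z) \<in> D \<Longrightarrow> f (y, z) = 0" "(y, z) \<in> D"
  shows "pdiff f (exk G) (y, z) = 0"
proof -
  have "open ((\<lambda>y. (y, z)) -` D)" by (intro open_vimage D continuous_intros)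
  hence "pdiff (\<lambda>y. f (y, z)) (axis G 1) y = pdiff (\<lambda>_. 0) (axis G 1) y"
    by (rule pdiff_cong) (use assms in auto)
  thus ?thesis by (simp add: pdiff_slice pdiff_zero)
qed

text \<open>No order is lost: a function that is zero on the slice has zero tangential derivatives
  there, and the two kinds of derivatives commute. Both later inductions on the order depend on
  this.\<close>

lemma van_pdiff_exk: "van n z D f \<Longrightarrow> van n z D (pdiff f (exk G))"
proof (induction n arbitrary: f)
  case (Suc n)
  have "van n z D (pdiff (pdiff f (exk G)) (exl j))" for j
    by (rule van_cong[of "pdiff (pdiff f (exl j)) (exk G)"])
       (use Suc pdiff_commute[OF van_analytic[OF Suc.prems]] in auto)
  thus ?case using Suc.prems pdiff_exk_slice_zero[of f] by (auto intro: real_analytic_on_pdiff)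
qed (auto intro: real_analytic_on_pdiff)

lemma van_pdiff_exl: "van (Suc n) z D f \<Longrightarrow> van n z D (pdiff f (exl j))"
  by simp

lemma coord_diff:
  "real_analytic_on (\<lambda>x. snd x $ i - z $ i) D"
  "x \<in> D \<Longrightarrow> pdiff (\<lambda>x. snd x $ i - z $ i) (exl j) x = (if i = j then 1 else 0)"
proof -
  show "real_analytic_on (\<lambda>x. snd x $ i - z $ i) D"
    by (intro real_analytic_on_diff real_analytic_on_coord real_analytic_on_const)
  show "pdiff (\<lambda>x. snd x $ i - z $ i) (exl j) x = (if i = j then 1 else 0)" if "x \<in> D"
    unfolding pdiff_diff[OF real_analytic_on_coord(2) real_analytic_on_const that] pdiff_zero pdiff_coord
    by (auto simp: exl_def axis_def)
qed

text \<open>The order gained here is what drives the induction for the defects.\<close>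

lemma van_coord_mult: "van n z D f \<Longrightarrow> van (Suc n) z D (\<lambda>x. (snd x $ i - z $ i) * f x)"
proof (induction n arbitrary: f)
  case 0
  thus ?case by (auto intro!: real_analytic_on_mult real_analytic_on_pdiff coord_diff(1))
next
  case (Suc n)
  note an = van_analytic[OF Suc.prems]
  have "van (Suc n) z D (pdiff (\<lambda>x. (snd x $ i - z $ i) * f x) (exl j))" for j
  proof (rule van_cong)
    show "van (Suc n) z D (\<lambda>x. (if i = j then 1 else 0) * f x + (snd x $ i - z $ i) * pdiff f (exl j) x)"
      by (intro van_add van_mult real_analytic_on_const Suc.prems Suc.IH van_pdiff_exl)
    show "(if i = j then 1 else 0) * f x + (snd x $ i - z $ i) * pdiff f (exl j) x
       = pdiff (\<lambda>x. (snd x $ i - z $ i) * f x) (exl j) x" if "x \<in> D" for x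
      unfolding pdiff_mult[OF coord_diff(1) an that] coord_diff(2)[OF that] ..
  qed
  thus ?case using an by (subst van.simps) (auto intro: real_analytic_on_mult coord_diff(1))
qed

text \<open>On the slice the Euler operator gives zero, so k f = 0 there. A transversal derivative
  turns E + k into E + (k + 1) acting on the derivative of \<open>f\<close>, which is why
  \<open>k\<close> varies in the induction.\<close>

lemma van_radial:
  assumes "real_analytic_on f D" "k > 0"
    and "van n z D (\<lambda>x. (\<Sum>i\<in>UNIV. (snd x $ i - z $ i) * pdiff f (exl i) x) + k * f x)"
  shows "van n z D f"
  using assms
proof (induction n arbitrary: f k)
  case (Suc n)
  let ?E = "\<lambda>k f x. (\<Sum>i\<in>UNIV. (snd x $ i - z $ i) * pdiff f (exl i) x) + k * f x"
  note an = Suc.prems(1)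
  have term_an: "real_analytic_on (\<lambda>x. (snd x $ i - z $ i) * pdiff f (exl i) x) D" for i
    by (intro real_analytic_on_mult coord_diff(1) real_analytic_on_pdiff an exl_Basis)
  have "f (y, z) = 0" if "(y, z) \<in> D" for y
    using Suc.prems(2,3) that by auto
  moreover have "van n z D (pdiff f (exl j))" for j
  proof (rule Suc.IH[of _ "k + 1"])
    show "real_analytic_on (pdiff f (exl j)) D" by (intro real_analytic_on_pdiff an exl_Basis)
    show "van n z D (?E (k + 1) (pdiff f (exl j)))"
    proof (rule van_cong)
      show "van n z D (pdiff (?E k f) (exl j))" using Suc.prems(3) by (rule van_pdiff_exl)
      fix x assume x: "x \<in> D"
      have "pdiff (?E k f) (exl j) x = pdiff (\<lambda>x. \<Sum>i\<in>UNIV. (snd x $ i - z $ i) * pdiff f (exl i) x) (exl j) x + pdiff (\<lambda>x. k * f x) (exl j) x"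
        by (rule pdiff_add[OF _ real_analytic_on_cmult[OF an] x]) (intro real_analytic_on_sum term_an)
      also have "pdiff (\<lambda>x. \<Sum>i\<in>UNIV. (snd x $ i - z $ i) * pdiff f (exl i) x) (exl j) x
          = (\<Sum>i\<in>UNIV. pdiff (\<lambda>x. (snd x $ i - z $ i) * pdiff f (exl i) x) (exl j) x)"
        by (rule pdiff_sum[OF term_an x])
      also have "pdiff (\<lambda>x. k * f x) (exl j) x = k * pdiff f (exl j) x"
        by (rule pdiff_cmult[OF an x])
      also have "(\<Sum>i\<in>UNIV. pdiff (\<lambda>x. (snd x $ i - z $ i) * pdiff f (exl i) x) (exl j) x)
        = (\<Sum>i\<in>UNIV. (if i = j then 1 else 0) * pdiff f (exl i) x + (snd x $ i - z $ i) * pdiff (pdiff f (exl j)) (exl i) x)"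
        using pdiff_mult[OF coord_diff(1) real_analytic_on_pdiff[OF an exl_Basis] x] coord_diff(2)[OF x]
          pdiff_commute[OF an x exl_Basis exl_Basis] by simp
      also have "\<dots> = pdiff f (exl j) x + (\<Sum>i\<in>UNIV. (snd x $ i - z $ i) * pdiff (pdiff f (exl j)) (exl i) x)"
        by (simp add: sum.distrib if_distrib[of "\<lambda>t. t * _"] cong: if_cong)
      finally show "pdiff (?E k f) (exl j) x = ?E (k + 1) (pdiff f (exl j)) x"
        by (simp add: algebra_simps)
    qed
  qed (use Suc.prems in auto)
  ultimately show ?case using an by auto
qed auto

text \<open>A derivative of the difference is a sum of two kinds of terms: a difference of the same
  type for a partial derivative of \<open>F\<close>, and a multiple of a derivative of
  \<open>J1 - J2\<close>. The first kind calls for an induction over all \<open>F\<close>; the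
  second has lost exactly one order.\<close>

lemma van_compose_diff:
  fixes F :: "'b::euclidean_space \<Rightarrow> real"
  assumes "real_analytic_on F U"
    and "\<And>b. b \<in> Basis \<Longrightarrow> real_analytic_on (\<lambda>x. J1 x \<bullet> b) D" "\<And>b. b \<in> Basis \<Longrightarrow> real_analytic_on (\<lambda>x. J2 x \<bullet> b) D"
    and "J1 ` D \<subseteq> U" "J2 ` D \<subseteq> U"
    and "\<And>b. b \<in> Basis \<Longrightarrow> van n z D (\<lambda>x. J1 x \<bullet> b - J2 x \<bullet> b)"
  shows "van n z D (\<lambda>x. F (J1 x) - F (J2 x))"
  using assms(1,6)
proof (induction n arbitrary: F)
  case 0
  thus ?case using assms real_analytic_on_compose[of F U _ D] by (auto intro!: real_analytic_on_diff)
next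
  case (Suc n)
  have an: "real_analytic_on (\<lambda>x. F (J1 x)) D" "real_analytic_on (\<lambda>x. F (J2 x)) D"
  proof -
    show "real_analytic_on (\<lambda>x. F (J1 x)) D"
      by (rule real_analytic_on_compose[OF Suc.prems(1) _ assms(4)]) (rule assms(2))
    show "real_analytic_on (\<lambda>x. F (J2 x)) D"
      by (rule real_analytic_on_compose[OF Suc.prems(1) _ assms(5)]) (rule assms(3))
  qed
  have U: "J1 x \<in> U" "J2 x \<in> U" if "x \<in> D" for x using assms(4,5) that by auto
  have "van n z D (pdiff (\<lambda>x. F (J1 x) - F (J2 x)) (exl j))" for j
  proof (rule van_cong)
    show "van n z D (\<lambda>x. \<Sum>b\<in>Basis. pdiff (\<lambda>x. J1 x \<bullet> b) (exl j) x * (pdiff F b (J1 x) - pdiff F b (J2 x))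
        + pdiff F b (J2 x) * pdiff (\<lambda>x. J1 x \<bullet> b - J2 x \<bullet> b) (exl j) x)"
    proof (intro van_sum van_add van_mult)
      fix b :: 'b assume b: "b \<in> Basis"
      show "real_analytic_on (pdiff (\<lambda>x. J1 x \<bullet> b) (exl j)) D"
        by (intro real_analytic_on_pdiff assms(2) b exl_Basis)
      show "van n z D (\<lambda>x. pdiff F b (J1 x) - pdiff F b (J2 x))"
        by (rule Suc.IH[OF real_analytic_on_pdiff[OF Suc.prems(1) b]]) (rule van_SucD[OF Suc.prems(2)])
      show "real_analytic_on (\<lambda>x. pdiff F b (J2 x)) D"
        by (rule real_analytic_on_compose[OF real_analytic_on_pdiff[OF Suc.prems(1) b] _ assms(5)]) (rule assms(3))
      show "van n z D (pdiff (\<lambda>x. J1 x \<bullet> b - J2 x \<bullet> b) (exl j))"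
        by (rule van_pdiff_exl[OF Suc.prems(2)[OF b]])
    qed
    fix x assume x: "x \<in> D"
    show "(\<Sum>b\<in>Basis. pdiff (\<lambda>x. J1 x \<bullet> b) (exl j) x * (pdiff F b (J1 x) - pdiff F b (J2 x))
        + pdiff F b (J2 x) * pdiff (\<lambda>x. J1 x \<bullet> b - J2 x \<bullet> b) (exl j) x) = pdiff (\<lambda>x. F (J1 x) - F (J2 x)) (exl j) x"
    proof -
      have "pdiff (\<lambda>x. F (J1 x)) (exl j) x = (\<Sum>b\<in>Basis. pdiff F b (J1 x) * pdiff (\<lambda>x. J1 x \<bullet> b) (exl j) x)"
        by (rule pdiff_compose[OF Suc.prems(1), where S = D]) (use U x assms(2) in blast)+
      moreover have "pdiff (\<lambda>x. F (J2 x)) (exl j) x = (\<Sum>b\<in>Basis. pdiff F b (J2 x) * pdiff (\<lambda>x. J2 x \<bullet> b) (exl j) x)"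
        by (rule pdiff_compose[OF Suc.prems(1), where S = D]) (use U x assms(3) in blast)+
      ultimately show ?thesis
        unfolding pdiff_diff[OF an x] by (simp add: sum_subtractf[symmetric])
          (intro sum.cong refl, simp add: pdiff_diff[OF assms(2) assms(3) x] algebra_simps)
    qed
  qed
  moreover have "F (J1 (y, z)) - F (J2 (y, z)) = 0" if "(y, z) \<in> D" for y
  proof -
    have "J1 (y, z) = J2 (y, z)"
      by (rule euclidean_eqI) (use Suc.prems(2) that in auto)
    thus ?thesis by simp
  qed
  ultimately show ?case using an by (auto intro: real_analytic_on_diff)
qed

text \<open>Infinite order along the slice is inherited by all partial derivatives, so the whole
  Taylor series at a point of the slice is zero.\<close>

lemma van_all_imp_zero:
  assumes "\<And>n. van n z D f" "(y, z) \<in> D"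
  obtains W where "open W" "(y, z) \<in> W" "\<And>x. x \<in> W \<Longrightarrow> f x = 0"
proof -
  obtain r c where e: "mexpand f (y, z) r c"
    using van_analytic[OF assms(1)] assms(2) unfolding real_analytic_on_iff_mexpand by blast
  have c: "c \<alpha> = 0" if "\<alpha> \<in> mindex" for \<alpha>
  proof (rule mexpand_coeff_zero[of "\<lambda>f. \<forall>n. van n z D f", OF _ _ _ e that])
    fix f :: "(real^'k) \<times> (real^'l) \<Rightarrow> real" and b :: "(real^'k) \<times> (real^'l)"
    assume f: "\<forall>n. van n z D f"
    show "f (y, z) = 0" using spec[OF f, of 1] assms(2) by simp
    show "\<forall>n. van n z D (pdiff f b)" if "b \<in> Basis"
      using that f van_pdiff_exk van_pdiff_exl by (cases rule: Basis_base_cases) blast+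
  qed (use assms in auto)
  show ?thesis
    by (rule that[of "ball (y, z) r"]) (use mexpandD(1)[OF e] mexpand_zero[OF e c] in auto)
qed

end

section \<open>Uniqueness\<close>

text \<open>If two solutions agree to order n, so do their jets, which contain only tangential
  derivatives. The equations pass this order to the transversal derivatives, and together with the
  common datum this gives order n + 1.\<close>

lemma cauchy_solution_unique:
  fixes F :: "'m::finite \<Rightarrow> 'l::finite \<Rightarrow> ('k::finite,'l,'m) jetpt \<Rightarrow> real"
  assumes F: "\<And>A j. real_analytic_on (F A j) U"
    and "cauchy_solution F U a x0 V1 u1" "cauchy_solution F U a x0 V2 u2"
  shows "\<exists>W. open W \<and> x0 \<in> W \<and> (\<forall>x\<in>W. u1 x = u2 x)"
proof -
  obtain y0 z0 where x0: "x0 = (y0, z0)" by (metis surj_pair)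
  define D where "D = V1 \<inter> V2"
  have D: "open D" "(y0, z0) \<in> D" using assms(2,3) by (auto simp: cauchy_solution_def D_def x0)
  have u1: "real_analytic_on (\<lambda>x. u1 x $ A) D" and u2: "real_analytic_on (\<lambda>x. u2 x $ A) D" for A
    using assms(2,3) by (auto simp: cauchy_solution_def D_def intro: real_analytic_on_subset)
  have J: "jet_of u1 ` D \<subseteq> U" "jet_of u2 ` D \<subseteq> U"
    using assms(2,3) by (auto simp: cauchy_solution_def D_def)
  have eq: "pdiff (\<lambda>y. u1 y $ A) (exl j) x = F A j (jet_of u1 x)" "pdiff (\<lambda>y. u2 y $ A) (exl j) x = F A j (jet_of u2 x)"
    if "x \<in> D" for A j x
    using assms(2,3) that by (auto simp: cauchy_solution_def D_def)
  have van: "van n z0 D (\<lambda>x. u1 x $ A - u2 x $ A)" for n A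
  proof (induction n arbitrary: A)
    case 0
    show ?case by (simp add: real_analytic_on_diff u1 u2)
  next
    case (Suc n)
    have "van n z0 D (\<lambda>x. jet_of u1 x \<bullet> b - jet_of u2 x \<bullet> b)" if "b \<in> Basis" for b
      using that
    proof (cases rule: Basis_jet_cases)
      case (4 B G)
      show ?thesis unfolding 4 inner_jet jet_of_simps
      proof (rule van_cong[OF D(1) _ van_pdiff_exk[OF D(1) Suc[of B], of G]])
        fix x assume "x \<in> D"
        thus "pdiff (\<lambda>x. u1 x $ B - u2 x $ B) (exk G) x = pdiff (\<lambda>y. u1 y $ B) (exk G) x - pdiff (\<lambda>y. u2 y $ B) (exk G) x"
          by (rule pdiff_diff[OF u1 u2])
      qed
    qed (simp_all add: van_zero[OF D(1)] Suc)
    hence vF: "van n z0 D (\<lambda>x. F A j (jet_of u1 x) - F A j (jet_of u2 x))" for j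
      by (intro van_compose_diff[OF D(1) F _ _ J] real_analytic_on_jet_of u1 u2) auto
    have "van n z0 D (pdiff (\<lambda>x. u1 x $ A - u2 x $ A) (exl j))" for j
      by (rule van_cong[OF D(1) _ vF[of j]]) (simp add: pdiff_diff[OF u1 u2] eq)
    moreover have "u1 (y, z0) $ A - u2 (y, z0) $ A = 0" if "(y, z0) \<in> D" for y
      using assms(2,3) that by (auto simp: cauchy_solution_def D_def x0)
    ultimately show ?case using u1 u2 by (auto intro: real_analytic_on_diff)
  qed
  have "\<exists>W. open W \<and> (y0, z0) \<in> W \<and> (\<forall>x\<in>W. u1 x $ A - u2 x $ A = 0)" for A
    using van_all_imp_zero[OF D(1) van D(2), of A] by metis
  then obtain W where W: "\<And>A. open (W A)" "\<And>A. (y0, z0) \<in> W A" "\<And>A x. x \<in> W A \<Longrightarrow> u1 x $ A - u2 x $ A = 0" by metis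
  show ?thesis
    by (rule exI[of _ "\<Inter>A. W A"]) (use W in \<open>auto simp: x0 vec_eq_iff\<close>)
qed

text \<open>Differentiating the radial equation shows that the defects satisfy a homogeneous linear
  system \<open>(E + 1) w\<^sub>j = \<Sum>\<^sub>i \<zeta>\<^sub>i L\<^sub>i\<^sub>j w\<close>, whose right-hand side vanishes to one order more than \<open>w\<close>.\<close>
lemma radial_solution_defect_van:
  fixes F :: "'m::finite \<Rightarrow> 'l::finite \<Rightarrow> ('k::finite,'l,'m) jetpt \<Rightarrow> real"
  assumes F: "\<And>A j. real_analytic_on (F A j) U" and V: "open V"
    and u: "\<And>A. real_analytic_on (\<lambda>x. u x $ A) V" and jet: "jet_of u ` V \<subseteq> U"
    and radial: "\<And>A x. x \<in> V \<Longrightarrow> (\<Sum>i\<in>UNIV. (snd x $ i - z $ i) * defect F u A i x) = 0"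
    and Phi: "\<And>w A a b. w \<in> U \<Longrightarrow> Phi F A a b w = Phi F A b a w"
    and Psi: "\<And>w A C G L a b. w \<in> U \<Longrightarrow> Psi F A G L a b C w = Psi F A G L b a C w"
  shows "van n z V (defect F u A j)"
proof (induction n arbitrary: A j)
  case 0
  show ?case by (simp add: real_analytic_on_defect[where F = F, OF F u jet])
next
  case (Suc n)
  note an = real_analytic_on_defect[where F = F, OF F u jet]
  \<comment> \<open>The part of the total derivative that is linear in the defects. By the
    compatibility conditions it is all that survives antisymmetrisation in i and j.\<close>
  define M where "M i j x = (\<Sum>B\<in>UNIV. pdiff (F A i) (dp B) (jet_of u x) * defect F u B j x)
    + (\<Sum>B\<in>UNIV. \<Sum>G\<in>UNIV. pdiff (F A i) (dp' B G) (jet_of u x) * pdiff (defect F u B j) (exk G) x)" for i j x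
  have M: "van n z V (M i j)" for i j
    unfolding M_def
    by (intro van_add[OF V] van_sum[OF V] van_mult[OF V] van_pdiff_exk[OF V] Suc.IH real_analytic_on_F_jet[OF u jet]
        real_analytic_on_pdiff F jet_Basis)
  have "van (Suc n) z V (\<lambda>x. (\<Sum>i\<in>UNIV. (snd x $ i - z $ i) * pdiff (defect F u A j) (exl i) x) + 1 * defect F u A j x)"
  proof (rule van_cong[OF V])
    show "van (Suc n) z V (\<lambda>x. \<Sum>i\<in>UNIV. (snd x $ i - z $ i) * (M i j x - M j i x))"
      by (intro van_sum[OF V] van_coord_mult[OF V] van_diff[OF V] M)
    fix x assume x: "x \<in> V"
    have Jx: "jet_of u x \<in> U" using jet x by blast
    have K: "pdiff (\<lambda>x. F A i (jet_of u x)) (exl j) x - pdiff (\<lambda>x. F A j (jet_of u x)) (exl i) x = M i j x - M j i x" for i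
      unfolding total_derivative[where F = F, OF F u jet x] M_def Phi[OF Jx, of A i j]  Psi[OF Jx, of A _ _ i j] by simp
    have mixed: "pdiff (pdiff (\<lambda>y. u y $ A) (exl i)) (exl j) x = pdiff (\<lambda>x. F A i (jet_of u x)) (exl j) x + pdiff (defect F u A i) (exl j) x" for i j
      unfolding pdiff_exl_eq[of u A i F] by (rule pdiff_add[OF real_analytic_on_F_jet[OF u jet F] an x])
    \<comment> \<open>The symmetry of the second derivatives of \<open>u\<close> expresses the curl
      of the defects through \<open>M\<close>.\<close>
    have diff: "pdiff (defect F u A j) (exl i) x = M i j x - M j i x + pdiff (defect F u A i) (exl j) x" for i
      using K[of i] mixed[of i j] mixed[of j i] pdiff_commute[OF u x exl_Basis exl_Basis, of A i j] by linarith
    have prod_an: "real_analytic_on (\<lambda>x. (snd x $ i - z $ i) * defect F u A i x) V" for i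
      by (intro real_analytic_on_mult coord_diff(1)[OF V] an)
    \<comment> \<open>Differentiating the radial identity produces derivatives in direction j of the
      i-th defect; \<open>diff\<close> exchanges the indices and the sum becomes the Euler operator
      applied to the j-th defect.\<close>
    have "0 = pdiff (\<lambda>x. \<Sum>i\<in>UNIV. (snd x $ i - z $ i) * defect F u A i x) (exl j) x"
      by (subst pdiff_cong[OF V x radial, where v = "exl j"]) (simp_all add: pdiff_zero)
    also have "\<dots> = (\<Sum>i\<in>UNIV. pdiff (\<lambda>x. (snd x $ i - z $ i) * defect F u A i x) (exl j) x)"
      by (rule pdiff_sum[OF prod_an x])
    also have "\<dots> = (\<Sum>i\<in>UNIV. (if i = j then 1 else 0) * defect F u A i x + (snd x $ i - z $ i) * pdiff (defect F u A i) (exl j) x)"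
      using pdiff_mult[OF coord_diff(1)[OF V] an x] coord_diff(2)[OF V x] by simp
    also have "\<dots> = defect F u A j x + (\<Sum>i\<in>UNIV. (snd x $ i - z $ i) * pdiff (defect F u A i) (exl j) x)"
      by (simp add: sum.distrib if_distrib[of "\<lambda>t. t * _"] cong: if_cong)
    finally show "(\<Sum>i\<in>UNIV. (snd x $ i - z $ i) * (M i j x - M j i x))
      = (\<Sum>i\<in>UNIV. (snd x $ i - z $ i) * pdiff (defect F u A j) (exl i) x) + 1 * defect F u A j x"
      by (simp add: diff distrib_left sum.distrib)
  qed
  thus ?case by (intro van_radial[OF V an, of 1]) auto
qed

section \<open>Radial integration of power series\<close>

type_synonym ('k, 'l) base = "(real^'k) \<times> (real^'l)"

text \<open>The eigenvalue of the Euler operator in the transversal variables on the monomial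
  \<alpha>.\<close>

definition zdeg :: "(('k::finite, 'l::finite) base \<Rightarrow> nat) \<Rightarrow> nat" where
  "zdeg \<alpha> = (\<Sum>j\<in>UNIV. \<alpha> (exl j))"

lemma component_le_zdeg: "\<alpha> (exl j) \<le> zdeg \<alpha>"
  unfolding zdeg_def by (rule member_le_sum) auto

lemma exl_eq_iff [simp]: "exl i = exl j \<longleftrightarrow> i = j"
  by (auto simp: exl_def axis_eq_axis)

lemma exk_neq_exl [simp]: "exk G \<noteq> exl j" "exl j \<noteq> exk G"
  by (auto simp: exl_def exk_def)

lemma zdeg_add_munit: "zdeg (\<beta> + munit (exl j)) = zdeg \<beta> + 1"
  by (simp add: zdeg_def sum.distrib munit_def)

text \<open>\<open>psr_rint j\<close> inverts the Euler operator in the \<open>exl\<close> directions on multiples of the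
  \<open>j\<close>-th transversal coordinate; \<open>psr_rint_diff G j\<close> is its derivative in direction
  \<^term>\<open>exk G\<close>. The point of the weights is that both have norm at most 1.\<close>
definition psr_rint :: "'l \<Rightarrow> ('k::finite, 'l::finite) base psr \<Rightarrow> ('k, 'l) base psr" where
  "psr_rint j = psr_lin (\<lambda>\<beta>. (mweight (\<beta> + munit (exl j)) / (mweight \<beta> * (real (zdeg \<beta>) + 1))) *\<^sub>R pse (\<beta> + munit (exl j)))"

definition psr_rint_diff :: "'k \<Rightarrow> 'l \<Rightarrow> ('k::finite, 'l::finite) base psr \<Rightarrow> ('k, 'l) base psr" where
  "psr_rint_diff G j = psr_lin (\<lambda>\<beta>. (real (\<beta> (exk G)) * mweight (\<beta> - munit (exk G) + munit (exl j)) / (mweight \<beta> * (real (zdeg \<beta>) + 1)))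
      *\<^sub>R pse (\<beta> - munit (exk G) + munit (exl j)))"

lemma norm_scaleR_pse_le: "\<bar>k\<bar> \<le> 1 \<Longrightarrow> norm (k *\<^sub>R pse \<alpha>) \<le> 1"
  using mult_mono[of "\<bar>k\<bar>" 1 "norm (pse \<alpha>)" 1] norm_pse_le[of \<alpha>] by simp

lemma psr_rint_bound:
  "norm ((mweight (\<beta> + munit (exl j)) / (mweight \<beta> * (real (zdeg \<beta>) + 1))) *\<^sub>R pse (\<beta> + munit (exl j))) \<le> 1"
proof (rule norm_scaleR_pse_le)
  have "mweight (\<beta> + munit (exl j)) \<le> mweight \<beta> * 1"
    using mweight_add_le[of \<beta> "munit (exl j)"] by simp
  also have "\<dots> \<le> mweight \<beta> * (real (zdeg \<beta>) + 1)" by (intro mult_left_mono) auto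
  finally show "\<bar>mweight (\<beta> + munit (exl j)) / (mweight \<beta> * (real (zdeg \<beta>) + 1))\<bar> \<le> 1"
    by (simp add: abs_of_pos divide_le_eq add_nonneg_pos)
qed

text \<open>This is the estimate without loss of derivatives. Writing \<beta> = \<gamma> + e_G and
  expressing both weights through that of \<gamma>, the degree factor cancels and the coefficient
  becomes (\<beta>_j + 1)/(\<open>zdeg \<beta>\<close> + 1).\<close>

lemma psr_rint_diff_bound:
  "norm ((real (\<beta> (exk G)) * mweight (\<beta> - munit (exk G) + munit (exl j)) / (mweight \<beta> * (real (zdeg \<beta>) + 1)))
      *\<^sub>R pse (\<beta> - munit (exk G) + munit (exl j))) \<le> 1"
proof (rule norm_scaleR_pse_le, cases "\<beta> (exk G) = 0")
  case False
  define \<gamma> where "\<gamma> = \<beta> - munit (exk G)"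
  have \<beta>: "\<beta> = \<gamma> + munit (exk G)" using minus_munit_add[of \<beta> "exk G"] False by (simp add: \<gamma>_def)
  define n where "n = real (mdeg \<gamma>) + 1"
  have n: "n > 0" by (simp add: n_def add_nonneg_pos)
  have "mweight (\<gamma> + munit (exl j)) * n = mweight \<gamma> * (real (\<gamma> (exl j)) + 1)"
    unfolding n_def by (rule mweight_add_munit) simp
  moreover have "mweight \<beta> * n = mweight \<gamma> * real (\<beta> (exk G))"
    using mweight_add_munit[of "exk G" \<gamma>] by (simp add: n_def \<beta>)
  ultimately have "n * (real (\<beta> (exk G)) * mweight (\<gamma> + munit (exl j))) = n * (mweight \<beta> * (real (\<gamma> (exl j)) + 1))"
    by algebra
  hence "real (\<beta> (exk G)) * mweight (\<gamma> + munit (exl j)) = mweight \<beta> * (real (\<gamma> (exl j)) + 1)"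
    using n by simp
  also have "\<gamma> (exl j) = \<beta> (exl j)" by (simp add: \<beta> munit_def)
  also have "mweight \<beta> * (real (\<beta> (exl j)) + 1) \<le> mweight \<beta> * (real (zdeg \<beta>) + 1)"
    using component_le_zdeg[of \<beta> j] by (intro mult_left_mono) auto
  finally have "real (\<beta> (exk G)) * mweight (\<gamma> + munit (exl j)) \<le> mweight \<beta> * (real (zdeg \<beta>) + 1)" .
  thus "\<bar>real (\<beta> (exk G)) * mweight (\<beta> - munit (exk G) + munit (exl j)) / (mweight \<beta> * (real (zdeg \<beta>) + 1))\<bar> \<le> 1"
    unfolding \<gamma>_def[symmetric] by (simp add: divide_le_eq add_nonneg_pos)
qed simp

lemma bounded_linear_psr_rint: "bounded_linear (psr_rint j)"
  unfolding psr_rint_def by (rule bounded_linear_psr_lin[of _ 1]) (rule psr_rint_bound)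

lemma bounded_linear_psr_rint_diff: "bounded_linear (psr_rint_diff G j)"
  unfolding psr_rint_diff_def by (rule bounded_linear_psr_lin[of _ 1]) (rule psr_rint_diff_bound)

lemma norm_psr_rint_le: "norm (psr_rint j f) \<le> norm f"
proof -
  have "norm (psr_rint j f) \<le> 1 * norm f"
    unfolding psr_rint_def by (rule norm_psr_lin_le) (rule psr_rint_bound)
  thus ?thesis by simp
qed

lemma norm_psr_rint_diff_le: "norm (psr_rint_diff G j f) \<le> norm f"
proof -
  have "norm (psr_rint_diff G j f) \<le> 1 * norm f"
    unfolding psr_rint_diff_def by (rule norm_psr_lin_le) (rule psr_rint_diff_bound)
  thus ?thesis by simp
qed

section \<open>Derivatives of evaluated series\<close>

text \<open>The termwise partial derivative as a linear functional on series, so that identities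
  about derivatives can also be checked on monomials.\<close>

definition psr_deval :: "'a::euclidean_space \<Rightarrow> 'a \<Rightarrow> 'a psr \<Rightarrow> real" where
  "psr_deval b h = psr_lin (\<lambda>\<alpha>. real (\<alpha> b) * mpow (\<lambda>b. h \<bullet> b) (\<alpha> - munit b) / mweight \<alpha>)"

lemma mexpand_psr_eval: "mexpand (\<lambda>h. psr_eval h \<phi>) 0 (1 / real DIM('a)) (psr_coeff \<phi>)"
  for \<phi> :: "'a::euclidean_space psr"
  unfolding mexpand_def using mconv_psr_coeff[of \<phi>] by (simp add: psr_eval_eq_msubst)

lemma pdiff_psr_eval:
  fixes h :: "'a::euclidean_space"
  assumes "\<And>b. b \<in> Basis \<Longrightarrow> \<bar>h \<bullet> b\<bar> < 1 / real DIM('a)" "b \<in> Basis"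
  shows "pdiff (\<lambda>h. psr_eval h \<phi>) b h = psr_deval b h \<phi>"
proof -
  have "pdiff (\<lambda>h. psr_eval h \<phi>) b (0 + h) = msubst (mderiv b (psr_coeff \<phi>)) (\<lambda>b. h \<bullet> b)"
    by (rule pdiff_mexpand[OF mexpand_psr_eval assms(2)]) (rule assms(1))
  also have "\<dots> = (\<Sum>\<^sub>\<infinity>\<alpha>\<in>mindex. psr_coeff \<phi> \<alpha> * (real (\<alpha> b) * mpow (\<lambda>b. h \<bullet> b) (\<alpha> - munit b)))"
    by (rule infsum_mderiv[OF assms(2), symmetric])
  also have "\<dots> = psr_deval b h \<phi>"
    unfolding psr_deval_def psr_lin_def by (intro infsum_cong) (simp add: psr_coeff_def)
  finally show ?thesis by simp
qed

text \<open>Half of the evaluation cube supplies the factor 2^(-n) that beats the exponent,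
  \<alpha>_b being at most n + 1; the drop of the degree by one leaves the factor
  \<open>DIM\<close>.\<close>

lemma bounded_linear_psr_deval:
  fixes h :: "'a::euclidean_space"
  assumes h: "\<And>b. b \<in> Basis \<Longrightarrow> \<bar>h \<bullet> b\<bar> \<le> 1 / (2 * real DIM('a))" and b: "b \<in> Basis"
  shows "bounded_linear (psr_deval b h)"
  unfolding psr_deval_def
proof (rule bounded_linear_psr_lin[of _ "real DIM('a)"])
  fix \<alpha> :: "'a \<Rightarrow> nat" assume \<alpha>: "\<alpha> \<in> mindex"
  show "norm (real (\<alpha> b) * mpow (\<lambda>b. h \<bullet> b) (\<alpha> - munit b) / mweight \<alpha>) \<le> real DIM('a)"
  proof (cases "\<alpha> b = 0")
    case False
    define D where "D = real DIM('a)"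
    have D: "D > 0" by (simp add: D_def)
    define n where "n = mdeg (\<alpha> - munit b)"
    have n: "mdeg \<alpha> = Suc n"
      using minus_munit_add[of \<alpha> b] False b mdeg_add[of "\<alpha> - munit b" "munit b"] by (simp add: n_def)
    have "norm (mpow (\<lambda>b. h \<bullet> b) (\<alpha> - munit b)) \<le> (1 / (2 * D)) ^ n"
      unfolding n_def D_def by (rule norm_mpow_le) (use h in simp)
    moreover have "\<alpha> b \<le> 2 ^ n"
      using component_le_mdeg[OF b, of \<alpha>] n less_exp[of n] by linarith
    hence "real (\<alpha> b) \<le> 2 ^ n" by (metis of_nat_le_iff of_nat_numeral of_nat_power)
    ultimately have "real (\<alpha> b) * norm (mpow (\<lambda>b. h \<bullet> b) (\<alpha> - munit b)) \<le> 2 ^ n * (1 / (2 * D)) ^ n"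
      by (intro mult_mono) auto
    also have "\<dots> = D * (1 / D) ^ mdeg \<alpha>"
      using D by (simp add: n power_divide power_mult_distrib)
    also have "\<dots> \<le> D * mweight \<alpha>"
      using mweight_ge[OF \<alpha>] D by (intro mult_left_mono) (auto simp: D_def)
    finally show ?thesis by (simp add: D_def abs_mult divide_le_eq)
  qed simp
qed

context
  fixes h :: "('k::finite, 'l::finite) base"
  assumes h: "\<And>b. b \<in> Basis \<Longrightarrow> \<bar>h \<bullet> b\<bar> \<le> 1 / (2 * real DIM(('k, 'l) base))"
begin

lemma eval_radius: "b \<in> Basis \<Longrightarrow> \<bar>h \<bullet> b\<bar> \<le> 1 / real DIM(('k, 'l) base)"
proof -
  assume "b \<in> Basis"
  moreover have "1 / (2 * d) \<le> 1 / d" if "d > 0" for d :: real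
    using that by (simp add: field_simps)
  from this[of "real DIM(('k, 'l) base)"]
  have "1 / (2 * real DIM(('k, 'l) base)) \<le> 1 / real DIM(('k, 'l) base)"
    using DIM_positive[where 'a = "('k, 'l) base"] by linarith
  ultimately show ?thesis using h by fastforce
qed

text \<open>Every monomial in the image contains a transversal coordinate, so the correction added
  to the datum vanishes on the initial manifold.\<close>

lemma psr_eval_rint_slice:
  assumes "snd h = 0"
  shows "psr_eval h (psr_rint j f) = 0"
proof (rule psr_linear_ext[of "\<lambda>f. psr_eval h (psr_rint j f)" "\<lambda>_. 0"])
  show "bounded_linear (\<lambda>f. psr_eval h (psr_rint j f))"
    by (rule bounded_linear_compose[OF bounded_linear_psr_eval[OF eval_radius] bounded_linear_psr_rint])
  fix \<alpha> :: "('k, 'l) base \<Rightarrow> nat" assume "\<alpha> \<in> mindex"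
  thus "psr_eval h (psr_rint j (pse \<alpha>)) = 0"
    using assms by (simp add: psr_rint_def psr_eval_scaleR[OF eval_radius]) (simp add: psr_eval_def mpow_add)
qed (rule bounded_linear_zero)

lemma psr_deval_rint_exk: "psr_deval (exk G) h (psr_rint j f) = psr_eval h (psr_rint_diff G j f)"
proof (rule psr_linear_ext[of "\<lambda>f. psr_deval (exk G) h (psr_rint j f)" "\<lambda>f. psr_eval h (psr_rint_diff G j f)"])
  show "bounded_linear (\<lambda>f. psr_eval h (psr_rint_diff G j f))"
    by (rule bounded_linear_compose[OF bounded_linear_psr_eval[OF eval_radius] bounded_linear_psr_rint_diff])
  have lin: "bounded_linear (psr_deval (exk G) h)" by (rule bounded_linear_psr_deval[OF h exk_Basis])
  show "bounded_linear (\<lambda>f. psr_deval (exk G) h (psr_rint j f))"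
    by (rule bounded_linear_compose[OF lin bounded_linear_psr_rint])
  fix \<beta> :: "('k, 'l) base \<Rightarrow> nat" assume \<beta>: "\<beta> \<in> mindex"
  have G: "(\<beta> + munit (exl j)) (exk G) = \<beta> (exk G)" by (simp add: munit_def)
  have "psr_deval (exk G) h (psr_rint j (pse \<beta>))
    = real (\<beta> (exk G)) * mpow (\<lambda>b. h \<bullet> b) (\<beta> + munit (exl j) - munit (exk G)) / (mweight \<beta> * (real (zdeg \<beta>) + 1))"
    using \<beta> linear_scale[OF bounded_linear.linear[OF lin]] G
    by (simp add: psr_rint_def) (simp add: psr_deval_def)
  \<comment> \<open>Lowering and raising commute unless the exponent to be lowered is 0, and in that
    case the prefactor is 0.\<close>
  also have "real (\<beta> (exk G)) * mpow (\<lambda>b. h \<bullet> b) (\<beta> + munit (exl j) - munit (exk G))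
     = real (\<beta> (exk G)) * mpow (\<lambda>b. h \<bullet> b) (\<beta> - munit (exk G) + munit (exl j))"
    by (cases "\<beta> (exk G) = 0") (simp_all add: minus_munit_add_swap)
  also have "\<dots> / (mweight \<beta> * (real (zdeg \<beta>) + 1)) = psr_eval h (psr_rint_diff G j (pse \<beta>))"
    using \<beta> by (simp add: psr_rint_diff_def psr_eval_scaleR[OF eval_radius]) (simp add: psr_eval_def)
  finally show "psr_deval (exk G) h (psr_rint j (pse \<beta>)) = psr_eval h (psr_rint_diff G j (pse \<beta>))" .
qed

text \<open>The monomial \<beta> + e_j is an eigenvector of the Euler operator with eigenvalue
  \<open>zdeg \<beta>\<close> + 1, the divisor built into \<open>psr_rint\<close>.\<close>

lemma psr_deval_rint_radial:
  "(\<Sum>i\<in>UNIV. snd h $ i * psr_deval (exl i) h (psr_rint j f)) = snd h $ j * psr_eval h f"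
proof (rule psr_linear_ext[of "\<lambda>f. \<Sum>i\<in>UNIV. snd h $ i * psr_deval (exl i) h (psr_rint j f)" "\<lambda>f. snd h $ j * psr_eval h f"])
  have lin: "bounded_linear (psr_deval (exl i) h)" for i by (rule bounded_linear_psr_deval[OF h exl_Basis])
  show "bounded_linear (\<lambda>f. \<Sum>i\<in>UNIV. snd h $ i * psr_deval (exl i) h (psr_rint j f))"
    by (intro bounded_linear_sum bounded_linear_const_mult bounded_linear_compose[OF lin bounded_linear_psr_rint])
  show "bounded_linear (\<lambda>f. snd h $ j * psr_eval h f)"
    by (intro bounded_linear_const_mult bounded_linear_psr_eval[OF eval_radius])
  fix \<beta> :: "('k, 'l) base \<Rightarrow> nat" assume \<beta>: "\<beta> \<in> mindex"
  define \<alpha> where "\<alpha> = \<beta> + munit (exl j)"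
  define H where "H = (\<lambda>b. h \<bullet> b)"
  define Z where "Z = mweight \<beta> * (real (zdeg \<beta>) + 1)"
  have Z: "Z \<noteq> 0" unfolding Z_def using of_nat_0_le_iff[of "zdeg \<beta>"] by (simp add: add_nonneg_eq_0_iff)
  have "snd h $ i * psr_deval (exl i) h (psr_rint j (pse \<beta>)) = real (\<alpha> (exl i)) * (mpow H \<alpha> / Z)" for i
  proof -
    have "psr_deval (exl i) h (psr_rint j (pse \<beta>)) = real (\<alpha> (exl i)) * mpow H (\<alpha> - munit (exl i)) / Z"
      using \<beta> linear_scale[OF bounded_linear.linear[OF lin]]
      by (simp add: psr_rint_def flip: \<alpha>_def) (simp add: psr_deval_def \<alpha>_def H_def Z_def)
    moreover have "snd h $ i * (real (\<alpha> (exl i)) * mpow H (\<alpha> - munit (exl i))) = real (\<alpha> (exl i)) * mpow H \<alpha>"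
    proof (cases "\<alpha> (exl i) = 0")
      case False
      hence "mpow H \<alpha> = mpow H (\<alpha> - munit (exl i)) * mpow H (munit (exl i))"
        using minus_munit_add[of \<alpha> "exl i"] mpow_add[of H "\<alpha> - munit (exl i)" "munit (exl i)"] by simp
      thus ?thesis by (simp add: H_def)
    qed simp
    ultimately show ?thesis by simp
  qed
  hence "(\<Sum>i\<in>UNIV. snd h $ i * psr_deval (exl i) h (psr_rint j (pse \<beta>))) = real (zdeg \<alpha>) * (mpow H \<alpha> / Z)"
    by (simp add: zdeg_def sum_distrib_right flip: sum_divide_distrib)
  also have "\<dots> = mpow H \<alpha> / mweight \<beta>"
    using Z unfolding \<alpha>_def zdeg_add_munit Z_def by (simp add: add.commute)
  also have "\<dots> = snd h $ j * psr_eval h (pse \<beta>)"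
    using \<beta> by (simp add: \<alpha>_def mpow_add H_def psr_eval_def)
  finally show "(\<Sum>i\<in>UNIV. snd h $ i * psr_deval (exl i) h (psr_rint j (pse \<beta>))) = snd h $ j * psr_eval h (pse \<beta>)" .
qed

end

section \<open>Existence for the radial equation\<close>

text \<open>Substitution takes a function of basis vectors. A formula linear in \<open>b\<close>
  prescribes its values on the four kinds of jet coordinates without a case distinction on
  \<open>b\<close>.\<close>

definition jmap ::
  "('k \<Rightarrow> 'a::real_vector) \<Rightarrow> ('l \<Rightarrow> 'a) \<Rightarrow> ('m \<Rightarrow> 'a) \<Rightarrow> ('m \<Rightarrow> 'k \<Rightarrow> 'a)
    \<Rightarrow> ('k::finite, 'l::finite, 'm::finite) jetpt \<Rightarrow> 'a" where
  "jmap \<xi> \<eta> P Q b = (\<Sum>G\<in>UNIV. (fst (fst b) $ G) *\<^sub>R \<xi> G) + (\<Sum>j\<in>UNIV. (snd (fst b) $ j) *\<^sub>R \<eta> j)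
     + (\<Sum>B\<in>UNIV. (fst (snd b) $ B) *\<^sub>R P B) + (\<Sum>B\<in>UNIV. \<Sum>G\<in>UNIV. (snd (snd b) $ B $ G) *\<^sub>R Q B G)"

lemma sum_axis_scaleR: "(\<Sum>i\<in>UNIV. (axis k (1::real) $ i) *\<^sub>R f i) = (f k :: 'a::real_vector)"
  by (simp add: axis_def if_distrib[of "\<lambda>t. t *\<^sub>R _"] cong: if_cong)

lemma jmap_simps [simp]:
  "jmap \<xi> \<eta> P Q (dxk G) = \<xi> G" "jmap \<xi> \<eta> P Q (dxl j) = \<eta> j"
  "jmap \<xi> \<eta> P Q (dp B) = P B" "jmap \<xi> \<eta> P Q (dp' B G) = Q B G"
proof -
  have "(\<Sum>B'\<in>UNIV. \<Sum>G'\<in>UNIV. (axis B (axis G (1::real)) $ B' $ G') *\<^sub>R Q B' G')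
      = (\<Sum>B'\<in>UNIV. if B' = B then (\<Sum>G'\<in>UNIV. (axis G (1::real) $ G') *\<^sub>R Q B' G') else 0)"
    by (intro sum.cong refl) (auto simp: axis_def)
  also have "\<dots> = Q B G" by (simp add: sum_axis_scaleR)
  finally show "jmap \<xi> \<eta> P Q (dp' B G) = Q B G" by (simp add: jmap_def dp'_def)
qed (simp_all add: jmap_def dxk_def dxl_def dp_def exk_def exl_def sum_axis_scaleR)

text \<open>The jet of the candidate solution relative to the base jet, as series in coordinates
  scaled by \<open>s\<close> tangentially and \<open>t\<close> transversally. \<open>P\<close> and
  \<open>Q\<close> carry the datum and its first derivatives without constant terms; a tangential
  derivative of the correction contributes 1/s, whence \<open>t / s\<close>.\<close>

definition ck_map ::
  "real \<Rightarrow> real \<Rightarrow> ('m \<Rightarrow> ('k, 'l) base psr) \<Rightarrow> ('m \<Rightarrow> 'k \<Rightarrow> ('k, 'l) base psr) \<Rightarrow> ('m \<Rightarrow> 'l \<Rightarrow> ('k, 'l) base psr)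
    \<Rightarrow> ('k::finite, 'l::finite, 'm::finite) jetpt \<Rightarrow> ('k, 'l) base psr" where
  "ck_map s t P Q f = jmap (\<lambda>G. s *\<^sub>R pse (munit (exk G))) (\<lambda>j. t *\<^sub>R pse (munit (exl j)))
     (\<lambda>B. P B + t *\<^sub>R (\<Sum>j\<in>UNIV. psr_rint j (f B j)))
     (\<lambda>B G. Q B G + (t / s) *\<^sub>R (\<Sum>j\<in>UNIV. psr_rint_diff G j (f B j)))"

text \<open>Banach's theorem for the family f. Jets must stay within r/2 for the Lipschitz bound on
  substitution; the datum takes up r/4, and the integral terms are brought below r/4 by the choice
  of \<open>t\<close>.\<close>

lemma ck_fixed_point:
  fixes c :: "'m::finite \<Rightarrow> 'l::finite \<Rightarrow> (('k::finite, 'l, 'm) jetpt \<Rightarrow> nat) \<Rightarrow> real"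
  assumes r: "r > 0" and conv: "\<And>A j. mconv (c A j) r" and s: "0 < s" "s \<le> r / 2"
    and P: "\<And>B. norm (P B) \<le> r / 4" and Q: "\<And>B G. norm (Q B G) \<le> r / 4"
  obtains t f where "t > 0" "\<And>b. b \<in> Basis \<Longrightarrow> norm (ck_map s t P Q f b) \<le> r / 2"
    "\<And>A j. f A j = msubst (c A j) (ck_map s t P Q f)"
proof -
  \<comment> \<open>A common bound for the norms of all expansions; the summand 1 keeps it
    positive.\<close>
  define M where "M = 1 + (\<Sum>A\<in>UNIV. \<Sum>j\<in>UNIV. mnorm (c A j) r)"
  have M_ge: "mnorm (c A j) r \<le> M" for A j
  proof -
    have "mnorm (c A j) r \<le> (\<Sum>j\<in>UNIV. mnorm (c A j) r)"
      by (rule member_le_sum) (use r in \<open>auto intro: mnorm_nonneg\<close>)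
    also have "\<dots> \<le> (\<Sum>A\<in>UNIV. \<Sum>j\<in>UNIV. mnorm (c A j) r)"
      by (rule member_le_sum[of A UNIV "\<lambda>A. \<Sum>j\<in>UNIV. mnorm (c A j) r"]) (use r in \<open>auto intro!: mnorm_nonneg sum_nonneg\<close>)
    finally show ?thesis by (simp add: M_def)
  qed
  have M: "M \<ge> 1" using r by (auto simp: M_def intro!: sum_nonneg mnorm_nonneg)
  define l where "l = real CARD('l)"
  define q where "q = real CARD('m \<times> 'l)"
  have l: "l \<ge> 1" unfolding l_def using finite_UNIV_card_ge_0[where 'a = 'l] by (simp add: Suc_le_eq)
  have "1 \<le> CARD('m \<times> 'l)" using zero_less_card_finite[where 'a = "'m \<times> 'l"] by linarith
  from of_nat_mono[OF this, where 'a = real] have q: "q \<ge> 1" by (simp add: q_def)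
  \<comment> \<open>This makes \<epsilon> l M at most r/4, which keeps jets within r/2, and makes
    \<epsilon> l q M / r equal to the contraction constant 1/4.\<close>
  define \<epsilon> where "\<epsilon> = r / (4 * l * q * M)"
  have \<epsilon>: "\<epsilon> > 0" using r l q M by (simp add: \<epsilon>_def)
  have \<epsilon>_eq: "\<epsilon> * l * q * M = r / 4" using l q M by (simp add: \<epsilon>_def)
  have lqM: "1 \<le> l * q * M" using mult_mono[OF mult_mono[OF l q] M] l q by simp
  have \<epsilon>_le: "\<epsilon> \<le> r / 4"
  proof -
    have "\<epsilon> * 1 \<le> \<epsilon> * (l * q * M)" using \<epsilon> by (intro mult_left_mono[OF lqM]) simp
    also have "\<dots> = r / 4" using \<epsilon>_eq by (simp only: mult.assoc)
    finally show ?thesis by simp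
  qed
  have \<epsilon>_lM: "\<epsilon> * l * M \<le> r / 4"
  proof -
    have "\<epsilon> * l * M * 1 \<le> \<epsilon> * l * M * q" using q \<epsilon> l M by (intro mult_left_mono) auto
    thus ?thesis using \<epsilon>_eq by (simp add: mult_ac)
  qed
  \<comment> \<open>Both \<open>t\<close>, in front of the correction of \<open>u\<close>, and
    \<open>t / s\<close>, in front of that of its derivatives, have to be at most
    \<epsilon>.\<close>
  define t where "t = min \<epsilon> (\<epsilon> * s)"
  have t: "t > 0" using \<epsilon> s by (simp add: t_def)
  have t_le: "t \<le> \<epsilon>" "t / s \<le> \<epsilon>"
    using s by (simp_all add: t_def divide_le_eq)
  have S_le: "norm (k *\<^sub>R (\<Sum>j\<in>(UNIV::'l set). g j)) \<le> \<epsilon> * l * m"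
    if "\<And>j. norm (g j :: ('k, 'l) base psr) \<le> m" "0 \<le> k" "k \<le> \<epsilon>" for k g m
  proof -
    have m: "0 \<le> m" using that(1)[of undefined] norm_ge_zero order.trans by blast
    have "norm (\<Sum>j\<in>(UNIV::'l set). g j) \<le> (\<Sum>j\<in>(UNIV::'l set). m)"
      by (rule order.trans[OF norm_sum sum_mono]) (use that in auto)
    hence "k * norm (\<Sum>j\<in>(UNIV::'l set). g j) \<le> \<epsilon> * (l * m)"
      using that \<epsilon> m by (intro mult_mono) (auto simp: l_def)
    thus ?thesis using that by (simp add: mult.assoc)
  qed
  have H_le: "norm (ck_map s t P Q f b) \<le> r / 2" if "b \<in> Basis" "\<And>B j. norm (f B j) \<le> M" for f b
    using that(1)
  proof (cases rule: Basis_jet_cases)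
    case (3 B)
    have "norm (t *\<^sub>R (\<Sum>j\<in>UNIV. psr_rint j (f B j))) \<le> \<epsilon> * l * M"
      by (rule S_le) (use t t_le order.trans[OF norm_psr_rint_le that(2)] in auto)
    thus ?thesis unfolding 3 ck_map_def jmap_simps
      by (intro norm_triangle_le) (use P[of B] \<epsilon>_lM in linarith)
  next
    case (4 B G)
    have "norm ((t / s) *\<^sub>R (\<Sum>j\<in>UNIV. psr_rint_diff G j (f B j))) \<le> \<epsilon> * l * M"
      by (rule S_le) (use s t t_le order.trans[OF norm_psr_rint_diff_le that(2)] in auto)
    thus ?thesis unfolding 4 ck_map_def jmap_simps
      by (intro norm_triangle_le) (use Q[of B G] \<epsilon>_lM in linarith)
  next
    case (1 G)
    show ?thesis unfolding 1 ck_map_def jmap_simps using s by simp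
  next
    case (2 j)
    show ?thesis unfolding 2 ck_map_def jmap_simps using t t_le \<epsilon>_le r by simp
  qed
  have H_diff: "norm (ck_map s t P Q f b - ck_map s t P Q g b) \<le> \<epsilon> * l * d"
    if "b \<in> Basis" "\<And>B j. norm (f B j - g B j) \<le> d" for f g b d
  proof -
    have "0 \<le> d" using that(2)[of undefined undefined] norm_ge_zero order.trans by blast
    hence ld: "0 \<le> \<epsilon> * l * d" using \<epsilon> l by simp
    show ?thesis
      using that(1)
    proof (cases rule: Basis_jet_cases)
      case (3 B)
      have "ck_map s t P Q f b - ck_map s t P Q g b = t *\<^sub>R (\<Sum>j\<in>UNIV. psr_rint j (f B j - g B j))"
        unfolding 3 ck_map_def jmap_simps
        by (simp add: linear_diff[OF bounded_linear.linear[OF bounded_linear_psr_rint]] sum_subtractf scaleR_diff_right)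
      also have "norm \<dots> \<le> \<epsilon> * l * d"
        by (rule S_le) (use t t_le order.trans[OF norm_psr_rint_le that(2)] in auto)
      finally show ?thesis .
    next
      case (4 B G)
      have "ck_map s t P Q f b - ck_map s t P Q g b = (t / s) *\<^sub>R (\<Sum>j\<in>UNIV. psr_rint_diff G j (f B j - g B j))"
        unfolding 4 ck_map_def jmap_simps
        by (simp add: linear_diff[OF bounded_linear.linear[OF bounded_linear_psr_rint_diff]] sum_subtractf scaleR_diff_right)
      also have "norm \<dots> \<le> \<epsilon> * l * d"
        by (rule S_le) (use s t t_le order.trans[OF norm_psr_rint_diff_le that(2)] in auto)
      finally show ?thesis .
    qed (simp_all add: ck_map_def ld)
  qed
  define fam :: "('k, 'l) base psr ^ ('m \<times> 'l) \<Rightarrow> 'm \<Rightarrow> 'l \<Rightarrow> ('k, 'l) base psr" where "fam v B j = v $ (B, j)" for v B j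
  define T where "T v = (\<chi> i. msubst (c (fst i) (snd i)) (ck_map s t P Q (fam v)))" for v
  define X where "X = {v :: ('k, 'l) base psr ^ ('m \<times> 'l). \<forall>i. norm (v $ i) \<le> M}"
  have "\<exists>!v\<in>X. T v = v"
  proof (rule Banach_fix)
    have "closed X" unfolding X_def
      by (intro closed_Collect_all closed_Collect_le continuous_intros)
    thus "complete X" by (simp add: complete_eq_closed)
    have "0 \<in> X" using M by (simp add: X_def)
    thus "X \<noteq> {}" by blast
    show "T ` X \<subseteq> X"
    proof
      fix w assume "w \<in> T ` X"
      then obtain v where v: "w = T v" "\<And>i. norm (v $ i) \<le> M" by (auto simp: X_def)
      have "norm (w $ i) \<le> M" for i
      proof -
        have "norm (msubst (c (fst i) (snd i)) (ck_map s t P Q (fam v))) \<le> mnorm (c (fst i) (snd i)) r"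
        proof (rule norm_msubst_le[OF conv])
          fix b :: "('k, 'l, 'm) jetpt" assume "b \<in> Basis"
          hence "norm (ck_map s t P Q (fam v) b) \<le> r / 2" by (rule H_le) (simp add: fam_def v)
          thus "norm (ck_map s t P Q (fam v) b) \<le> r" using r by linarith
        qed
        thus ?thesis using M_ge[of "fst i" "snd i"] by (simp add: v T_def)
      qed
      thus "w \<in> X" by (simp add: X_def)
    qed
    fix v w assume vw: "v \<in> X" "w \<in> X"
    define d where "d = norm (v - w)"
    have comp: "norm (fam v B j - fam w B j) \<le> d" for B j
      using Finite_Cartesian_Product.norm_nth_le[of "v - w" "(B, j)"] by (simp add: fam_def d_def)
    have "norm ((T v - T w) $ i) \<le> M / r * (\<epsilon> * l * d)" for i
    proof -
      have "norm (msubst (c (fst i) (snd i)) (ck_map s t P Q (fam v)) - msubst (c (fst i) (snd i)) (ck_map s t P Q (fam w)))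
        \<le> mnorm (c (fst i) (snd i)) r / r * (\<epsilon> * l * d)"
      proof (rule msubst_lipschitz[OF conv r])
        fix b :: "('k, 'l, 'm) jetpt" assume b: "b \<in> Basis"
        show "norm (ck_map s t P Q (fam v) b) \<le> r / 2" "norm (ck_map s t P Q (fam w) b) \<le> r / 2"
          using vw by (intro H_le[OF b]; simp add: X_def fam_def)+
        show "norm (ck_map s t P Q (fam v) b - ck_map s t P Q (fam w) b) \<le> \<epsilon> * l * d"
          by (rule H_diff[OF b comp])
      qed
      also have "\<dots> \<le> M / r * (\<epsilon> * l * d)"
        using M_ge r \<epsilon> l by (intro mult_right_mono divide_right_mono) (auto simp: d_def)
      finally show ?thesis by (simp add: T_def)
    qed
    \<comment> \<open>The Euclidean norm on the product is bounded by the sum of the component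
      norms, which is why the number \<open>q\<close> of components enters \<epsilon>.\<close>
    hence "(\<Sum>i\<in>UNIV. norm ((T v - T w) $ i)) \<le> (\<Sum>i\<in>(UNIV::('m \<times> 'l) set). M / r * (\<epsilon> * l * d))"
      by (intro sum_mono)
    also have "\<dots> = (\<epsilon> * l * q * M) / r * d" by (simp add: q_def)
    also have "\<dots> = 1 / 4 * d" unfolding \<epsilon>_eq using r by simp
    finally show "dist (T v) (T w) \<le> 1 / 4 * dist v w"
      using L2_set_le_sum[of UNIV "\<lambda>i. norm ((T v - T w) $ i)"] by (simp add: dist_norm norm_vec_def[of "T v - T w"] d_def)
  qed auto
  then obtain v where v: "v \<in> X" "T v = v" by blast
  show ?thesis
  proof (rule that[OF t, of "fam v"])
    show "norm (ck_map s t P Q (fam v) b) \<le> r / 2" if "b \<in> Basis" for b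
      using that by (rule H_le) (use v(1) in \<open>simp add: X_def fam_def\<close>)
    show "fam v A j = msubst (c A j) (ck_map s t P Q (fam v))" for A j
      using arg_cong[OF v(2), of "\<lambda>v. v $ (A, j)"] by (simp add: T_def fam_def)
  qed
qed

section \<open>Coordinates with separate tangential and transversal scales\<close>

definition rescale :: "('k::finite, 'l::finite) base \<Rightarrow> real \<Rightarrow> real \<Rightarrow> ('k, 'l) base \<Rightarrow> ('k, 'l) base" where
  "rescale x0 s t x = ((fst x - fst x0) /\<^sub>R s, (snd x - snd x0) /\<^sub>R t)"

text \<open>The half side is the radius at which evaluation and the derivative functionals are
  bounded simultaneously.\<close>

definition rescaled_box :: "('k::finite, 'l::finite) base \<Rightarrow> real \<Rightarrow> real \<Rightarrow> ('k, 'l) base set" where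
  "rescaled_box x0 s t = {x. \<forall>b\<in>Basis. \<bar>rescale x0 s t x \<bullet> b\<bar> < 1 / (2 * real DIM(('k, 'l) base))}"

context
  fixes x0 :: "('k::finite, 'l::finite) base" and s t :: real
  assumes s: "s > 0" and t: "t > 0"
begin

lemma open_rescaled_box: "open (rescaled_box x0 s t)"
proof -
  have "rescaled_box x0 s t = (\<Inter>b\<in>Basis. {x. \<bar>rescale x0 s t x \<bullet> b\<bar> < 1 / (2 * real DIM(('k, 'l) base))})"
    by (auto simp: rescaled_box_def)
  moreover have "open {x. \<bar>rescale x0 s t x \<bullet> b\<bar> < 1 / (2 * real DIM(('k, 'l) base))}" for b
    unfolding rescale_def by (intro open_Collect_less continuous_intros)
  ultimately show ?thesis by auto
qed

lemma center_rescaled_box: "x0 \<in> rescaled_box x0 s t"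
  by (simp add: rescaled_box_def rescale_def zero_prod_def[symmetric] add_pos_pos)

lemma rescaled_boxD:
  assumes "x \<in> rescaled_box x0 s t" "b \<in> Basis"
  shows "\<bar>rescale x0 s t x \<bullet> b\<bar> \<le> 1 / (2 * real DIM(('k, 'l) base))" "\<bar>rescale x0 s t x \<bullet> b\<bar> < 1 / real DIM(('k, 'l) base)"
    "\<bar>rescale x0 s t x \<bullet> b\<bar> \<le> 1 / real DIM(('k, 'l) base)"
proof -
  have 1: "\<bar>rescale x0 s t x \<bullet> b\<bar> < 1 / (2 * real DIM(('k, 'l) base))"
    using assms by (auto simp: rescaled_box_def)
  have "1 / (2 * d) \<le> 1 / d" if "d > 0" for d :: real
    using that by (simp add: field_simps)
  from this[of "real DIM(('k, 'l) base)"]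
  have 2: "1 / (2 * real DIM(('k, 'l) base)) \<le> 1 / real DIM(('k, 'l) base)"
    using DIM_positive[where 'a = "('k, 'l) base"] by linarith
  show "\<bar>rescale x0 s t x \<bullet> b\<bar> \<le> 1 / (2 * real DIM(('k, 'l) base))" "\<bar>rescale x0 s t x \<bullet> b\<bar> < 1 / real DIM(('k, 'l) base)"
    "\<bar>rescale x0 s t x \<bullet> b\<bar> \<le> 1 / real DIM(('k, 'l) base)"
    using 1 2 by linarith+
qed

lemma rescale_components: "fst (rescale x0 s t x) $ G = (1 / s) * (fst x $ G - fst x0 $ G)"
  "snd (rescale x0 s t x) $ j = (1 / t) * (snd x $ j - snd x0 $ j)"
  by (simp_all add: rescale_def divide_inverse)

lemma rescale_analytic:
  assumes "b \<in> Basis"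
  shows "real_analytic_on (\<lambda>x. rescale x0 s t x \<bullet> b) S"
  using assms
proof (cases rule: Basis_base_cases)
  case (1 G)
  show ?thesis unfolding 1 inner_exk rescale_components
    by (intro real_analytic_on_cmult real_analytic_on_diff real_analytic_on_coord real_analytic_on_const)
next
  case (2 j)
  show ?thesis unfolding 2 inner_exl rescale_components
    by (intro real_analytic_on_cmult real_analytic_on_diff real_analytic_on_coord real_analytic_on_const)
qed

lemma real_analytic_on_psr_eval:
  "real_analytic_on (\<lambda>h. psr_eval h \<phi>) {h :: ('k, 'l) base. \<forall>b\<in>Basis. \<bar>h \<bullet> b\<bar> < 1 / real DIM(('k, 'l) base)}"
  by (rule real_analytic_on_box[OF mexpand_psr_eval]) (simp del: DIM_prod)

lemma real_analytic_on_rescaled: "real_analytic_on (\<lambda>x. psr_eval (rescale x0 s t x) \<phi>) (rescaled_box x0 s t)"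
  by (rule real_analytic_on_compose[OF real_analytic_on_psr_eval]) (auto intro: rescale_analytic rescaled_boxD simp del: DIM_prod)

lemma pdiff_rescaled:
  assumes x: "x \<in> rescaled_box x0 s t"
  shows "pdiff (\<lambda>x. psr_eval (rescale x0 s t x) \<phi>) (exk G) x = (1 / s) * psr_deval (exk G) (rescale x0 s t x) \<phi>"
    and "pdiff (\<lambda>x. psr_eval (rescale x0 s t x) \<phi>) (exl j) x = (1 / t) * psr_deval (exl j) (rescale x0 s t x) \<phi>"
proof -
  let ?h = "rescale x0 s t x"
  have "pdiff (\<lambda>x. psr_eval (rescale x0 s t x) \<phi>) v x = (\<Sum>b\<in>Basis. pdiff (\<lambda>h. psr_eval h \<phi>) b ?h * pdiff (\<lambda>x. rescale x0 s t x \<bullet> b) v x)" for v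
    by (rule pdiff_compose[OF real_analytic_on_psr_eval, where S = UNIV]) (use x in \<open>auto intro: rescale_analytic rescaled_boxD simp del: DIM_prod\<close>)
  also have "\<dots> v = (\<Sum>b\<in>Basis. psr_deval b ?h \<phi> * pdiff (\<lambda>x. rescale x0 s t x \<bullet> b) v x)" for v
    by (intro sum.cong refl) (subst pdiff_psr_eval, use rescaled_boxD(2)[OF x] in auto)
  finally have *: "pdiff (\<lambda>x. psr_eval (rescale x0 s t x) \<phi>) v x = (\<Sum>b\<in>Basis. psr_deval b ?h \<phi> * pdiff (\<lambda>x. rescale x0 s t x \<bullet> b) v x)" for v .
  have c: "real_analytic_on (\<lambda>x :: ('k, 'l) base. fst x $ G' - fst x0 $ G') UNIV"
    "real_analytic_on (\<lambda>x :: ('k, 'l) base. snd x $ i - snd x0 $ i) UNIV"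
    for G' :: 'k and i :: 'l
    by (intro real_analytic_on_diff real_analytic_on_coord real_analytic_on_const)+
  have d: "pdiff (\<lambda>x. (1 / s) * (fst x $ G' - fst x0 $ G')) v x = (1 / s) * (fst v $ G')"
    "pdiff (\<lambda>x. (1 / t) * (snd x $ i - snd x0 $ i)) v x = (1 / t) * (snd v $ i)" for G' i v
    unfolding pdiff_cmult[OF c(1) UNIV_I] pdiff_cmult[OF c(2) UNIV_I]
      pdiff_diff[OF real_analytic_on_coord(1) real_analytic_on_const UNIV_I] pdiff_diff[OF real_analytic_on_coord(2) real_analytic_on_const UNIV_I]
      pdiff_coord pdiff_zero by simp_all
  have **: "pdiff (\<lambda>x. psr_eval (rescale x0 s t x) \<phi>) v x
     = (\<Sum>G\<in>UNIV. psr_deval (exk G) ?h \<phi> * ((1 / s) * (fst v $ G))) + (\<Sum>j\<in>UNIV. psr_deval (exl j) ?h \<phi> * ((1 / t) * (snd v $ j)))" for v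
    unfolding * sum_Basis_base inner_exk inner_exl rescale_components d ..
  show "pdiff (\<lambda>x. psr_eval (rescale x0 s t x) \<phi>) (exk G) x = (1 / s) * psr_deval (exk G) ?h \<phi>"
    unfolding ** by (simp add: exk_def axis_def if_distrib cong: if_cong)
  show "pdiff (\<lambda>x. psr_eval (rescale x0 s t x) \<phi>) (exl j) x = (1 / t) * psr_deval (exl j) ?h \<phi>"
    unfolding ** by (simp add: exl_def axis_def if_distrib cong: if_cong)
qed

end

section \<open>Construction of solutions\<close>

text \<open>The fixed point only provides series f. The function \<open>u\<close> is built from
  them, and one verifies that its jet is the evaluated \<open>ck_map\<close>, so that f evaluates to
  \<open>F\<close> along that jet.\<close>

lemma radial_solution_exists:
  fixes F :: "'m::finite \<Rightarrow> 'l::finite \<Rightarrow> ('k::finite,'l,'m) jetpt \<Rightarrow> real"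
  assumes "open U" and F: "\<And>A j. real_analytic_on (F A j) U" and w: "(x0, p0, p1) \<in> U"
    and a: "admissible_datum a x0 p0 p1"
  obtains V u where "open V" "x0 \<in> V" "\<And>A. real_analytic_on (\<lambda>x. u x $ A) V" "jet_of u ` V \<subseteq> U"
    "\<And>A x. x \<in> V \<Longrightarrow> (\<Sum>i\<in>UNIV. (snd x $ i - snd x0 $ i) * defect F u A i x) = 0"
    "\<And>y. (y, snd x0) \<in> V \<Longrightarrow> u (y, snd x0) = a y"
proof -
  obtain y0 z0 where x0: "x0 = (y0, z0)" by (metis surj_pair)
  define w0 :: "('k,'l,'m) jetpt" where "w0 = (x0, p0, p1)"
  have "\<forall>A j. \<exists>r c. mexpand (F A j) w0 r c"
    using F w unfolding real_analytic_on_iff_mexpand w0_def by blast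
  then obtain rF c where rF: "\<And>A j. mexpand (F A j) w0 (rF A j) (c A j)" by metis
  obtain e where e: "e > 0" "ball w0 e \<subseteq> U" using assms(1) w open_contains_ball unfolding w0_def by blast
  \<comment> \<open>Within the common radius of the expansions of \<open>F\<close>, and small enough
    that the cube about the base jet stays in \<open>U\<close>.\<close>
  define r where "r = min (Min (range (\<lambda>(A, j). rF A j))) (e / (2 * real DIM(('k,'l,'m) jetpt)))"
  have "Min (range (\<lambda>(A, j). rF A j)) > 0"
    using mexpandD(1)[OF rF] by (subst Min_gr_iff) auto
  moreover have "real DIM(('k,'l,'m) jetpt) > 0"
    using DIM_positive[where 'a = "('k,'l,'m) jetpt"] by linarith
  ultimately have r: "r > 0" using e unfolding r_def by (auto simp del: DIM_prod)
  have r_le: "r \<le> rF A j" for A j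
  proof -
    have "Min (range (\<lambda>(A, j). rF A j)) \<le> rF A j" by (rule Min_le) (auto intro: image_eqI[of _ _ "(A, j)"])
    thus ?thesis by (simp add: r_def)
  qed
  have expF: "mexpand (F A j) w0 r (c A j)" for A j
    by (rule mexpand_mono[OF rF r r_le])
  have in_U: "w0 + h \<in> U" if "\<And>b. b \<in> Basis \<Longrightarrow> \<bar>h \<bullet> b\<bar> \<le> r" for h
  proof -
    define d where "d = real DIM(('k,'l,'m) jetpt)"
    have d: "d > 0" using DIM_positive[where 'a = "('k,'l,'m) jetpt"] unfolding d_def by linarith
    have "norm h \<le> (\<Sum>b\<in>Basis. \<bar>h \<bullet> b\<bar>)" by (rule norm_le_l1)
    also have "\<dots> \<le> (\<Sum>b\<in>(Basis::('k,'l,'m) jetpt set). r)" by (intro sum_mono that)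
    also have "\<dots> = d * r" unfolding d_def by (simp del: DIM_prod)
    also have "\<dots> \<le> d * (e / (2 * d))" using d by (intro mult_left_mono) (auto simp: r_def d_def simp del: DIM_prod)
    also have "\<dots> < e" using d e by simp
    finally show ?thesis using e by (auto simp: dist_norm)
  qed
  obtain D where D: "open D" "y0 \<in> D" and a_an: "\<And>A. real_analytic_on (\<lambda>y. a y $ A) D" and a0: "a y0 = p0"
    and a1: "\<And>A G. pdiff (\<lambda>y. a y $ A) (axis G 1) y0 = p1 $ A $ G"
    using a unfolding admissible_datum_def x0 by auto
  have ax: "axis G (1::real) \<in> Basis" for G :: 'k by simp
  have "\<forall>A. \<exists>r c. mexpand (\<lambda>y. a y $ A) y0 r c"
    using a_an D(2) unfolding real_analytic_on_iff_mexpand by blast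
  then obtain ra ca where ra: "\<And>A. mexpand (\<lambda>y. a y $ A) y0 (ra A) (ca A)" by metis
  \<comment> \<open>Half of the common radius, because the expansions of the first derivatives of
    the datum are available on half of it.\<close>
  define \<rho> where "\<rho> = Min (range ra) / 2"
  have "Min (range ra) > 0" using mexpandD(1)[OF ra] by (subst Min_gr_iff) auto
  hence \<rho>: "\<rho> > 0" by (simp add: \<rho>_def)
  have "2 * \<rho> \<le> ra A" for A by (simp add: \<rho>_def)
  hence exp2: "mexpand (\<lambda>y. a y $ A) y0 (2 * \<rho>) (ca A)" for A
    using mexpand_mono[OF ra, of "2 * \<rho>"] \<rho> by simp
  have expa: "mexpand (\<lambda>y. a y $ A) y0 \<rho> (ca A)" for A
    using mexpand_mono[OF exp2, of \<rho>] \<rho> by simp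
  define cd where "cd A G = mderiv (axis G 1) (ca A)" for A G
  have expd: "mexpand (pdiff (\<lambda>y. a y $ A) (axis G 1)) y0 \<rho> (cd A G)" for A G
    using mexpand_pdiff[OF exp2 ax] by (simp add: cd_def)
  have ca0: "ca A 0 = p0 $ A" and cd0: "cd A G 0 = p1 $ A $ G" for A G
    using mexpand_center[OF expa] mexpand_center[OF expd] a0 a1 by simp_all
  define N where "N = 1 + (\<Sum>A\<in>UNIV. mnorm (ca A) \<rho>) + (\<Sum>A\<in>UNIV. \<Sum>G\<in>UNIV. mnorm (cd A G) \<rho>)"
  have nonneg: "mnorm (ca A) \<rho> \<ge> 0" "mnorm (cd A G) \<rho> \<ge> 0" for A G using \<rho> by (auto intro: mnorm_nonneg)
  have sums: "0 \<le> (\<Sum>A\<in>UNIV. mnorm (ca A) \<rho>)" "0 \<le> (\<Sum>G\<in>UNIV. mnorm (cd A G) \<rho>)"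
    "0 \<le> (\<Sum>A\<in>UNIV. \<Sum>G\<in>UNIV. mnorm (cd A G) \<rho>)" for A
    by (intro sum_nonneg nonneg)+
  have N_ca: "mnorm (ca A) \<rho> \<le> N" for A
    using member_le_sum[of A UNIV "\<lambda>A. mnorm (ca A) \<rho>"] nonneg(1) sums(3) by (simp add: N_def)
  have N_cd: "mnorm (cd A G) \<rho> \<le> N" for A G
    using member_le_sum[of G UNIV "\<lambda>G. mnorm (cd A G) \<rho>"] member_le_sum[of A UNIV "\<lambda>A. \<Sum>G\<in>UNIV. mnorm (cd A G) \<rho>"]
      nonneg(2) sums by (simp add: N_def)
  have N: "N \<ge> 1" using sums by (simp add: N_def)
  \<comment> \<open>\<rho> keeps the scaled variables inside the expansions of the datum, r/2 bounds
    the tangential coordinates of the jet, and the last bound makes \<open>P\<close> and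
    \<open>Q\<close> at most r/4.\<close>
  define s where "s = min (min \<rho> (r / 2)) (\<rho> * r / (4 * N))"
  have s: "s > 0" "s \<le> \<rho>" "s \<le> r / 2" using \<rho> r N by (auto simp: s_def)
  have sN: "s / \<rho> * N \<le> r / 4"
  proof -
    have "s \<le> \<rho> * r / (4 * N)" by (simp add: s_def)
    hence "s * N \<le> \<rho> * r / 4" using N by (simp add: field_simps)
    thus ?thesis using \<rho> by (simp add: field_simps)
  qed
  \<comment> \<open>The tangential displacement from the base point, as series in the rescaled
    coordinates.\<close>
  define X :: "real^'k \<Rightarrow> ('k, 'l) base psr" where "X b = s *\<^sub>R pse (munit (b, 0))" for b
  have pair: "(b, 0) \<in> (Basis :: ('k, 'l) base set)" if "b \<in> Basis" for b
    using that by (simp add: Basis_prod_def)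
  have X_le: "norm (X b) \<le> s" if "b \<in> Basis" for b
    using s pair[OF that] by (simp add: X_def)
  \<comment> \<open>The constant terms are removed because \<open>F\<close> is expanded about the
    base jet.\<close>
  define P where "P A = msubst (ca A) X - p0 $ A *\<^sub>R 1" for A
  define Q where "Q A G = msubst (cd A G) X - p1 $ A $ G *\<^sub>R 1" for A G
  have P_le: "norm (P A) \<le> r / 4" for A
  proof -
    have "norm (msubst (ca A) X - ca A 0 *\<^sub>R 1) \<le> s / \<rho> * mnorm (ca A) \<rho>"
      by (rule msubst_minus_const(1)[OF mexpandD(2)[OF expa]]) (use s X_le \<rho> in auto)
    also have "\<dots> \<le> s / \<rho> * N" using N_ca s \<rho> by (intro mult_left_mono) auto
    also note sN
    finally show ?thesis by (simp add: P_def ca0)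
  qed
  have Q_le: "norm (Q A G) \<le> r / 4" for A G
  proof -
    have "norm (msubst (cd A G) X - cd A G 0 *\<^sub>R 1) \<le> s / \<rho> * mnorm (cd A G) \<rho>"
      by (rule msubst_minus_const(1)[OF mexpandD(2)[OF expd]]) (use s X_le \<rho> in auto)
    also have "\<dots> \<le> s / \<rho> * N" using N_cd s \<rho> by (intro mult_left_mono) auto
    also note sN
    finally show ?thesis by (simp add: Q_def cd0)
  qed
  have convF: "mconv (c A j) r" for A j by (rule mexpandD(2)[OF expF])
  obtain t f where t: "t > 0" and H_le: "\<And>b. b \<in> Basis \<Longrightarrow> norm (ck_map s t P Q f b) \<le> r / 2"
    and f_eq: "\<And>A j. f A j = msubst (c A j) (ck_map s t P Q f)"
    by (rule ck_fixed_point[where c = c and P = P and Q = Q, OF r convF s(1,3) P_le Q_le]) (rule that)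
  define V where "V = rescaled_box x0 s t"
  note V_open = open_rescaled_box[OF s(1) t, of x0, folded V_def]
  note V_center = center_rescaled_box[OF s(1) t, of x0, folded V_def]
  let ?h = "rescale x0 s t"
  have box: "\<bar>?h x \<bullet> b\<bar> \<le> 1 / (2 * real DIM(('k, 'l) base))" "\<bar>?h x \<bullet> b\<bar> \<le> 1 / real DIM(('k, 'l) base)"
    if "x \<in> V" "b \<in> Basis" for x b
    using rescaled_boxD[OF s(1) t, of x x0 b] that unfolding V_def by auto
  define fn where "fn \<phi> x = psr_eval (?h x) \<phi>" for \<phi> x
  have fn_an: "real_analytic_on (fn \<phi>) V" for \<phi>
    using real_analytic_on_rescaled[OF s(1) t, of x0 \<phi>] unfolding V_def fn_def .
  have fn_pdiff: "pdiff (fn \<phi>) (exk G) x = (1 / s) * psr_deval (exk G) (?h x) \<phi>"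
    "pdiff (fn \<phi>) (exl j) x = (1 / t) * psr_deval (exl j) (?h x) \<phi>" if "x \<in> V" for \<phi> G j x
    using pdiff_rescaled[OF s(1) t, of x x0 \<phi>] that unfolding V_def fn_def by auto
  have scale_y: "s * (fst (?h x) \<bullet> b) = (fst x - y0) \<bullet> b" for x b
    using s by (simp add: rescale_def x0)
  have small_y: "\<bar>(fst x - y0) \<bullet> b\<bar> \<le> \<rho>" if "x \<in> V" "b \<in> Basis" for x b
  proof -
    have "\<bar>?h x \<bullet> (b, 0)\<bar> \<le> 1 / real DIM(('k, 'l) base)" by (rule box(2)[OF that(1) pair[OF that(2)]])
    also have "\<dots> \<le> 1" using DIM_positive[where 'a = "('k, 'l) base"] by (simp add: divide_le_eq Suc_le_eq del: DIM_prod)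
    finally have "\<bar>fst (?h x) \<bullet> b\<bar> \<le> 1" by (simp add: inner_prod_def)
    hence "s * \<bar>fst (?h x) \<bullet> b\<bar> \<le> \<rho> * 1" using s by (intro mult_mono) auto
    thus ?thesis unfolding scale_y[of x b, symmetric] using s by (simp add: abs_mult)
  qed
  have fn_msubst: "fn (msubst d X) x = g (fst x)" if d: "mexpand g y0 \<rho> d" and x: "x \<in> V" for d g x
  proof -
    have "fn (msubst d X) x = msubst d (\<lambda>b. psr_eval (?h x) (X b))"
      unfolding fn_def by (rule psr_eval_msubst[OF box(2)[OF x] mexpandD(2)[OF d]]) (use X_le s in force)+
    also have "\<dots> = msubst d (\<lambda>b. (fst x - y0) \<bullet> b)"
    proof (rule msubst_cong)
      fix b :: "real^'k" assume b: "b \<in> Basis"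
      have "psr_eval (?h x) (X b) = s * psr_eval (?h x) (pse (munit (b, 0)))"
        unfolding X_def by (rule psr_eval_scaleR[OF box(2)[OF x]])
      also have "\<dots> = s * (fst (?h x) \<bullet> b)" using pair[OF b] by (simp add: inner_prod_def)
      finally show "psr_eval (?h x) (X b) = (fst x - y0) \<bullet> b" by (simp only: scale_y)
    qed
    also have "\<dots> = g (y0 + (fst x - y0))"
      by (rule mexpandD(3)[OF d, symmetric]) (rule small_y[OF x])
    finally show ?thesis by simp
  qed
  have fn_a: "fn (msubst (ca A) X) x = a (fst x) $ A" if "x \<in> V" for A x
    using fn_msubst[OF expa that] .
  have fn_da: "fn (msubst (cd A G) X) x = pdiff (\<lambda>y. a y $ A) (axis G 1) (fst x)" if "x \<in> V" for A G x
    using fn_msubst[OF expd that] .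
  \<comment> \<open>The datum, extended constantly in the transversal directions, plus the radial
    integral of f; the factor \<open>t\<close> converts the rescaled transversal coordinate
    back.\<close>
  define u where "u x = (\<chi> A. fn (msubst (ca A) X) x + t * (\<Sum>j\<in>UNIV. fn (psr_rint j (f A j)) x))" for x
  have u_comp: "(\<lambda>x. u x $ A) = (\<lambda>x. fn (msubst (ca A) X) x + t * (\<Sum>j\<in>UNIV. fn (psr_rint j (f A j)) x))" for A
    by (simp add: u_def)
  have sum_an: "real_analytic_on (\<lambda>x. \<Sum>j\<in>UNIV. fn (psr_rint j (f A j)) x) V" for A
    by (intro real_analytic_on_sum fn_an)
  have u_an: "real_analytic_on (\<lambda>x. u x $ A) V" for A
    unfolding u_comp by (intro real_analytic_on_add fn_an real_analytic_on_cmult sum_an)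
  have u_pdiff: "pdiff (\<lambda>x. u x $ A) v x = pdiff (fn (msubst (ca A) X)) v x + t * (\<Sum>j\<in>UNIV. pdiff (fn (psr_rint j (f A j))) v x)"
    if "x \<in> V" for A v x
    unfolding u_comp pdiff_add[OF fn_an real_analytic_on_cmult[OF sum_an] that] pdiff_cmult[OF sum_an that]
    by (subst pdiff_sum[OF fn_an that]) (rule refl)
  have a_exk: "pdiff (fn (msubst (ca A) X)) (exk G) x = fn (msubst (cd A G) X) x" if "x \<in> V" for A G x
  proof -
    have "pdiff (fn (msubst (ca A) X)) (exk G) x = pdiff (\<lambda>x. a (fst x) $ A) (exk G) x"
      by (rule pdiff_cong[OF V_open that fn_a])
    also have "\<dots> = pdiff (\<lambda>y. a y $ A) (axis G 1) (fst x)"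
      by (simp add: pdiff_def exk_def)
    finally show ?thesis using fn_da[OF that] by simp
  qed
  have a_exl: "pdiff (fn (msubst (ca A) X)) (exl j) x = 0" if "x \<in> V" for A j x
  proof -
    have "pdiff (fn (msubst (ca A) X)) (exl j) x = pdiff (\<lambda>x. a (fst x) $ A) (exl j) x"
      by (rule pdiff_cong[OF V_open that fn_a])
    also have "\<dots> = 0" by (simp add: pdiff_def exl_def)
    finally show ?thesis .
  qed
  have u_exk: "pdiff (\<lambda>x. u x $ A) (exk G) x = fn (msubst (cd A G) X) x + (t / s) * (\<Sum>j\<in>UNIV. fn (psr_rint_diff G j (f A j)) x)"
    if x: "x \<in> V" for A G x
  proof -
    have "psr_deval (exk G) (?h x) (psr_rint j \<phi>) = fn (psr_rint_diff G j \<phi>) x" for j \<phi>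
      unfolding fn_def by (rule psr_deval_rint_exk) (rule box(1)[OF x])
    hence "pdiff (fn (psr_rint j \<phi>)) (exk G) x = (1 / s) * fn (psr_rint_diff G j \<phi>) x" for j \<phi>
      unfolding fn_pdiff(1)[OF x] by simp
    thus ?thesis
      unfolding u_pdiff[OF x] a_exk[OF x] by (simp flip: sum_divide_distrib)
  qed
  \<comment> \<open>The link between function and fixed point: the tangential derivatives of
    \<open>u\<close> are the evaluations of \<open>psr_rint_diff\<close>, exactly as anticipated in
    \<open>ck_map\<close>.\<close>
  have jet_eq: "(jet_of u x - w0) \<bullet> b = fn (ck_map s t P Q f b) x" if x: "x \<in> V" and b: "b \<in> Basis" for x b
  proof -
    note ev = psr_eval_add[OF box(2)[OF x]] psr_eval_scaleR[OF box(2)[OF x]] psr_eval_sum[OF box(2)[OF x]] psr_eval_1[OF box(2)[OF x]]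
      linear_diff[OF bounded_linear.linear[OF bounded_linear_psr_eval[OF box(2)[OF x]]]]
    from b show ?thesis
    proof (cases rule: Basis_jet_cases)
      case (1 G)
      have "psr_eval (?h x) (pse (munit (exk G))) = (1 / s) * (fst x $ G - fst x0 $ G)"
        using rescale_components(1)[OF s(1) t, of x0 x G] by (simp only: psr_eval_munit[OF exk_Basis] inner_exk)
      thus ?thesis using s unfolding 1 ck_map_def jmap_simps inner_jet fn_def w0_def by (simp add: ev)
    next
      case (2 j)
      have "psr_eval (?h x) (pse (munit (exl j))) = (1 / t) * (snd x $ j - snd x0 $ j)"
        using rescale_components(2)[OF s(1) t, of x0 x j] by (simp only: psr_eval_munit[OF exl_Basis] inner_exl)
      thus ?thesis using t unfolding 2 ck_map_def jmap_simps inner_jet fn_def w0_def by (simp add: ev)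
    next
      case (3 B)
      show ?thesis unfolding 3 ck_map_def jmap_simps inner_jet fn_def w0_def
        by (simp add: ev P_def) (simp add: u_def fn_def)
    next
      case (4 B G)
      show ?thesis unfolding 4 ck_map_def jmap_simps inner_jet fn_def w0_def
        by (simp add: ev Q_def u_exk[OF x]) (simp add: fn_def)
    qed
  qed
  have jet_small: "\<bar>(jet_of u x - w0) \<bullet> b\<bar> \<le> r" if x: "x \<in> V" and b: "b \<in> Basis" for x b
    using abs_psr_eval_le[OF box(2)[OF x], of "ck_map s t P Q f b"] H_le[OF b] r
    unfolding jet_eq[OF x b] fn_def by linarith
  have jet_U: "jet_of u ` V \<subseteq> U"
    using in_U[OF jet_small] by auto
  \<comment> \<open>Evaluation commutes with substitution, so the fixed point equation holds
    pointwise.\<close>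
  have F_jet: "F A j (jet_of u x) = fn (f A j) x" if x: "x \<in> V" for A j x
  proof -
    have "F A j (w0 + (jet_of u x - w0)) = msubst (c A j) (\<lambda>b. (jet_of u x - w0) \<bullet> b)"
      by (rule mexpandD(3)[OF expF]) (rule jet_small[OF x])
    also have "\<dots> = msubst (c A j) (\<lambda>b. psr_eval (?h x) (ck_map s t P Q f b))"
      by (rule msubst_cong) (simp only: jet_eq[OF x] fn_def)
    also have "\<dots> = psr_eval (?h x) (msubst (c A j) (ck_map s t P Q f))"
      by (rule psr_eval_msubst[OF box(2)[OF x] mexpandD(2)[OF expF], symmetric]) (use H_le r in force)+
    also have "\<dots> = fn (f A j) x" unfolding f_eq[of A j, symmetric] fn_def ..
    finally show ?thesis by simp
  qed
  have radial: "(\<Sum>i\<in>UNIV. (snd x $ i - snd x0 $ i) * defect F u A i x) = 0" if x: "x \<in> V" for A x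
  proof -
    have z: "snd x $ i - snd x0 $ i = t * snd (?h x) $ i" for i
      using t by (simp add: rescale_components[OF s(1) t])
    have "pdiff (\<lambda>x. u x $ A) (exl i) x = (\<Sum>j\<in>UNIV. psr_deval (exl i) (?h x) (psr_rint j (f A j)))" for i
      unfolding u_pdiff[OF x] a_exl[OF x] using t by (simp add: fn_pdiff(2)[OF x] flip: sum_divide_distrib)
    \<comment> \<open>The datum part has no transversal derivatives, so the Euler operator acts on
      the radial integrals only and returns \<zeta>_j f_j.\<close>
    hence "(\<Sum>i\<in>UNIV. (snd x $ i - snd x0 $ i) * pdiff (\<lambda>x. u x $ A) (exl i) x)
        = (\<Sum>i\<in>UNIV. \<Sum>j\<in>UNIV. t * (snd (?h x) $ i * psr_deval (exl i) (?h x) (psr_rint j (f A j))))"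
      unfolding z by (simp add: sum_distrib_left mult_ac)
    also have "\<dots> = (\<Sum>j\<in>UNIV. t * (\<Sum>i\<in>UNIV. snd (?h x) $ i * psr_deval (exl i) (?h x) (psr_rint j (f A j))))"
      by (subst sum.swap) (simp add: sum_distrib_left)
    also have "\<dots> = (\<Sum>j\<in>UNIV. (snd x $ j - snd x0 $ j) * F A j (jet_of u x))"
    proof -
      have "(\<Sum>i\<in>UNIV. snd (?h x) $ i * psr_deval (exl i) (?h x) (psr_rint j \<phi>)) = snd (?h x) $ j * fn \<phi> x" for j \<phi>
        unfolding fn_def by (rule psr_deval_rint_radial) (rule box(1)[OF x])
      thus ?thesis unfolding z F_jet[OF x] by (simp add: mult.assoc)
    qed
    finally show ?thesis by (simp add: defect_def right_diff_distrib sum_subtractf)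
  qed
  have init: "u (y, snd x0) = a y" if y: "(y, snd x0) \<in> V" for y
  proof -
    have slice: "snd (?h (y, snd x0)) = 0" by (simp add: rescale_def)
    have "fn (psr_rint j (f A j)) (y, snd x0) = 0" for A j
      unfolding fn_def by (rule psr_eval_rint_slice[OF _ slice]) (rule box(1)[OF y])
    thus ?thesis using fn_a[OF y] by (simp add: u_def vec_eq_iff)
  qed
  show ?thesis
    by (rule that[OF V_open V_center u_an jet_U radial init])
qed

lemma cauchy_solution_exists:
  fixes F :: "'m::finite \<Rightarrow> 'l::finite \<Rightarrow> ('k::finite,'l,'m) jetpt \<Rightarrow> real"
  assumes U: "open U" and F: "\<And>A j. real_analytic_on (F A j) U" and w: "(x0, p0, p1) \<in> U"
    and a: "admissible_datum a x0 p0 p1"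
    and Phi: "\<And>w A a b. w \<in> U \<Longrightarrow> Phi F A a b w = Phi F A b a w"
    and Psi: "\<And>w A C G L a b. w \<in> U \<Longrightarrow> Psi F A G L a b C w = Psi F A G L b a C w"
  shows "\<exists>V u. cauchy_solution F U a x0 V u"
proof -
  obtain V u where V: "open V" "x0 \<in> V" and u: "\<And>A. real_analytic_on (\<lambda>x. u x $ A) V" and jet: "jet_of u ` V \<subseteq> U"
    and radial: "\<And>A x. x \<in> V \<Longrightarrow> (\<Sum>i\<in>UNIV. (snd x $ i - snd x0 $ i) * defect F u A i x) = 0"
    and init: "\<And>y. (y, snd x0) \<in> V \<Longrightarrow> u (y, snd x0) = a y"
    using radial_solution_exists[where F = F, OF U F w a] by blast
  have van: "van n (snd x0) V (defect F u A j)" for n A j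
    by (rule radial_solution_defect_van[where F = F, OF F V(1) u jet]) (rule radial Phi Psi, assumption)+
  have "\<exists>W. open W \<and> x0 \<in> W \<and> (\<forall>x\<in>W. defect F u A j x = 0)" for A j
  proof -
    have "(fst x0, snd x0) \<in> V" using V(2) by simp
    show ?thesis
    proof (rule van_all_imp_zero[OF V(1) van \<open>(fst x0, snd x0) \<in> V\<close>, of A j])
      fix W assume "open W" "(fst x0, snd x0) \<in> W" "\<And>x. x \<in> W \<Longrightarrow> defect F u A j x = 0"
      thus ?thesis by (intro exI[of _ W]) simp
    qed
  qed
  then obtain W where W: "\<And>A j. open (W A j)" "\<And>A j. x0 \<in> W A j" "\<And>A j x. x \<in> W A j \<Longrightarrow> defect F u A j x = 0"
    by metis
  \<comment> \<open>Each defect vanishes on a neighbourhood of its own; there are finitely many of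
    them.\<close>
  define V' where "V' = V \<inter> (\<Inter>A. \<Inter>j. W A j)"
  have "open V'" unfolding V'_def by (intro open_Int V(1) open_INT ballI W(1)) auto
  moreover have "x0 \<in> V'" using V(2) W(2) by (auto simp: V'_def)
  moreover have "real_analytic_on (\<lambda>x. u x $ A) V'" for A
    by (rule real_analytic_on_subset[OF u]) (simp add: V'_def)
  moreover have "pdiff (\<lambda>y. u y $ A) (exl j) x = F A j (jet_of u x)" if "x \<in> V'" for A j x
    using W(3)[of x A j] that by (auto simp: V'_def defect_def)
  ultimately have "cauchy_solution F U a x0 V' u"
    using jet init by (auto simp: cauchy_solution_def V'_def)
  thus ?thesis by blast
qed

section \<open>The equivalence\<close>

lemma cauchy_solution_imp_approx_solution:
  "cauchy_solution F U a x0 V u \<Longrightarrow> approx_solution F U a x0 u"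
  unfolding cauchy_solution_def approx_solution_def
  by (rule exI[of _ V]) (auto intro!: exI[of _ 0] exI[of _ 1])

theorem theorem1p1:
  fixes F :: "'m::finite \<Rightarrow> 'l::finite \<Rightarrow> ('k::finite,'l,'m) jetpt \<Rightarrow> real"
    and U :: "('k,'l,'m) jetpt set"
  assumes "open U"
    and "\<forall>A j. real_analytic_on (F A j) U"
  shows "((\<forall>w\<in>U. cauchy_solvable_at F U w) \<longleftrightarrow> (\<forall>w\<in>U. approx_solvable_at F U w))
       \<and> ((\<forall>w\<in>U. approx_solvable_at F U w) \<longleftrightarrow>
          (\<forall>w\<in>U. (\<forall>A a b. Phi F A a b w = Phi F A b a w) \<and>
                  (\<forall>A C G L a b. Psi F A G L a b C w = Psi F A G L b a C w)))"
proof -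
  let ?i = "\<forall>w\<in>U. cauchy_solvable_at F U w"
  let ?ii = "\<forall>w\<in>U. approx_solvable_at F U w"
  let ?iii = "\<forall>w\<in>U. (\<forall>A a b. Phi F A a b w = Phi F A b a w) \<and>
                  (\<forall>A C G L a b. Psi F A G L a b C w = Psi F A G L b a C w)"
  have F: "real_analytic_on (F A j) U" for A j using assms(2) by blast
  have 12: "?i \<Longrightarrow> ?ii"
    unfolding cauchy_solvable_at_def approx_solvable_at_def
    using cauchy_solution_imp_approx_solution by blast
  have 23: "?iii" if ?ii
  proof (intro ballI conjI allI)
    fix w A a b assume "w \<in> U"
    \<comment> \<open>The identity is affine in the free Hessian coefficient \<open>s\<close>: the
      value at \<open>s = 0\<close> gives the condition on \<open>Phi\<close>, and the difference of
      the values at 1 and 0 gives that on \<open>Psi\<close>.\<close>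
    note eq = approx_solvable_imp_symmetric[where F = F, OF F bspec[OF that this]]
    show "Phi F A a b w = Phi F A b a w"
      using eq[of A a b 0 undefined undefined undefined] by simp
    fix C G L
    show "Psi F A G L a b C w = Psi F A G L b a C w"
      using eq[of A a b 0 G L C] eq[of A a b 1 G L C] by simp
  qed
  have 31: "?i" if iii: ?iii
  proof
    fix w assume w: "w \<in> U"
    show "cauchy_solvable_at F U w"
      unfolding cauchy_solvable_at_def
    proof (intro allI impI conjI)
      fix a assume a: "admissible_datum a (fst w) (fst (snd w)) (snd (snd w))"
      show "\<exists>V u. cauchy_solution F U a (fst w) V u"
        by (rule cauchy_solution_exists[OF assms(1) F _ a]) (use iii w in auto)
      fix V1 u1 V2 u2
      assume "cauchy_solution F U a (fst w) V1 u1 \<and> cauchy_solution F U a (fst w) V2 u2"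
      thus "\<exists>W. open W \<and> fst w \<in> W \<and> (\<forall>x\<in>W. u1 x = u2 x)"
        by (elim conjE) (rule cauchy_solution_unique[where F = F, OF F])
    qed
  qed
  show ?thesis using 12 23 31 by blast
qed

end
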